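(* Let $\omega$ be a weight function (quasianalytic or non-quasianalytic). The Fréchet space $\mathcal{B}'_{\{\omega\}}(\mathbb{R}^d)$ satisfies $(\underline{DN})$.
   Context: $\mathbb{N}=\{0,1,2,\dots\}$ and $\mathbb{Z}_+=\{1,2,\dots\}$. $O$ and $o$ are understood as $t\to\infty$. **Weight functions.** A weight function is a continuous increasing (i.e. non-decreasing) function $\omega:[0,\infty)\to[0,\infty)$ with $\omega\equiv 0$ on $[0,1]$ such that: $(\alpha)$ $\omega(2t)=O(\omega(t))$; $(\beta)$ $\omega(t)=O(t)$; $(\gamma)$ $\log t=o(\omega(t))$; $(\delta)$ $\psi:[0,\infty)\to[0,\infty)$, $\psi(x):=\omega(e^x)$, is convex. It is quasianalytic if $\int_0^\infty \frac{\omega(t)}{1+t^2}\,dt=\infty$ and non-quasianalytic otherwise. The Young conjugate of $\psi$ is $\psi^*(y):=\sup_{x\ge 0}(xy-\psi(x))$, $y\ge0$. **The space.** For $n\in\mathbb{Z}_+$, $\mathcal{D}_{L^1,\omega,n}(\mathbb{R}^d)$ is the Banach space of all $\varphi\in C^\infty(\mathbb{R}^d)$ with $\varphi^{(\alpha)}\in L^1(\mathbb{R}^d)$ for all $\alpha\in\mathbb{N}^d$ and $\|\varphi\|_{\mathcal{D}_{L^1,\omega,n}}:=\sup_{\alpha\in\mathbb{N}^d}\|\varphi^{(\alpha)}\|_{L^1}\exp(-\frac1n\psi^*(n|\alpha|))<\infty$. Set $\mathcal{D}_{L^1,\{\omega\}}(\mathbb{R}^d):=\varinjlim_n\mathcal{D}_{L^1,\omega,n}(\mathbb{R}^d)$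 (locally convex inductive limit), and let $\mathcal{B}'_{\{\omega\}}(\mathbb{R}^d)$ be its dual endowed with the strong topology, which is a Fréchet space. **Condition $(\underline{DN})$.** A Fréchet space $X$ with a fundamental increasing sequence of seminorms $(\|\cdot\|_n)_{n\in\mathbb{N}}$ satisfies $(\underline{DN})$ if $$\exists n\ \forall m\ge n\ \exists\theta\in(0,1)\ \exists k\ge m\ \exists C>0\ \forall x\in X:\quad \|x\|_m\le C\,\|x\|_n^{\theta}\,\|x\|_k^{1-\theta}.$$ *)

theory Defs
  imports "HOL-Analysis.Analysis" "HOL-Library.Landau_Symbols"
begin

section \<open>Weight functions\<close>

text \<open>Only the values on \<open>[0,\<infinity>)\<close> matter; the Landau symbols are taken at \<open>at_top\<close>.\<close>

definition weight_function :: "(real \<Rightarrow> real) \<Rightarrow> bool" where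
  "weight_function \<omega> \<longleftrightarrow>
     continuous_on {0..} \<omega> \<and> mono_on {0..} \<omega> \<and> (\<forall>t\<ge>0. 0 \<le> \<omega> t) \<and> (\<forall>t\<in>{0..1}. \<omega> t = 0) \<and>
     (\<lambda>t. \<omega> (2 * t)) \<in> O(\<omega>) \<and>
     \<omega> \<in> O(\<lambda>t. t) \<and>
     (\<lambda>t. ln t) \<in> o(\<omega>) \<and>
     convex_on {0..} (\<lambda>x. \<omega> (exp x))"

text \<open>The Young conjugate of \<open>\<psi>(x) = \<omega>(e\<^sup>x)\<close>. For a weight function the supremum is finite,
  because \<open>log t = o(\<omega>(t))\<close> makes \<open>\<psi>\<close> grow superlinearly.\<close>

definition psi_star :: "(real \<Rightarrow> real) \<Rightarrow> real \<Rightarrow> real" where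
  "psi_star \<omega> y = (SUP x\<in>{0..}. x * y - \<omega> (exp x))"


section \<open>Smooth functions and the Banach spaces of the inductive system\<close>

definition partial :: "'d \<Rightarrow> (real^'d::finite \<Rightarrow> complex) \<Rightarrow> real^'d \<Rightarrow> complex" where
  "partial i f x = vector_derivative (\<lambda>t. f (x + t *\<^sub>R axis i 1)) (at 0)"

fun C_times :: "nat \<Rightarrow> (real^'d::finite \<Rightarrow> complex) \<Rightarrow> bool" where
  "C_times 0 f \<longleftrightarrow> continuous_on UNIV f"
| "C_times (Suc k) f \<longleftrightarrow> (\<forall>x. f differentiable (at x)) \<and> (\<forall>i. C_times k (partial i f))"

definition smooth :: "(real^'d::finite \<Rightarrow> complex) \<Rightarrow> bool" where
  "smooth f \<longleftrightarrow> (\<forall>k. C_times k f)"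

text \<open>Multi-indices are functions \<open>'d \<Rightarrow> nat\<close>. The partial derivatives are composed along an
  arbitrarily chosen enumeration of the coordinates; for smooth functions they commute, so the
  choice is irrelevant.\<close>

definition multi_deriv ::
    "('d \<Rightarrow> nat) \<Rightarrow> (real^'d::finite \<Rightarrow> complex) \<Rightarrow> real^'d \<Rightarrow> complex" where
  "multi_deriv \<alpha> f =
     foldr (\<lambda>i. partial i ^^ \<alpha> i) (SOME is. distinct is \<and> set is = UNIV) f"

definition multi_abs :: "('d::finite \<Rightarrow> nat) \<Rightarrow> nat" where
  "multi_abs \<alpha> = (\<Sum>i\<in>UNIV. \<alpha> i)"

definition weighted_L1 ::
    "(real \<Rightarrow> real) \<Rightarrow> nat \<Rightarrow> (real^'d::finite \<Rightarrow> complex) \<Rightarrow> ('d \<Rightarrow> nat) \<Rightarrow> real" where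
  "weighted_L1 \<omega> n \<phi> \<alpha> =
     (LINT x|lborel. norm (multi_deriv \<alpha> \<phi> x)) *
     exp (- (1 / real n) * psi_star \<omega> (real n * real (multi_abs \<alpha>)))"

definition DL1 :: "(real \<Rightarrow> real) \<Rightarrow> nat \<Rightarrow> (real^'d::finite \<Rightarrow> complex) set" where
  "DL1 \<omega> n = {\<phi>. smooth \<phi> \<and> (\<forall>\<alpha>. integrable lborel (multi_deriv \<alpha> \<phi>)) \<and>
                 bdd_above (range (weighted_L1 \<omega> n \<phi>))}"

definition DL1_norm :: "(real \<Rightarrow> real) \<Rightarrow> nat \<Rightarrow> (real^'d::finite \<Rightarrow> complex) \<Rightarrow> real" where
  "DL1_norm \<omega> n \<phi> = (SUP \<alpha>. weighted_L1 \<omega> n \<phi> \<alpha>)"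


section \<open>Locally convex spaces of complex-valued functions\<close>

text \<open>All vector spaces below are complex linear subspaces, with the pointwise operations, of some
  function space \<open>'a \<Rightarrow> complex\<close>. Seminorms are only constrained on the carrier.\<close>

definition complex_subspace :: "('a \<Rightarrow> complex) set \<Rightarrow> bool" where
  "complex_subspace X \<longleftrightarrow> (\<lambda>_. 0) \<in> X \<and> (\<forall>f\<in>X. \<forall>g\<in>X. (\<lambda>x. f x + g x) \<in> X) \<and>
     (\<forall>c. \<forall>f\<in>X. (\<lambda>x. c * f x) \<in> X)"

definition seminorm_on :: "('a \<Rightarrow> complex) set \<Rightarrow> (('a \<Rightarrow> complex) \<Rightarrow> real) \<Rightarrow> bool" where
  "seminorm_on X p \<longleftrightarrow> (\<forall>f\<in>X. 0 \<le> p f) \<and> (\<forall>f\<in>X. \<forall>g\<in>X. p (\<lambda>x. f x + g x) \<le> p f + p g) \<and>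
     (\<forall>c. \<forall>f\<in>X. p (\<lambda>x. c * f x) = norm c * p f)"

definition lc_topology ::
    "('a \<Rightarrow> complex) set \<Rightarrow> (('a \<Rightarrow> complex) \<Rightarrow> real) set \<Rightarrow> ('a \<Rightarrow> complex) topology" where
  "lc_topology X P = topology_generated_by
     {{g \<in> X. p (\<lambda>x. g x - f x) < e} | p f e. p \<in> P \<and> f \<in> X \<and> 0 < e}"

text \<open>The finest locally convex topology on the union of the steps for which all inclusions are
  continuous, i.e. the one generated by all seminorms with continuous restrictions to the steps.\<close>

definition ind_lim_topology ::
    "nat set \<Rightarrow> (nat \<Rightarrow> ('a \<Rightarrow> complex) set) \<Rightarrow> (nat \<Rightarrow> ('a \<Rightarrow> complex) \<Rightarrow> real) \<Rightarrow>
     ('a \<Rightarrow> complex) topology" where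
  "ind_lim_topology I E N = lc_topology (\<Union>n\<in>I. E n)
     {p. seminorm_on (\<Union>n\<in>I. E n) p \<and>
         (\<forall>n\<in>I. continuous_map (lc_topology (E n) {N n}) euclideanreal p)}"

definition vn_bounded :: "('a \<Rightarrow> complex) topology \<Rightarrow> ('a \<Rightarrow> complex) set \<Rightarrow> bool" where
  "vn_bounded T B \<longleftrightarrow> B \<subseteq> topspace T \<and>
     (\<forall>U. openin T U \<and> (\<lambda>_. 0) \<in> U \<longrightarrow>
        (\<exists>r>0. \<forall>c. norm c \<ge> r \<longrightarrow> B \<subseteq> (\<lambda>f x. c * f x) ` U))"

text \<open>Functionals are normalised to be \<open>0\<close> off the carrier, so that each one has a unique
  representative and the dual is again a space of complex-valued functions.\<close>

definition top_dual :: "('a \<Rightarrow> complex) topology \<Rightarrow> (('a \<Rightarrow> complex) \<Rightarrow> complex) set" where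
  "top_dual T = {u. (\<forall>f\<in>topspace T. \<forall>g\<in>topspace T. u (\<lambda>x. f x + g x) = u f + u g) \<and>
     (\<forall>c. \<forall>f\<in>topspace T. u (\<lambda>x. c * f x) = c * u f) \<and>
     (\<forall>f. f \<notin> topspace T \<longrightarrow> u f = 0) \<and> continuous_map T euclidean u}"

definition strong_dual_topology ::
    "('a \<Rightarrow> complex) topology \<Rightarrow> (('a \<Rightarrow> complex) \<Rightarrow> complex) topology" where
  "strong_dual_topology T = lc_topology (top_dual T)
     {(\<lambda>u. SUP f\<in>B. norm (u f)) | B. vn_bounded T B \<and> B \<noteq> {}}"


section \<open>Frechet spaces and the condition (DN)\<close>

text \<open>A fundamental increasing sequence of seminorms of the locally convex topology \<open>T\<close> on \<open>X\<close>.\<close>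

definition fundamental_seminorms ::
    "('a \<Rightarrow> complex) set \<Rightarrow> ('a \<Rightarrow> complex) topology \<Rightarrow> (nat \<Rightarrow> ('a \<Rightarrow> complex) \<Rightarrow> real) \<Rightarrow> bool"
where
  "fundamental_seminorms X T q \<longleftrightarrow> (\<forall>n. seminorm_on X (q n)) \<and>
     (\<forall>n. \<forall>f\<in>X. q n f \<le> q (Suc n) f) \<and> T = lc_topology X (range q)"

definition frechet_space :: "('a \<Rightarrow> complex) set \<Rightarrow> ('a \<Rightarrow> complex) topology \<Rightarrow> bool" where
  "frechet_space X T \<longleftrightarrow> complex_subspace X \<and> Hausdorff_space T \<and>
     (\<exists>q. fundamental_seminorms X T q \<and>
       (\<forall>s. (\<forall>j. s j \<in> X) \<and>
            (\<forall>n. \<forall>e>0. \<exists>M. \<forall>i\<ge>M. \<forall>j\<ge>M. q n (\<lambda>x. s i x - s j x) < e) \<longrightarrow>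
            (\<exists>l\<in>X. limitin T s l sequentially)))"

text \<open>The underlined condition (DN), required for every fundamental increasing sequence of
  seminorms (its validity does not depend on the choice of such a sequence).\<close>

definition satisfies_DN_underlined ::
    "('a \<Rightarrow> complex) set \<Rightarrow> ('a \<Rightarrow> complex) topology \<Rightarrow> bool" where
  "satisfies_DN_underlined X T \<longleftrightarrow> (\<forall>q. fundamental_seminorms X T q \<longrightarrow>
     (\<exists>n. \<forall>m\<ge>n. \<exists>\<theta>\<in>{0<..<1}. \<exists>k\<ge>m. \<exists>C>0. \<forall>x\<in>X.
        q m x \<le> C * q n x powr \<theta> * q k x powr (1 - \<theta>)))"


section \<open>The space of ultradistributions\<close>

definition DL1_ind_topology ::
    "(real \<Rightarrow> real) \<Rightarrow> (real^'d::finite \<Rightarrow> complex) topology" where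
  "DL1_ind_topology \<omega> = ind_lim_topology {1..} (DL1 \<omega>) (DL1_norm \<omega>)"

definition B_dual :: "(real \<Rightarrow> real) \<Rightarrow> ((real^'d::finite \<Rightarrow> complex) \<Rightarrow> complex) set" where
  "B_dual \<omega> = top_dual (DL1_ind_topology \<omega>)"

definition B_dual_topology ::
    "(real \<Rightarrow> real) \<Rightarrow> ((real^'d::finite \<Rightarrow> complex) \<Rightarrow> complex) topology" where
  "B_dual_topology \<omega> = strong_dual_topology (DL1_ind_topology \<omega>)"

end

(*
  The strong dual of a countable inductive limit of normed spaces E_n carries the norms ||u||_n
  dual to the unit balls B_n, because a set on which all continuous seminorms are bounded is
  controlled by a single ||.||_n (gliding hump). So DN is the estimate
  ||u||_m <= C ||u||_1^theta ||u||_k^(1-theta), and this follows by optimising over s >= 0 once every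
  f in B_m splits as f = g + h with ||g||_1 <= C exp(L s) and ||h||_k <= C exp(-b s), where L does
  not depend on m.

  For the splitting let A be the convolution with a band-limited, non-negative Jackson kernel at
  scale 1/R and put h = (1 - A)^N f, so that g = sum_{i<N} A (1 - A)^i f. Band-limitedness gives
  ||d^a g|| <= C (C R)^|a| 2^N ||f||, a first moment gives ||d^a h|| <= (C/R)^N max_b ||d^(a+b) f||
  with |b| = N. With rho = R/C, N about eta/(2m) and eta the slope of psi at log rho, Young
  duality turns these into exp(C omega(rho)) and exp(-omega(rho)/(4m)), for k = 2m; then s = omega(rho).
*)

theory Submission
  imports Defs
begin

section \<open>Locally convex topologies given by seminorms\<close>

text \<open>For quasianalytic omega the spaces contain no nonzero function of compact support, so
  neither cutoffs nor partitions of unity are available; hence the use of a kernel with compact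
  spectrum. Non-negativity and unit mass make A a contraction of L1, but a first moment yields only
  one factor 1/R per application. The power N of 1 - A turns this into a gain of order N, with N
  adapted to rho. The price 2^N falls on g alone, where it is harmless: N <= omega(e rho), and
  condition (alpha) bounds this by a multiple of omega(rho) + 1. No such factor appears in h,
  because each factor 1 - A is traded for one derivative. Doubling the index comes from convexity:
  psi*(m(p+q))/m <= psi*(2mp)/(2m) + psi*(2mq)/(2m) separates the order p of a derivative from the q
  = N derivatives that were spent. Rounding N to an integer costs a factor rho; condition (gamma)
  absorbs it in half of the decay exp(-omega(rho)/(2m)), which explains the exponent 1/(4m).\<close>

lemma cspace_zero: "complex_subspace X \<Longrightarrow> (\<lambda>_. 0) \<in> X"
  and cspace_add: "complex_subspace X \<Longrightarrow> f \<in> X \<Longrightarrow> g \<in> X \<Longrightarrow> (\<lambda>x. f x + g x) \<in> X"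
  and cspace_scale: "complex_subspace X \<Longrightarrow> f \<in> X \<Longrightarrow> (\<lambda>x. c * f x) \<in> X"
  by (auto simp: complex_subspace_def)

lemma cspace_diff:
  assumes "complex_subspace X" "f \<in> X" "g \<in> X"
  shows "(\<lambda>x. f x - g x) \<in> X"
  using cspace_add[OF assms(1,2) cspace_scale[OF assms(1,3), of "-1"]] by simp

lemma seminorm_nonneg: "seminorm_on X p \<Longrightarrow> f \<in> X \<Longrightarrow> 0 \<le> p f"
  and seminorm_add: "seminorm_on X p \<Longrightarrow> f \<in> X \<Longrightarrow> g \<in> X \<Longrightarrow> p (\<lambda>x. f x + g x) \<le> p f + p g"
  and seminorm_scale: "seminorm_on X p \<Longrightarrow> f \<in> X \<Longrightarrow> p (\<lambda>x. c * f x) = norm c * p f"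
  by (auto simp: seminorm_on_def)

lemma seminorm_zero:
  assumes "seminorm_on X p" "complex_subspace X"
  shows "p (\<lambda>_. 0) = 0"
  using seminorm_scale[OF assms(1) cspace_zero[OF assms(2)], of 0] by simp

lemma seminorm_minus_commute:
  assumes "seminorm_on X p" "complex_subspace X" "f \<in> X" "g \<in> X"
  shows "p (\<lambda>x. f x - g x) = p (\<lambda>x. g x - f x)"
  using seminorm_scale[OF assms(1) cspace_diff[OF assms(2-4)], of "-1"] by simp

lemma seminorm_triangle:
  assumes "seminorm_on X p" "complex_subspace X" "f \<in> X" "g \<in> X" "h \<in> X"
  shows "p (\<lambda>x. f x - h x) \<le> p (\<lambda>x. f x - g x) + p (\<lambda>x. g x - h x)"
  using seminorm_add[OF assms(1) cspace_diff[OF assms(2-4)] cspace_diff[OF assms(2,4,5)]]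
  by simp

lemma seminorm_diff_le:
  assumes "seminorm_on X p" "complex_subspace X" "f \<in> X" "g \<in> X"
  shows "p f - p g \<le> p (\<lambda>x. f x - g x)"
  using seminorm_add[OF assms(1) cspace_diff[OF assms(2-4)] assms(4)] by simp

lemma seminorm_abs_diff_le:
  assumes "seminorm_on X p" "complex_subspace X" "f \<in> X" "g \<in> X"
  shows "\<bar>p f - p g\<bar> \<le> p (\<lambda>x. f x - g x)"
  using seminorm_diff_le[OF assms] seminorm_diff_le[OF assms(1,2,4,3)]
    seminorm_minus_commute[OF assms] by linarith

lemma seminorm_sum:
  assumes "finite F" "\<forall>p\<in>F. seminorm_on X p"
  shows "seminorm_on X (\<lambda>f. \<Sum>p\<in>F. p f)"
  using assms unfolding seminorm_on_def
  by (auto intro!: sum_nonneg sum_mono simp: sum_distrib_left simp flip: sum.distrib)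

lemma seminorm_subset: "seminorm_on X p \<Longrightarrow> Y \<subseteq> X \<Longrightarrow> seminorm_on Y p"
  unfolding seminorm_on_def by blast

lemma seminorm_le_of_ball:
  assumes X: "complex_subspace X" and p: "seminorm_on X p" and q: "seminorm_on X q"
    and e: "e > 0" and ball: "\<And>f. f \<in> X \<Longrightarrow> q f < e \<Longrightarrow> p f < 1" and f: "f \<in> X"
  shows "p f \<le> q f / e"
proof (rule field_le_epsilon)
  fix d :: real assume d: "d > 0"
  have q0: "0 \<le> q f" using seminorm_nonneg[OF q f] .
  \<comment> \<open>The summand \<open>d * e\<close> keeps the denominator positive when
    \<open>q f = 0\<close> and puts the rescaled function strictly inside the ball.\<close>
  define t where "t = e / (q f + d * e)"
  have den: "q f + d * e > 0" using q0 d e by (simp add: add_nonneg_pos)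
  have t: "t > 0" using den e by (simp add: t_def)
  have "q (\<lambda>x. complex_of_real t * f x) = t * q f" using seminorm_scale[OF q f] t by simp
  also have "\<dots> < e" using den e d q0 by (simp add: t_def field_simps)
  finally have "p (\<lambda>x. complex_of_real t * f x) < 1"
    using ball cspace_scale[OF X f] by blast
  hence "t * p f < 1" using seminorm_scale[OF p f] t by simp
  hence "p f < (q f + d * e) / e" using den e by (simp add: t_def field_simps)
  also have "\<dots> = q f / e + d" using e by (simp add: field_simps)
  finally show "p f \<le> q f / e + d" by simp
qed

abbreviation sball ::
    "('a \<Rightarrow> complex) set \<Rightarrow> (('a \<Rightarrow> complex) \<Rightarrow> real) set \<Rightarrow> ('a \<Rightarrow> complex) \<Rightarrow> real \<Rightarrow> ('a \<Rightarrow> complex) set" where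
  "sball X F f e \<equiv> {g \<in> X. \<forall>p\<in>F. p (\<lambda>x. g x - f x) < e}"

abbreviation sball_inside ::
    "('a \<Rightarrow> complex) set \<Rightarrow> (('a \<Rightarrow> complex) \<Rightarrow> real) set \<Rightarrow> ('a \<Rightarrow> complex) \<Rightarrow> ('a \<Rightarrow> complex) set \<Rightarrow> bool" where
  "sball_inside X P f U \<equiv> \<exists>F e. finite F \<and> F \<subseteq> P \<and> e > 0 \<and> sball X F f e \<subseteq> U"

text \<open>The generating balls have arbitrary centres, and the triangle inequality recentres them
  at any of their points, so balls for finitely many seminorms around \<open>f\<close> form a
  neighbourhood basis. With \<open>P \<noteq> {}\<close> the generating balls cover
  \<open>X\<close>.\<close>

lemma openin_lc:
  assumes X: "complex_subspace X" and P: "\<forall>p\<in>P. seminorm_on X p" "P \<noteq> {}"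
  shows "openin (lc_topology X P) U \<longleftrightarrow> U \<subseteq> X \<and>
    (\<forall>f\<in>U. sball_inside X P f U)"
    (is "_ = (_ \<and> (\<forall>f\<in>U. ?N U f))")
proof
  assume "openin (lc_topology X P) U"
  hence "generate_topology_on {{g \<in> X. p (\<lambda>x. g x - f x) < e} | p f e. p \<in> P \<and> f \<in> X \<and> 0 < e} U"
    unfolding lc_topology_def openin_topology_generated_by_iff .
  thus "U \<subseteq> X \<and> (\<forall>f\<in>U. ?N U f)"
  proof induction
    case Empty thus ?case by simp
  next
    case (Int A B)
    have "?N (A \<inter> B) f" if fAB: "f \<in> A \<inter> B" for f
    proof -
      obtain F e where F: "finite F" "F \<subseteq> P" "e > 0" "sball X F f e \<subseteq> A"
        using bspec[OF conjunct2[OF Int.IH(1)] IntD1[OF fAB]] by blast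
      obtain G d where G: "finite G" "G \<subseteq> P" "d > 0" "sball X G f d \<subseteq> B"
        using bspec[OF conjunct2[OF Int.IH(2)] IntD2[OF fAB]] by blast
      have "{g \<in> X. \<forall>p\<in>F \<union> G. p (\<lambda>x. g x - f x) < min d e} \<subseteq> A \<inter> B"
        using F(4) G(4) by fastforce
      thus ?thesis using F G
        by (intro exI[of _ "F \<union> G"] exI[of _ "min d e"]) simp
    qed
    moreover have "A \<inter> B \<subseteq> X"
      by (rule order_trans[OF Int_lower1 conjunct1[OF Int.IH(1)]])
    ultimately show ?case by (intro conjI ballI)
  next
    case (UN K)
    have "?N (\<Union>K) f" if f: "f \<in> \<Union>K" for f
    proof -
      obtain k where k: "k \<in> K" "f \<in> k" using f by blast
      then obtain F e where F: "finite F" "F \<subseteq> P" "e > 0" "sball X F f e \<subseteq> k"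
        using bspec[OF conjunct2[OF UN.IH[OF k(1)]] k(2)] by blast
      have "sball X F f e \<subseteq> \<Union>K"
        by (rule order_trans[OF F(4) Union_upper[OF k(1)]])
      thus ?thesis using F(1-3) by (intro exI conjI)
    qed
    moreover have "\<Union>K \<subseteq> X"
      by (rule Union_least) (rule conjunct1[OF UN.IH])
    ultimately show ?case by (intro conjI ballI)
  next
    case (Basis s)
    then obtain p f e where s: "s = {g \<in> X. p (\<lambda>x. g x - f x) < e}" "p \<in> P" "f \<in> X" "0 < e" by blast
    have "?N s g" if g: "g \<in> s" for g
    proof (intro exI conjI)
      show "finite {p}" "{p} \<subseteq> P" "e - p (\<lambda>x. g x - f x) > 0" using s g by auto
      show "sball X {p} g (e - p (\<lambda>x. g x - f x)) \<subseteq> s"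
      proof clarify
        fix h assume h: "h \<in> X" "\<forall>p'\<in>{p}. p' (\<lambda>x. h x - g x) < e - p (\<lambda>x. g x - f x)"
        have "p (\<lambda>x. h x - f x) \<le> p (\<lambda>x. h x - g x) + p (\<lambda>x. g x - f x)"
          using seminorm_triangle[of X p h g f] P(1) X s g h by auto
        thus "h \<in> s" using h s by auto
      qed
    qed
    moreover have "s \<subseteq> X" unfolding s(1) by (rule Collect_restrict)
    ultimately show ?case by (intro conjI ballI)
  qed
next
  let ?S = "{{g \<in> X. p (\<lambda>x. g x - f x) < e} | p f e. p \<in> P \<and> f \<in> X \<and> 0 < e}"
  assume U: "U \<subseteq> X \<and> (\<forall>f\<in>U. ?N U f)"
  show "openin (lc_topology X P) U"
  proof (subst openin_subopen, intro ballI)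
    fix f assume f: "f \<in> U"
    then obtain F e where F: "finite F" "F \<subseteq> P" "e > 0" "sball X F f e \<subseteq> U"
      using bspec[OF conjunct2[OF U] f] by blast
    \<comment> \<open>\<open>F\<close> may be empty; adding \<open>p0\<close> makes the intersection
      run over a nonempty family.\<close>
    obtain p0 where p0: "p0 \<in> P" using P(2) by blast
    have fX: "f \<in> X" using f U by blast
    have "openin (lc_topology X P) (\<Inter>p\<in>insert p0 F. {g \<in> X. p (\<lambda>x. g x - f x) < e})"
    proof (rule openin_Inter)
      fix W assume "W \<in> (\<lambda>p. {g \<in> X. p (\<lambda>x. g x - f x) < e}) ` insert p0 F"
      then obtain p where p: "p \<in> P" "W = {g \<in> X. p (\<lambda>x. g x - f x) < e}" using p0 F(2) by auto
      show "openin (lc_topology X P) W"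
        unfolding lc_topology_def p(2) using p(1) fX F(3)
        by (intro topology_generated_by_Basis) auto
    qed (use F in auto)
    moreover have "f \<in> (\<Inter>p\<in>insert p0 F. {g \<in> X. p (\<lambda>x. g x - f x) < e})"
    proof (intro INT_I CollectI conjI fX)
      fix p assume "p \<in> insert p0 F"
      hence "seminorm_on X p" using P(1) p0 F(2) by blast
      thus "p (\<lambda>x. f x - f x) < e" using seminorm_zero[OF _ X, of p] F(3) by simp
    qed
    moreover have "(\<Inter>p\<in>insert p0 F. {g \<in> X. p (\<lambda>x. g x - f x) < e}) \<subseteq> U"
      using F(4) by auto
    ultimately show "\<exists>W. openin (lc_topology X P) W \<and> f \<in> W \<and> W \<subseteq> U" by blast
  qed
qed

lemma openin_lcE:
  assumes X: "complex_subspace X" and P: "\<forall>p\<in>P. seminorm_on X p" "P \<noteq> {}"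
    and U: "openin (lc_topology X P) U" "f \<in> U"
  obtains F e where "finite F" "F \<subseteq> P" "e > 0" "sball X F f e \<subseteq> U"
  using bspec[OF conjunct2[OF iffD1[OF openin_lc[OF X P] U(1)]] U(2)] by blast

lemma topspace_lc:
  assumes X: "complex_subspace X" and P: "\<forall>p\<in>P. seminorm_on X p" "P \<noteq> {}"
  shows "topspace (lc_topology X P) = X"
proof -
  have "openin (lc_topology X P) X"
    unfolding openin_lc[OF assms] using P(2) by (auto intro!: exI[of _ "{}"] exI[of _ 1])
  thus ?thesis using openin_lc[OF assms, of "topspace (lc_topology X P)"]
    by (simp add: openin_subset subset_antisym)
qed

lemma openin_lc_ball:
  assumes X: "complex_subspace X" and P: "\<forall>p\<in>P. seminorm_on X p" "p \<in> P" and "f \<in> X" "e > 0"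
  shows "openin (lc_topology X P) {g \<in> X. p (\<lambda>x. g x - f x) < e}"
  unfolding lc_topology_def using assms by (intro topology_generated_by_Basis) auto

lemma lc_topology_mono:
  assumes X: "complex_subspace X" and P: "\<forall>p\<in>P. seminorm_on X p" "P \<noteq> {}"
    and Q: "\<forall>q\<in>Q. seminorm_on X q" "Q \<noteq> {}"
    and le: "\<And>p. p \<in> P \<Longrightarrow> \<exists>q\<in>Q. \<exists>C. \<forall>f\<in>X. p f \<le> C * q f"
    and U: "openin (lc_topology X P) U"
  shows "openin (lc_topology X Q) U"
proof -
  have PU: "U \<subseteq> X" "\<And>f. f \<in> U \<Longrightarrow> sball_inside X P f U"
    using U unfolding openin_lc[OF X P] by simp_all
  show ?thesis unfolding openin_lc[OF X Q]
  proof (intro conjI ballI)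
    fix f assume f: "f \<in> U"
    obtain F e where F: "finite F" "F \<subseteq> P" "e > 0" "sball X F f e \<subseteq> U"
      using PU(2)[OF f] by blast
    from le obtain r C where r: "\<And>p. p \<in> P \<Longrightarrow> r p \<in> Q \<and> (\<forall>f\<in>X. p f \<le> C p * r p f)" by metis
    define D where "D = (\<Sum>p\<in>F. \<bar>C p\<bar>) + 1"
    have D: "D > 0" unfolding D_def by (simp add: add_nonneg_pos sum_nonneg)
    show "sball_inside X Q f U"
    proof (intro exI conjI)
      show "finite (r ` F)" "r ` F \<subseteq> Q" "e / D > 0" using F r D by auto
      show "sball X (r ` F) f (e / D) \<subseteq> U"
      proof clarify
        fix g assume g: "g \<in> X" "\<forall>p\<in>r ` F. p (\<lambda>x. g x - f x) < e / D"
        have gf: "(\<lambda>x. g x - f x) \<in> X" using cspace_diff[OF X g(1)] f PU(1) by blast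
        have "p (\<lambda>x. g x - f x) < e" if p: "p \<in> F" for p
        proof -
          have pP: "p \<in> P" using p F by auto
          have nn: "0 \<le> r p (\<lambda>x. g x - f x)" using r[OF pP] Q(1) seminorm_nonneg gf by blast
          have CD: "\<bar>C p\<bar> \<le> D" unfolding D_def using member_le_sum[OF p, of "\<lambda>p. \<bar>C p\<bar>"] F(1) by simp
          have "p (\<lambda>x. g x - f x) \<le> C p * r p (\<lambda>x. g x - f x)" using r[OF pP] gf by blast
          also have "\<dots> \<le> D * r p (\<lambda>x. g x - f x)" using CD nn by (intro mult_right_mono) auto
          also have "\<dots> < D * (e / D)" using g(2) p D by (intro mult_strict_left_mono) auto
          finally show ?thesis using D by simp
        qed
        thus "g \<in> U" using F(4) g(1) by blast
      qed
    qed
  qed (rule PU(1))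
qed

lemma lc_topology_eqI:
  assumes "complex_subspace X" "\<forall>p\<in>P. seminorm_on X p" "P \<noteq> {}"
    and "\<forall>q\<in>Q. seminorm_on X q" "Q \<noteq> {}"
    and "\<And>p. p \<in> P \<Longrightarrow> \<exists>q\<in>Q. \<exists>C. \<forall>f\<in>X. p f \<le> C * q f"
    and "\<And>q. q \<in> Q \<Longrightarrow> \<exists>p\<in>P. \<exists>C. \<forall>f\<in>X. q f \<le> C * p f"
  shows "lc_topology X P = lc_topology X Q"
  unfolding topology_eq
proof (intro allI iffI)
  show "openin (lc_topology X Q) U" if "openin (lc_topology X P) U" for U
    by (rule lc_topology_mono[OF assms(1-6) that])
  show "openin (lc_topology X P) U" if "openin (lc_topology X Q) U" for U
    by (rule lc_topology_mono[OF assms(1,4,5,2,3,7) that])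
qed

text \<open>Openness of the unit ball gives a neighbourhood of zero, and homogeneity turns it into
  an inequality. The sum over \<open>F\<close> stands in for a maximum and also makes sense for
  empty \<open>F\<close>.\<close>

lemma lc_topology_seminorm_le:
  assumes X: "complex_subspace X" and P: "\<forall>p\<in>P. seminorm_on X p" "P \<noteq> {}"
    and q: "seminorm_on X q" and op: "openin (lc_topology X P) {f \<in> X. q f < 1}"
  obtains F C where "finite F" "F \<subseteq> P" "0 \<le> C" "\<forall>f\<in>X. q f \<le> C * (\<Sum>p\<in>F. p f)"
proof -
  have "(\<lambda>_. 0) \<in> {f \<in> X. q f < 1}"
    using seminorm_zero[OF q X] cspace_zero[OF X] by simp
  then obtain F e where F: "finite F" "F \<subseteq> P" "e > 0" "sball X F (\<lambda>_. 0) e \<subseteq> {f \<in> X. q f < 1}"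
    by (rule openin_lcE[OF X P op])
  have SF: "seminorm_on X (\<lambda>f. \<Sum>p\<in>F. p f)" using seminorm_sum F P by blast
  have "q f \<le> (\<Sum>p\<in>F. p f) / e" if f: "f \<in> X" for f
  proof (rule seminorm_le_of_ball[OF X q SF F(3) _ f])
    fix g assume g: "g \<in> X" "(\<Sum>p\<in>F. p g) < e"
    have "p g < e" if p: "p \<in> F" for p
    proof -
      have "0 \<le> p' g" if "p' \<in> F" for p' using that F(2) P(1) seminorm_nonneg[OF _ g(1)] by blast
      hence "p g \<le> (\<Sum>p\<in>F. p g)" using member_le_sum[OF p, of "\<lambda>p. p g"] F(1) by simp
      thus ?thesis using g(2) by simp
    qed
    thus "q g < 1" using F(4) g by auto
  qed
  thus ?thesis using F by (intro that[of F "1/e"]) auto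
qed

text \<open>A Lipschitz bound is asked for instead of linearity, so that seminorms are covered as
  well as functionals.\<close>

lemma continuous_map_lc:
  fixes u :: "('a \<Rightarrow> complex) \<Rightarrow> 'b::real_normed_vector"
  assumes X: "complex_subspace X" and P: "\<forall>p\<in>P. seminorm_on X p" "p \<in> P"
    and u: "\<And>f g. f \<in> X \<Longrightarrow> g \<in> X \<Longrightarrow> norm (u f - u g) \<le> C * p (\<lambda>x. f x - g x)"
  shows "continuous_map (lc_topology X P) euclidean u"
proof -
  have ne: "P \<noteq> {}" using P by blast
  have ts: "topspace (lc_topology X P) = X" using topspace_lc[OF X P(1) ne] .
  have "openin (lc_topology X P) {f \<in> X. u f \<in> V}" if V: "open V" for V
    unfolding openin_lc[OF X P(1) ne]
  proof (intro conjI ballI)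
    fix f assume f: "f \<in> {f \<in> X. u f \<in> V}"
    then obtain e where e: "e > 0" "ball (u f) e \<subseteq> V" using V open_contains_ball by blast
    have "sball X {p} f (e / (\<bar>C\<bar> + 1)) \<subseteq> {f \<in> X. u f \<in> V}"
    proof clarify
      fix g assume g: "g \<in> X" "\<forall>p\<in>{p}. p (\<lambda>x. g x - f x) < e / (\<bar>C\<bar> + 1)"
      have nn: "0 \<le> p (\<lambda>x. g x - f x)"
        using P g f cspace_diff[OF X, of g f] seminorm_nonneg by blast
      have "norm (u g - u f) \<le> C * p (\<lambda>x. g x - f x)" using u f g by blast
      also have "\<dots> \<le> (\<bar>C\<bar> + 1) * p (\<lambda>x. g x - f x)" using nn by (intro mult_right_mono) auto
      also have "\<dots> < e" using g(2) by (simp add: field_simps)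
      finally show "u g \<in> V" using e(2) by (auto simp: dist_norm norm_minus_commute)
    qed
    thus "sball_inside X P f {f \<in> X. u f \<in> V}"
      using e P(2) by (intro exI[of _ "{p}"] exI[of _ "e / (\<bar>C\<bar> + 1)"]) auto
  qed auto
  thus ?thesis by (simp add: continuous_map_def ts)
qed

lemma vn_boundedD:
  assumes X: "complex_subspace X" and P: "\<forall>p\<in>P. seminorm_on X p" "p \<in> P"
    and B: "vn_bounded (lc_topology X P) B"
  shows "\<exists>C. \<forall>f\<in>B. p f \<le> C"
proof -
  have "openin (lc_topology X P) {g \<in> X. p (\<lambda>x. g x - 0) < 1}"
    using openin_lc_ball[OF X P cspace_zero[OF X], of 1] by simp
  moreover have "(\<lambda>_. 0) \<in> {g \<in> X. p (\<lambda>x. g x - 0) < 1}"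
    using seminorm_zero[OF _ X, of p] P cspace_zero[OF X] by simp
  ultimately obtain r where r: "r > 0" "\<And>c::complex. norm c \<ge> r \<Longrightarrow> B \<subseteq> (\<lambda>f x. c * f x) ` {g \<in> X. p (\<lambda>x. g x - 0) < 1}"
    using B unfolding vn_bounded_def by blast
  have "p f \<le> r" if f: "f \<in> B" for f
  proof -
    obtain g where g: "f = (\<lambda>x. complex_of_real r * g x)" "g \<in> X" "p g < 1"
      using r(2)[of "complex_of_real r"] r(1) f by auto
    have "p f = r * p g" using g seminorm_scale[of X p g] P r(1) by simp
    thus ?thesis using g(3) r(1) by simp
  qed
  thus ?thesis by blast
qed

lemma vn_boundedI:
  assumes X: "complex_subspace X" and P: "\<forall>p\<in>P. seminorm_on X p" "P \<noteq> {}"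
    and B: "B \<subseteq> X" "\<And>p. p \<in> P \<Longrightarrow> \<exists>C. \<forall>f\<in>B. p f \<le> C"
  shows "vn_bounded (lc_topology X P) B"
  unfolding vn_bounded_def topspace_lc[OF X P]
proof (intro conjI allI impI)
  fix U assume U: "openin (lc_topology X P) U \<and> (\<lambda>_. 0) \<in> U"
  then obtain F e where F: "finite F" "F \<subseteq> P" "e > 0" "sball X F (\<lambda>_. 0) e \<subseteq> U"
    using openin_lcE[OF X P, of U "\<lambda>_. 0"] by auto
  obtain C where C: "\<And>p f. p \<in> P \<Longrightarrow> f \<in> B \<Longrightarrow> p f \<le> C p" using B(2) by metis
  \<comment> \<open>Chosen so that \<open>\<bar>C p\<bar> < e * r\<close> for every \<open>p\<close>
    in \<open>F\<close>: division by any \<open>c\<close> of modulus at least \<open>r\<close> moves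
    \<open>B\<close> into the ball.\<close>
  define r where "r = ((\<Sum>p\<in>F. \<bar>C p\<bar>) + 1) / e"
  have r0: "r > 0" unfolding r_def using F(3) by (simp add: add_nonneg_pos sum_nonneg)
  have "B \<subseteq> (\<lambda>f x. c * f x) ` U" if c: "norm c \<ge> r" for c :: complex
  proof
    fix f assume f: "f \<in> B"
    have c0: "c \<noteq> 0" using c r0 by auto
    have fX: "f \<in> X" using f B by blast
    have "p (\<lambda>x. inverse c * f x) < e" if p: "p \<in> F" for p
    proof -
      have "p (\<lambda>x. inverse c * f x) = p f / norm c"
      proof -
        have "seminorm_on X p" using P(1) F(2) p by blast
        thus ?thesis using seminorm_scale[OF _ fX, of p "inverse c"]
          by (simp add: norm_inverse divide_inverse mult.commute)
      qed
      moreover have "p f < e * norm c"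
      proof -
        have "p f \<le> \<bar>C p\<bar>" using C[of p f] f p F by fastforce
        also have "\<dots> < (\<Sum>p\<in>F. \<bar>C p\<bar>) + 1" using member_le_sum[OF p, of "\<lambda>p. \<bar>C p\<bar>"] F(1) by simp
        also have "\<dots> = e * r" using F(3) by (simp add: r_def)
        also have "\<dots> \<le> e * norm c" using c F(3) by simp
        finally show ?thesis .
      qed
      moreover have "norm c > 0" using c0 by simp
      ultimately show ?thesis by (simp only: pos_divide_less_eq)
    qed
    hence "(\<lambda>x. inverse c * f x) \<in> U" using F(4) cspace_scale[OF X fX, of "inverse c"] by auto
    thus "f \<in> (\<lambda>f x. c * f x) ` U"
      by (rule rev_image_eqI) (use c0 in \<open>simp add: fun_eq_iff\<close>)
  qed
  thus "\<exists>r>0. \<forall>c. norm c \<ge> r \<longrightarrow> B \<subseteq> (\<lambda>f x. c * f x) ` U" using r0 by blast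
qed (rule B(1))

lemma seminorm_SUP:
  assumes X: "complex_subspace X" and q: "\<And>i. i \<in> I \<Longrightarrow> seminorm_on X (q i)" and I: "I \<noteq> {}"
    and bdd: "\<And>f. f \<in> X \<Longrightarrow> bdd_above ((\<lambda>i. q i f) ` I)"
  shows "seminorm_on X (\<lambda>f. SUP i\<in>I. q i f)"
proof -
  have up: "q i f \<le> (SUP i\<in>I. q i f)" if "i \<in> I" "f \<in> X" for i f
    using cSUP_upper[OF that(1) bdd[OF that(2)]] .
  have nonneg: "0 \<le> (SUP i\<in>I. q i f)" if f: "f \<in> X" for f
  proof -
    obtain i where i: "i \<in> I" using I by blast
    thus ?thesis using up[OF i f] seminorm_nonneg[OF q[OF i] f] by linarith
  qed
  have le: "(SUP i\<in>I. q i (\<lambda>x. c * f x)) \<le> norm c * (SUP i\<in>I. q i f)" if f: "f \<in> X" for f c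
    by (rule cSUP_least[OF I]) (simp add: seminorm_scale[OF q f] up f mult_left_mono)
  have "(SUP i\<in>I. q i (\<lambda>x. c * f x)) = norm c * (SUP i\<in>I. q i f)" if f: "f \<in> X" for f c
  proof (cases "c = 0")
    case True
    thus ?thesis using le[OF f, of c] nonneg[OF cspace_scale[OF X f, of c]] by simp
  next
    case False
    \<comment> \<open>The reverse inequality is \<open>le\<close> applied to
      \<open>inverse c\<close> and the scaled function.\<close>
    have "(SUP i\<in>I. q i f) \<le> norm (inverse c) * (SUP i\<in>I. q i (\<lambda>x. c * f x))"
      using le[OF cspace_scale[OF X f, of c], of "inverse c"] False by (simp flip: mult.assoc)
    hence "norm c * (SUP i\<in>I. q i f) \<le> (SUP i\<in>I. q i (\<lambda>x. c * f x))"
      using False by (simp add: norm_divide field_simps)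
    thus ?thesis using le[OF f, of c] by simp
  qed
  moreover have "(SUP i\<in>I. q i (\<lambda>x. f x + g x)) \<le> (SUP i\<in>I. q i f) + (SUP i\<in>I. q i g)"
    if f: "f \<in> X" and g: "g \<in> X" for f g
  proof (rule cSUP_least[OF I])
    fix i assume i: "i \<in> I"
    show "q i (\<lambda>x. f x + g x) \<le> (SUP i\<in>I. q i f) + (SUP i\<in>I. q i g)"
      using seminorm_add[OF q[OF i] f g] up[OF i f] up[OF i g] by linarith
  qed
  ultimately show ?thesis using nonneg unfolding seminorm_on_def by blast
qed

text \<open>Both sequences define the same topology, so each seminorm of one is continuous for the
  other, and monotonicity replaces finitely many indices by the largest. The free lower bound
  \<open>n0\<close> serves the requirement \<open>k \<ge> m\<close> in the condition (DN).\<close>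

lemma fundamental_seminorms_dominate:
  assumes X: "complex_subspace X" and q: "fundamental_seminorms X T q" and q': "fundamental_seminorms X T q'"
  shows "\<exists>n\<ge>n0. \<exists>C>0. \<forall>f\<in>X. q' m f \<le> C * q n f"
proof -
  have sq: "\<forall>p\<in>range q. seminorm_on X p" and sq': "\<forall>p\<in>range q'. seminorm_on X p"
    and inc: "\<And>n f. f \<in> X \<Longrightarrow> q n f \<le> q (Suc n) f"
    using q q' unfolding fundamental_seminorms_def by blast+
  have T: "lc_topology X (range q') = lc_topology X (range q)"
    using q q' unfolding fundamental_seminorms_def by metis
  have "openin (lc_topology X (range q')) {g \<in> X. q' m (\<lambda>x. g x - 0) < 1}"
    by (rule openin_lc_ball[OF X sq' rangeI cspace_zero[OF X] zero_less_one])
  hence op: "openin (lc_topology X (range q)) {g \<in> X. q' m g < 1}"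
    unfolding T by simp
  have ne: "range q \<noteq> {}" by simp
  obtain F C where F: "finite F" "F \<subseteq> range q" "0 \<le> C" "\<forall>f\<in>X. q' m f \<le> C * (\<Sum>p\<in>F. p f)"
    by (rule lc_topology_seminorm_le[OF X sq ne bspec[OF sq' rangeI] op])
  obtain J where J: "finite J" "F = q ` J" using F(1,2) by (meson finite_subset_image)
  obtain n where n: "\<And>j. j \<in> J \<Longrightarrow> j \<le> n" using J(1) by (meson finite_nat_set_iff_bounded_le)
  define n' where "n' = max n n0"
  have mono: "q j f \<le> q n' f" if "j \<in> J" "f \<in> X" for j f
    using lift_Suc_mono_le[of "\<lambda>k. q k f" j n'] inc[OF that(2)] n[OF that(1)] by (simp add: n'_def)
  have "q' m f \<le> (C * card F + 1) * q n' f" if f: "f \<in> X" for f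
  proof -
    have "q' m f \<le> C * (\<Sum>p\<in>F. p f)" by (rule bspec[OF F(4) f])
    also have "\<dots> \<le> C * (of_nat (card F) * q n' f)"
      by (intro mult_left_mono F(3) sum_bounded_above) (use mono J(2) f in auto)
    also have "\<dots> \<le> (C * card F + 1) * q n' f"
      using seminorm_nonneg[OF bspec[OF sq rangeI] f, of n'] by (simp add: algebra_simps)
    finally show ?thesis .
  qed
  moreover have "C * card F + 1 > 0" using F(3) by (simp add: add_nonneg_pos)
  ultimately show ?thesis by (intro exI[of _ n'] conjI exI[of _ "C * card F + 1"]) (auto simp: n'_def)
qed

section \<open>Strong duals of countable inductive limits\<close>

locale lb_system =
  fixes E :: "nat \<Rightarrow> ('a \<Rightarrow> complex) set" and N :: "nat \<Rightarrow> ('a \<Rightarrow> complex) \<Rightarrow> real"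
  assumes subspace: "\<And>n. 1 \<le> n \<Longrightarrow> complex_subspace (E n)"
    and norm_step: "\<And>n. 1 \<le> n \<Longrightarrow> seminorm_on (E n) (N n)"
    and step_mono: "\<And>n m. 1 \<le> n \<Longrightarrow> n \<le> m \<Longrightarrow> E n \<subseteq> E m"
    and norm_antimono: "\<And>n m f. 1 \<le> n \<Longrightarrow> n \<le> m \<Longrightarrow> f \<in> E n \<Longrightarrow> N m f \<le> N n f"
begin

definition X where "X = (\<Union>n\<in>{1..}. E n)"
definition P where "P = {p. seminorm_on X p \<and>
         (\<forall>n\<in>{1..}. continuous_map (lc_topology (E n) {N n}) euclideanreal p)}"
definition T where "T = lc_topology X P"
definition D where "D = top_dual T"
definition unit_ball where "unit_ball n = {f \<in> E n. N n f \<le> 1}"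
definition dnorm :: "nat \<Rightarrow> (('a \<Rightarrow> complex) \<Rightarrow> complex) \<Rightarrow> real"
  where "dnorm n u = (SUP f\<in>unit_ball n. norm (u f))"

lemma T_eq: "T = ind_lim_topology {1..} E N"
  unfolding T_def ind_lim_topology_def X_def P_def ..

lemma EX: "1 \<le> n \<Longrightarrow> E n \<subseteq> X"
  by (auto simp: X_def)

lemma subspace_X: "complex_subspace X"
  unfolding complex_subspace_def
proof (intro conjI ballI allI)
  show "(\<lambda>_. 0) \<in> X" using cspace_zero[OF subspace[of 1]] EX[of 1] by auto
  fix f assume f: "f \<in> X"
  then obtain n where n: "1 \<le> n" "f \<in> E n" by (auto simp: X_def)
  show "(\<lambda>x. c * f x) \<in> X" for c
    using cspace_scale[OF subspace[OF n(1)] n(2)] EX[OF n(1)] by auto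
  fix g assume g: "g \<in> X"
  then obtain m where m: "1 \<le> m" "g \<in> E m" by (auto simp: X_def)
  have nm: "1 \<le> max n m" using n by simp
  have "f \<in> E (max n m)" "g \<in> E (max n m)" using step_mono[of n "max n m"] step_mono[of m "max n m"] n m by auto
  thus "(\<lambda>x. f x + g x) \<in> X" using cspace_add[OF subspace[OF nm]] EX[OF nm] by auto
qed

lemma norm_nonneg: "1 \<le> n \<Longrightarrow> f \<in> E n \<Longrightarrow> 0 \<le> N n f"
  using seminorm_nonneg[OF norm_step] .

text \<open>For a seminorm, continuity on a step is boundedness relative to the norm of that step.
  This replaces the topological description of the inductive limit by inequalities, one constant per
  step.\<close>

lemma P_iff: "p \<in> P \<longleftrightarrow> seminorm_on X p \<and> (\<forall>n\<ge>1. \<exists>C. \<forall>f\<in>E n. p f \<le> C * N n f)"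
proof
  assume p: "p \<in> P"
  hence sp: "seminorm_on X p" unfolding P_def by blast
  have "\<exists>C. \<forall>f\<in>E n. p f \<le> C * N n f" if n: "1 \<le> n" for n
  proof -
    have sn: "\<forall>q\<in>{N n}. seminorm_on (E n) q" using norm_step[OF n] by simp
    have spn: "seminorm_on (E n) p" using seminorm_subset[OF sp EX[OF n]] .
    have "continuous_map (lc_topology (E n) {N n}) euclideanreal p" using p n unfolding P_def by auto
    hence "openin (lc_topology (E n) {N n}) {f \<in> topspace (lc_topology (E n) {N n}). p f \<in> {..<1}}"
      by (rule openin_continuous_map_preimage) simp
    hence op: "openin (lc_topology (E n) {N n}) {f \<in> E n. p f < 1}"
      unfolding topspace_lc[OF subspace[OF n] sn insert_not_empty] by simp
    obtain F C where F: "finite F" "F \<subseteq> {N n}" "0 \<le> C" "\<forall>f\<in>E n. p f \<le> C * (\<Sum>q\<in>F. q f)"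
      by (rule lc_topology_seminorm_le[OF subspace[OF n] sn insert_not_empty spn op])
    have "(\<Sum>q\<in>F. q f) \<le> N n f" if "f \<in> E n" for f
      using F(1,2) norm_nonneg[OF n that] by (cases "F = {}") (auto simp: subset_singleton_iff)
    hence "p f \<le> C * N n f" if "f \<in> E n" for f
      using bspec[OF F(4) that] mult_left_mono[OF _ F(3)] that by (meson order_trans)
    thus ?thesis by blast
  qed
  thus "seminorm_on X p \<and> (\<forall>n\<ge>1. \<exists>C. \<forall>f\<in>E n. p f \<le> C * N n f)" using sp by blast
next
  assume p: "seminorm_on X p \<and> (\<forall>n\<ge>1. \<exists>C. \<forall>f\<in>E n. p f \<le> C * N n f)"
  have "continuous_map (lc_topology (E n) {N n}) euclideanreal p" if n: "1 \<le> n" for n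
  proof -
    have spn: "seminorm_on (E n) p" using seminorm_subset[OF _ EX[OF n]] p by blast
    obtain C where C: "\<forall>f\<in>E n. p f \<le> C * N n f" using p n by blast
    show ?thesis
    proof (rule continuous_map_lc[OF subspace[OF n]])
      show "\<forall>q\<in>{N n}. seminorm_on (E n) q" "N n \<in> {N n}" using norm_step[OF n] by auto
      fix f g assume fg: "f \<in> E n" "g \<in> E n"
      show "norm (p f - p g) \<le> C * N n (\<lambda>x. f x - g x)"
        unfolding real_norm_def
        by (rule order_trans[OF seminorm_abs_diff_le[OF spn subspace[OF n] fg]
            bspec[OF C cspace_diff[OF subspace[OF n] fg]]])
    qed
  qed
  thus "p \<in> P" using p by (auto simp: P_def)
qed

lemma P_seminorm: "\<forall>p\<in>P. seminorm_on X p"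
  by (simp add: P_def)

lemma P_nonempty: "P \<noteq> {}"
proof -
  have "(\<lambda>_. 0) \<in> P" unfolding P_iff by (auto simp: seminorm_on_def intro!: exI[of _ 0])
  thus ?thesis by blast
qed

lemma topspace_T: "topspace T = X"
  unfolding T_def by (rule topspace_lc[OF subspace_X P_seminorm P_nonempty])

lemma D_add: "u \<in> D \<Longrightarrow> f \<in> X \<Longrightarrow> g \<in> X \<Longrightarrow> u (\<lambda>x. f x + g x) = u f + u g"
  and D_scale: "u \<in> D \<Longrightarrow> f \<in> X \<Longrightarrow> u (\<lambda>x. c * f x) = c * u f"
  and D_off: "u \<in> D \<Longrightarrow> f \<notin> X \<Longrightarrow> u f = 0"
  by (auto simp: D_def top_dual_def topspace_T)

lemma linear_norm_seminorm:
  assumes "\<And>f g. f \<in> X \<Longrightarrow> g \<in> X \<Longrightarrow> u (\<lambda>x. f x + g x) = u f + u g"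
    and "\<And>c f. f \<in> X \<Longrightarrow> u (\<lambda>x. c * f x) = c * u f"
  shows "seminorm_on X (\<lambda>f. norm (u f :: complex))"
  unfolding seminorm_on_def
proof (intro conjI ballI allI)
  fix f g assume fg: "f \<in> X" "g \<in> X"
  show "norm (u (\<lambda>x. f x + g x)) \<le> norm (u f) + norm (u g)"
    unfolding assms(1)[OF fg] by (rule norm_triangle_ineq)
next
  fix c f assume f: "f \<in> X"
  show "norm (u (\<lambda>x. c * f x)) = norm c * norm (u f)"
    unfolding assms(2)[OF f] by (rule norm_mult)
qed simp

lemma D_seminorm: "u \<in> D \<Longrightarrow> seminorm_on X (\<lambda>f. norm (u f))"
  by (rule linear_norm_seminorm) (auto simp: D_add D_scale)

lemma D_bound:
  assumes u: "u \<in> D" and n: "1 \<le> n"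
  shows "\<exists>C. \<forall>f\<in>E n. norm (u f) \<le> C * N n f"
proof -
  have "continuous_map T euclidean u" using u unfolding D_def top_dual_def by blast
  hence "openin T {f \<in> topspace T. u f \<in> ball 0 1}"
    by (rule openin_continuous_map_preimage) simp
  hence op: "openin (lc_topology X P) {f \<in> X. norm (u f) < 1}"
    by (simp add: topspace_T flip: T_def)
  obtain F C where F: "finite F" "F \<subseteq> P" "0 \<le> C" "\<forall>f\<in>X. norm (u f) \<le> C * (\<Sum>q\<in>F. q f)"
    by (rule lc_topology_seminorm_le[OF subspace_X P_seminorm P_nonempty D_seminorm[OF u] op])
  have "\<forall>p\<in>P. \<exists>C. \<forall>f\<in>E n. p f \<le> C * N n f" using P_iff n by blast
  then obtain c where c: "\<And>p f. p \<in> P \<Longrightarrow> f \<in> E n \<Longrightarrow> p f \<le> c p * N n f" by metis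
  have "norm (u f) \<le> (C * (\<Sum>q\<in>F. c q)) * N n f" if f: "f \<in> E n" for f
  proof -
    have "norm (u f) \<le> C * (\<Sum>q\<in>F. q f)" using F(4) EX[OF n] f by auto
    also have "\<dots> \<le> C * (\<Sum>q\<in>F. c q * N n f)"
      by (intro mult_left_mono sum_mono F(3)) (use F(2) c f in auto)
    finally show ?thesis by (simp add: sum_distrib_right mult.assoc)
  qed
  thus ?thesis by blast
qed

text \<open>The modulus of such a functional is itself a seminorm in \<open>P\<close>, hence
  continuous. With \<open>D_bound\<close> this describes the dual by one bound per step, without
  uniformity in \<open>n\<close>.\<close>

lemma DI:
  assumes add: "\<And>f g. f \<in> X \<Longrightarrow> g \<in> X \<Longrightarrow> u (\<lambda>x. f x + g x) = u f + u g"
    and scale: "\<And>c f. f \<in> X \<Longrightarrow> u (\<lambda>x. c * f x) = c * u f"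
    and off: "\<And>f. f \<notin> X \<Longrightarrow> u f = 0"
    and bound: "\<And>n. 1 \<le> n \<Longrightarrow> \<exists>C. \<forall>f\<in>E n. norm (u f) \<le> C * N n f"
  shows "u \<in> D"
proof -
  have "(\<lambda>f. norm (u f)) \<in> P"
    unfolding P_iff using linear_norm_seminorm[of u, OF add scale] bound by blast
  have "continuous_map T euclidean u"
    unfolding T_def
  proof (rule continuous_map_lc[OF subspace_X P_seminorm \<open>(\<lambda>f. norm (u f)) \<in> P\<close>])
    fix f g assume fg: "f \<in> X" "g \<in> X"
    have "u (\<lambda>x. f x - g x) = u f - u g"
      using add[OF cspace_diff[OF subspace_X fg] fg(2)] by simp
    thus "norm (u f - u g) \<le> 1 * norm (u (\<lambda>x. f x - g x))" by simp
  qed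
  thus ?thesis using assms by (simp add: D_def top_dual_def topspace_T)
qed

lemma subspace_D: "complex_subspace D"
  unfolding complex_subspace_def
proof (intro conjI ballI allI)
  show "(\<lambda>_. 0) \<in> D" by (rule DI) (auto intro!: exI[of _ 0])
  fix u assume u: "u \<in> D"
  show "(\<lambda>f. c * u f) \<in> D" for c
  proof (rule DI)
    fix n :: nat assume n: "1 \<le> n"
    obtain C where "\<forall>f\<in>E n. norm (u f) \<le> C * N n f" using D_bound[OF u n] by blast
    hence "\<forall>f\<in>E n. norm (c * u f) \<le> (norm c * C) * N n f"
      by (simp add: norm_mult mult.assoc mult_left_mono)
    thus "\<exists>C. \<forall>f\<in>E n. norm (c * u f) \<le> C * N n f" by blast
  qed (use u in \<open>auto simp: D_add D_scale D_off algebra_simps\<close>)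
  fix v assume v: "v \<in> D"
  show "(\<lambda>f. u f + v f) \<in> D"
  proof (rule DI)
    fix n :: nat assume n: "1 \<le> n"
    obtain C where C: "\<forall>f\<in>E n. norm (u f) \<le> C * N n f" using D_bound[OF u n] by blast
    obtain C' where C': "\<forall>f\<in>E n. norm (v f) \<le> C' * N n f" using D_bound[OF v n] by blast
    have "norm (u f + v f) \<le> (C + C') * N n f" if "f \<in> E n" for f
      using norm_triangle_ineq[of "u f" "v f"] bspec[OF C that] bspec[OF C' that] by (simp add: algebra_simps)
    thus "\<exists>C. \<forall>f\<in>E n. norm (u f + v f) \<le> C * N n f" by blast
  qed (use u v in \<open>auto simp: D_add D_scale D_off algebra_simps\<close>)
qed

lemma zero_unit_ball: "1 \<le> n \<Longrightarrow> (\<lambda>_. 0) \<in> unit_ball n"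
  by (simp add: unit_ball_def cspace_zero subspace seminorm_zero[OF norm_step])

lemma unit_ball_le:
  assumes n: "1 \<le> n" and f: "f \<in> unit_ball n" and r: "r \<le> C * N n f"
  shows "r \<le> \<bar>C\<bar>"
proof -
  have fE: "f \<in> E n" "N n f \<le> 1" using f by (auto simp: unit_ball_def)
  have "C * N n f \<le> \<bar>C\<bar> * N n f" using norm_nonneg[OF n fE(1)] by (intro mult_right_mono) auto
  also have "\<dots> \<le> \<bar>C\<bar>" using fE by (simp add: mult_left_le)
  finally show ?thesis using r by simp
qed

lemma unit_ball_bdd:
  assumes u: "u \<in> D" and n: "1 \<le> n"
  shows "bdd_above ((\<lambda>f. norm (u f)) ` unit_ball n)"
proof -
  obtain C where C: "\<forall>f\<in>E n. norm (u f) \<le> C * N n f" using D_bound[OF u n] by blast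
  have "norm (u f) \<le> \<bar>C\<bar>" if f: "f \<in> unit_ball n" for f
    by (rule unit_ball_le[OF n f]) (use C f in \<open>simp add: unit_ball_def\<close>)
  thus ?thesis by (intro bdd_aboveI2)
qed

lemma dnorm_upper: "u \<in> D \<Longrightarrow> 1 \<le> n \<Longrightarrow> f \<in> unit_ball n \<Longrightarrow> norm (u f) \<le> dnorm n u"
  unfolding dnorm_def by (rule cSUP_upper[OF _ unit_ball_bdd])

lemma dnorm_least: "1 \<le> n \<Longrightarrow> (\<And>f. f \<in> unit_ball n \<Longrightarrow> norm (u f) \<le> B) \<Longrightarrow> dnorm n u \<le> B"
proof -
  assume n: "1 \<le> n" and B: "\<And>f. f \<in> unit_ball n \<Longrightarrow> norm (u f) \<le> B"
  have "unit_ball n \<noteq> {}" using zero_unit_ball[OF n] by blast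
  thus "dnorm n u \<le> B" unfolding dnorm_def using B by (rule cSUP_least)
qed

lemma dnorm_seminorm:
  assumes n: "1 \<le> n"
  shows "seminorm_on D (dnorm n)"
proof -
  have "seminorm_on D (\<lambda>u. SUP f\<in>unit_ball n. norm (u f))"
    by (rule seminorm_SUP[OF subspace_D])
      (use zero_unit_ball[OF n] n in \<open>auto simp: seminorm_on_def norm_mult norm_triangle_ineq intro!: unit_ball_bdd\<close>)
  moreover have "dnorm n = (\<lambda>u. SUP f\<in>unit_ball n. norm (u f))" by (simp add: dnorm_def fun_eq_iff)
  ultimately show ?thesis by simp
qed

lemma dnorm_nonneg: "u \<in> D \<Longrightarrow> 1 \<le> n \<Longrightarrow> 0 \<le> dnorm n u"
  using seminorm_nonneg[OF dnorm_seminorm] .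

lemma unit_ball_mono: "1 \<le> n \<Longrightarrow> n \<le> m \<Longrightarrow> unit_ball n \<subseteq> unit_ball m"
proof
  fix f assume nm: "1 \<le> n" "n \<le> m" and f: "f \<in> unit_ball n"
  hence "f \<in> E n" "N n f \<le> 1" by (simp_all add: unit_ball_def)
  thus "f \<in> unit_ball m"
    using subsetD[OF step_mono[OF nm]] norm_antimono[OF nm, of f] by (simp add: unit_ball_def)
qed

lemma dnorm_mono: "u \<in> D \<Longrightarrow> 1 \<le> n \<Longrightarrow> n \<le> m \<Longrightarrow> dnorm n u \<le> dnorm m u"
proof -
  assume u: "u \<in> D" and nm: "1 \<le> n" "n \<le> m"
  have m: "1 \<le> m" using nm by simp
  show "dnorm n u \<le> dnorm m u"
    by (rule dnorm_least[OF nm(1)]) (rule dnorm_upper[OF u m subsetD[OF unit_ball_mono[OF nm]]])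
qed

lemma dnorm_bound:
  assumes u: "u \<in> D" and n: "1 \<le> n" and f: "f \<in> E n"
  shows "norm (u f) \<le> dnorm n u * N n f"
proof (rule field_le_epsilon)
  fix e :: real assume e: "e > 0"
  \<comment> \<open>\<open>N n f\<close> may be zero, so the scaling factor \<open>t\<close> gets a
    positive summand, small enough to cost at most \<open>e\<close>.\<close>
  define d where "d = e / (dnorm n u + 1)"
  have dn: "0 \<le> dnorm n u" using dnorm_nonneg[OF u n] .
  have d: "d > 0" using e dn by (simp add: d_def)
  have N0: "0 \<le> N n f" using norm_nonneg[OF n f] .
  define t where "t = N n f + d"
  have t: "t > 0" using N0 d by (simp add: t_def)
  let ?g = "\<lambda>x. inverse (complex_of_real t) * f x"
  have "N n ?g = norm (inverse (complex_of_real t)) * N n f" by (rule seminorm_scale[OF norm_step[OF n] f])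
  also have "\<dots> = N n f / t" using t by (simp add: norm_inverse divide_inverse mult.commute)
  also have "\<dots> \<le> 1" using t d N0 by (simp add: t_def)
  finally have "?g \<in> unit_ball n" using cspace_scale[OF subspace[OF n] f] by (simp add: unit_ball_def)
  hence "norm (u ?g) \<le> dnorm n u" by (rule dnorm_upper[OF u n])
  moreover have "u ?g = inverse (complex_of_real t) * u f" using D_scale[OF u] EX[OF n] f by blast
  ultimately have "norm (u f) / t \<le> dnorm n u" using t by (simp add: norm_mult norm_inverse divide_inverse mult.commute)
  hence "norm (u f) \<le> dnorm n u * t" using t by (simp only: pos_divide_le_eq)
  also have "\<dots> = dnorm n u * N n f + dnorm n u * d" by (simp add: t_def algebra_simps)
  also have "dnorm n u * d \<le> e" using e dn by (simp add: d_def field_simps)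
  finally show "norm (u f) \<le> dnorm n u * N n f + e" by simp
qed

text \<open>Gliding hump: otherwise there are functionals \<open>v\<^sub>n\<close> with \<open>\<parallel>v\<^sub>n\<parallel> \<le> 1\<close> on the \<open>n\<close>-th step and
  \<open>|v\<^sub>n| \<ge> n\<close> somewhere on \<open>B\<close>, and \<open>sup\<^sub>n |v\<^sub>n|\<close> is a continuous seminorm unbounded on \<open>B\<close>.\<close>

lemma vn_bounded_dominated:
  assumes B: "vn_bounded T B"
  shows "\<exists>n\<ge>1. \<exists>C. \<forall>u\<in>D. \<forall>f\<in>B. norm (u f) \<le> C * dnorm n u"
proof (rule ccontr)
  assume contr: "\<not> ?thesis"
  have ex: "\<exists>v b. v \<in> D \<and> b \<in> B \<and> norm (v b) = real n \<and> dnorm n v \<le> 1" if n: "1 \<le> n" for n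
  proof -
    have "\<not> (\<forall>u\<in>D. \<forall>f\<in>B. norm (u f) \<le> real n * dnorm n u)" using contr n by blast
    then obtain u b where u: "u \<in> D" "b \<in> B" "real n * dnorm n u < norm (u b)" by (auto simp: not_le)
    have "0 \<le> real n * dnorm n u" using dnorm_nonneg[OF u(1) n] by simp
    hence a: "0 < norm (u b)" using u(3) by linarith
    let ?c = "complex_of_real (real n / norm (u b))"
    have "dnorm n (\<lambda>f. ?c * u f) = norm ?c * dnorm n u"
      by (rule seminorm_scale[OF dnorm_seminorm[OF n] u(1)])
    also have "\<dots> \<le> 1" using a u(3) by (simp add: norm_divide)
    finally have "dnorm n (\<lambda>f. ?c * u f) \<le> 1" .
    moreover have "norm (?c * u b) = real n" using a by (simp add: norm_mult norm_divide)
    ultimately show ?thesis using u(2) cspace_scale[OF subspace_D u(1), of ?c]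
      by (intro exI[of _ "\<lambda>f. ?c * u f"] exI[of _ b] conjI)
  qed
  hence "\<forall>n. \<exists>v b. 1 \<le> n \<longrightarrow> v \<in> D \<and> b \<in> B \<and> norm (v b) = real n \<and> dnorm n v \<le> 1" by blast
  then obtain v where "\<forall>n. \<exists>b. 1 \<le> n \<longrightarrow> v n \<in> D \<and> b \<in> B \<and> norm (v n b) = real n \<and> dnorm n (v n) \<le> 1"
    by (rule choice[THEN exE])
  then obtain b where vb: "\<forall>n. 1 \<le> n \<longrightarrow> v n \<in> D \<and> b n \<in> B \<and> norm (v n (b n)) = real n \<and> dnorm n (v n) \<le> 1"
    by (rule choice[THEN exE])
  have vD: "v n \<in> D" and bB: "b n \<in> B" and vbn: "norm (v n (b n)) = real n" and dv: "dnorm n (v n) \<le> 1"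
    if "n \<ge> 1" for n
    using vb[rule_format, OF that] by simp_all
  have BX: "B \<subseteq> X" using B unfolding vn_bounded_def topspace_T by blast
  \<comment> \<open>A bound uniform in \<open>n\<close>: for \<open>k \<le> n\<close> the estimate
    \<open>dnorm n (v n) \<le> 1\<close> suffices because the norms decrease along the steps, and
    the finitely many \<open>n < k\<close> enter through the sum.\<close>
  define M where "M k = 1 + (\<Sum>n=1..k. dnorm k (v n))" for k
  have vM: "norm (v n f) \<le> M k * N k f" if n: "n \<ge> 1" and k: "k \<ge> 1" and f: "f \<in> E k" for n k f
  proof -
    have nn: "0 \<le> (\<Sum>n=1..k. dnorm k (v n))"
      by (rule sum_nonneg) (use dnorm_nonneg[OF vD k] in auto)
    have N0: "0 \<le> N k f" using norm_nonneg[OF k f] .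
    show ?thesis
    proof (cases "k \<le> n")
      case True
      have fn: "f \<in> E n" using step_mono[OF k True] f by blast
      have "norm (v n f) \<le> dnorm n (v n) * N n f" by (rule dnorm_bound[OF vD[OF n] n fn])
      also have "\<dots> \<le> 1 * N n f" by (intro mult_right_mono dv n norm_nonneg fn)
      also have "\<dots> \<le> 1 * N k f" using norm_antimono[OF k True f] by simp
      also have "\<dots> \<le> M k * N k f" using nn N0 by (intro mult_right_mono) (auto simp: M_def)
      finally show ?thesis .
    next
      case False
      have "dnorm k (v n) \<le> (\<Sum>n=1..k. dnorm k (v n))"
        by (rule member_le_sum) (use n False dnorm_nonneg[OF vD k] in auto)
      hence "dnorm k (v n) \<le> M k" by (simp add: M_def)
      hence "dnorm k (v n) * N k f \<le> M k * N k f" using N0 by (intro mult_right_mono)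
      thus ?thesis using dnorm_bound[OF vD[OF n] k f] by linarith
    qed
  qed
  define p where "p f = (SUP n\<in>{1..}. norm (v n f))" for f
  have bdd: "bdd_above ((\<lambda>n. norm (v n f)) ` {1..})" if f: "f \<in> X" for f
  proof -
    obtain k where k: "k \<ge> 1" "f \<in> E k" using f by (auto simp: X_def)
    show ?thesis by (rule bdd_aboveI2[of _ _ "M k * N k f"]) (use vM k in auto)
  qed
  have pX: "seminorm_on X p"
  proof -
    have "seminorm_on X (\<lambda>f. SUP n\<in>{1..}. norm (v n f))"
      by (rule seminorm_SUP[OF subspace_X D_seminorm[OF vD] _ bdd]) auto
    moreover have "p = (\<lambda>f. SUP n\<in>{1..}. norm (v n f))" by (simp add: p_def fun_eq_iff)
    ultimately show ?thesis by simp
  qed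
  have "p f \<le> M k * N k f" if k: "k \<ge> 1" and f: "f \<in> E k" for k f
    unfolding p_def by (rule cSUP_least) (use vM[OF _ k f] in auto)
  hence "p \<in> P" unfolding P_iff using pX by blast
  then obtain C where C: "\<forall>f\<in>B. p f \<le> C"
    using vn_boundedD[OF subspace_X P_seminorm _ B[unfolded T_def]] by blast
  obtain n :: nat where n: "n \<ge> 1" "real n > C" using reals_Archimedean2[of "max C 1"]
    by (metis less_imp_le max_less_iff_conj of_nat_1 of_nat_le_iff)
  note bn = bB[OF n(1)]
  have "real n \<le> p (b n)"
    unfolding p_def vbn[OF n(1), symmetric] by (rule cSUP_upper[OF _ bdd]) (use n bn BX in auto)
  thus False using bspec[OF C bn] n(2) by simp
qed

lemma vn_bounded_unit_ball:
  assumes n: "1 \<le> n"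
  shows "vn_bounded T (unit_ball n)"
  unfolding T_def
proof (rule vn_boundedI[OF subspace_X P_seminorm P_nonempty])
  show "unit_ball n \<subseteq> X" using EX[OF n] by (auto simp: unit_ball_def)
  fix p assume "p \<in> P"
  then obtain C where C: "\<forall>f\<in>E n. p f \<le> C * N n f" unfolding P_iff using n by blast
  have "p f \<le> \<bar>C\<bar>" if f: "f \<in> unit_ball n" for f
    by (rule unit_ball_le[OF n f]) (use C f in \<open>simp add: unit_ball_def\<close>)
  thus "\<exists>C. \<forall>f\<in>unit_ball n. p f \<le> C" by blast
qed

abbreviation SD where "SD \<equiv> strong_dual_topology T"

text \<open>Unit balls are bounded, so the dual norms are among the seminorms defining the strong
  topology; conversely \<open>vn_bounded_dominated\<close> bounds each defining seminorm by one of
  them. The shift by \<open>Suc\<close> reconciles sequences indexed from 0 with steps indexed from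
  1.\<close>

lemma strong_dual_fundamental:
  "fundamental_seminorms D (SD) (\<lambda>n. dnorm (Suc n))"
  unfolding fundamental_seminorms_def
proof (intro conjI allI ballI)
  show "seminorm_on D (dnorm (Suc n))" for n by (rule dnorm_seminorm) simp
  show "dnorm (Suc n) u \<le> dnorm (Suc (Suc n)) u" if "u \<in> D" for n u
    by (rule dnorm_mono[OF that]) auto
  define S :: "((('a \<Rightarrow> complex) \<Rightarrow> complex) \<Rightarrow> real) set"
    where "S = {(\<lambda>u. SUP f\<in>B. norm (u f)) | B. vn_bounded T B \<and> B \<noteq> {}}"
  let ?Q = "range (\<lambda>n. dnorm (Suc n))"
  have bdd: "bdd_above ((\<lambda>f. norm (u f)) ` B)" if B: "vn_bounded T B" and u: "u \<in> D" for B u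
  proof -
    obtain n C where "\<forall>u\<in>D. \<forall>f\<in>B. norm (u f) \<le> C * dnorm n u"
      using vn_bounded_dominated[OF B] by blast
    thus ?thesis using u by (intro bdd_aboveI2[of _ _ "C * dnorm n u"]) blast
  qed
  have S: "\<forall>p\<in>S. seminorm_on D p"
  proof
    fix p assume "p \<in> S"
    then obtain B where B: "p = (\<lambda>u. SUP f\<in>B. norm (u f))" "vn_bounded T B" "B \<noteq> {}" unfolding S_def by blast
    show "seminorm_on D p" unfolding B(1)
      by (rule seminorm_SUP[OF subspace_D _ B(3) bdd[OF B(2)]])
        (auto simp: seminorm_on_def norm_mult norm_triangle_ineq)
  qed
  have QS: "?Q \<subseteq> S"
  proof
    fix p assume "p \<in> ?Q"
    then obtain n where n: "p = dnorm (Suc n)" by blast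
    have "p = (\<lambda>u. SUP f\<in>unit_ball (Suc n). norm (u f))" by (simp add: n dnorm_def fun_eq_iff)
    moreover have "vn_bounded T (unit_ball (Suc n))" by (rule vn_bounded_unit_ball) simp
    moreover have "unit_ball (Suc n) \<noteq> {}" using zero_unit_ball[of "Suc n"] by auto
    ultimately show "p \<in> S" unfolding S_def by blast
  qed
  have "lc_topology D S = lc_topology D ?Q"
  proof (rule lc_topology_eqI[OF subspace_D S])
    show "S \<noteq> {}" using QS by blast
    show "\<forall>q\<in>?Q. seminorm_on D q" using QS S by blast
    show "?Q \<noteq> {}" by simp
    show "\<exists>p\<in>S. \<exists>C. \<forall>u\<in>D. q u \<le> C * p u" if "q \<in> ?Q" for q
      by (rule bexI[of _ q], rule exI[of _ 1]) (use that QS in auto)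
    fix p assume "p \<in> S"
    then obtain B where B: "p = (\<lambda>u. SUP f\<in>B. norm (u f))" "vn_bounded T B" "B \<noteq> {}" unfolding S_def by blast
    obtain n C where n: "1 \<le> n" "\<forall>u\<in>D. \<forall>f\<in>B. norm (u f) \<le> C * dnorm n u"
      using vn_bounded_dominated[OF B(2)] by blast
    have "\<forall>u\<in>D. p u \<le> C * dnorm n u" unfolding B(1) by (intro ballI cSUP_least B(3) bspec[OF bspec[OF n(2)]])
    moreover have "dnorm n \<in> ?Q" using n(1) by (intro range_eqI[of _ _ "n - 1"]) simp
    ultimately show "\<exists>q\<in>?Q. \<exists>C. \<forall>u\<in>D. p u \<le> C * q u" by blast
  qed
  thus "SD = lc_topology D ?Q"
    unfolding strong_dual_topology_def S_def D_def .
qed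

lemma dual_separated:
  assumes u: "u \<in> D" "v \<in> D" "u \<noteq> v"
  obtains n where "dnorm (Suc n) (\<lambda>f. u f - v f) > 0"
proof -
  obtain f where f: "u f \<noteq> v f" using u(3) by blast
  \<comment> \<open>Functionals vanish off \<open>X\<close>, so a point where two of them differ
    lies in some step.\<close>
  have "f \<in> X" using f D_off u by metis
  then obtain n where n: "1 \<le> n" "f \<in> E n" by (auto simp: X_def)
  have d: "(\<lambda>f. u f - v f) \<in> D" using cspace_diff[OF subspace_D u(1,2)] .
  have "0 < norm (u f - v f)" using f by simp
  also have "\<dots> \<le> dnorm n (\<lambda>f. u f - v f) * N n f" by (rule dnorm_bound[OF d n])
  finally have "dnorm n (\<lambda>f. u f - v f) > 0"
    using norm_nonneg[OF n] dnorm_nonneg[OF d n(1)] by (simp add: zero_less_mult_iff)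
  thus ?thesis using that[of "n - 1"] n(1) by simp
qed

section \<open>Separation and completeness of the strong dual\<close>

lemma strong_dual_topology_eq: "SD = lc_topology D (range (\<lambda>n. dnorm (Suc n)))"
  and dnorms: "\<forall>p\<in>range (\<lambda>n. dnorm (Suc n)). seminorm_on D p"
  using strong_dual_fundamental unfolding fundamental_seminorms_def by blast+

lemma topspace_strong_dual: "topspace (SD) = D"
  unfolding strong_dual_topology_eq by (rule topspace_lc[OF subspace_D dnorms]) simp

lemma Hausdorff_strong_dual: "Hausdorff_space (SD)"
  unfolding Hausdorff_space_def
proof (intro allI impI)
  fix u v assume uv: "u \<in> topspace (SD) \<and> v \<in> topspace (SD) \<and> u \<noteq> v"
  hence u: "u \<in> D" and v: "v \<in> D" by (simp_all add: topspace_strong_dual)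
  obtain n where n: "dnorm (Suc n) (\<lambda>f. u f - v f) > 0"
    using dual_separated[OF u v] uv by blast
  define d where "d = dnorm (Suc n) (\<lambda>f. u f - v f) / 2"
  define V where "V w = {g \<in> D. dnorm (Suc n) (\<lambda>x. g x - w x) < d}" for w
  have d: "d > 0" using n by (simp add: d_def)
  have sn: "seminorm_on D (dnorm (Suc n))" by (rule dnorm_seminorm) simp
  have op: "openin (SD) (V w)" if "w \<in> D" for w
    unfolding strong_dual_topology_eq V_def
    by (rule openin_lc_ball[OF subspace_D dnorms _ that d]) blast
  have mem: "w \<in> V w" if "w \<in> D" for w
    using that d seminorm_zero[OF sn subspace_D] by (simp add: V_def)
  have "disjnt (V u) (V v)"
    unfolding disjnt_iff
  proof (intro allI notI)
    fix g assume g: "g \<in> V u \<and> g \<in> V v"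
    hence gD: "g \<in> D" by (simp add: V_def)
    have "dnorm (Suc n) (\<lambda>x. u x - v x) \<le> dnorm (Suc n) (\<lambda>x. u x - g x) + dnorm (Suc n) (\<lambda>x. g x - v x)"
      by (rule seminorm_triangle[OF sn subspace_D u gD v])
    also have "dnorm (Suc n) (\<lambda>x. u x - g x) = dnorm (Suc n) (\<lambda>x. g x - u x)"
      by (rule seminorm_minus_commute[OF sn subspace_D u gD])
    finally show False using g by (simp add: V_def d_def)
  qed
  thus "\<exists>U V. openin (SD) U \<and> openin (SD) V \<and> u \<in> U \<and> v \<in> V \<and> disjnt U V"
    using op[OF u] op[OF v] mem[OF u] mem[OF v] by blast
qed

text \<open>The limit is taken pointwise. Cauchy estimates proportional to \<open>N n f\<close>
  survive the passage to the limit and give both the boundedness of the limit on every step and the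
  convergence in every dual norm.\<close>

lemma strong_dual_complete:
  assumes s: "\<And>j. s j \<in> D"
    and cauchy: "\<And>n e. e > 0 \<Longrightarrow> \<exists>M. \<forall>i\<ge>M. \<forall>j\<ge>M. dnorm (Suc n) (\<lambda>x. s i x - s j x) < e"
  obtains l where "l \<in> D" "limitin (SD) s l sequentially"
proof -
  have diff: "(\<lambda>x. s i x - s j x) \<in> D" for i j using cspace_diff[OF subspace_D s s] .
  have close: "\<exists>M. \<forall>i\<ge>M. \<forall>j\<ge>M. \<forall>f\<in>E n. norm (s i f - s j f) \<le> e * N n f"
    if n: "1 \<le> n" and e: "e > 0" for n e
  proof -
    obtain M where M: "\<forall>i\<ge>M. \<forall>j\<ge>M. dnorm n (\<lambda>x. s i x - s j x) < e"
      using cauchy[OF e, of "n - 1"] n by auto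
    have "norm (s i f - s j f) \<le> e * N n f" if "i \<ge> M" "j \<ge> M" "f \<in> E n" for i j f
    proof -
      have "dnorm n (\<lambda>x. s i x - s j x) \<le> e" using M that(1,2) by (simp add: less_imp_le)
      hence "dnorm n (\<lambda>x. s i x - s j x) * N n f \<le> e * N n f"
        using norm_nonneg[OF n that(3)] by (rule mult_right_mono)
      thus ?thesis using dnorm_bound[OF diff n that(3), of i j] by linarith
    qed
    thus ?thesis by blast
  qed
  have conv: "convergent (\<lambda>i. s i f)" for f
  proof (cases "f \<in> X")
    case True
    then obtain n where n: "1 \<le> n" "f \<in> E n" by (auto simp: X_def)
    have "Cauchy (\<lambda>i. s i f)"
    proof (rule CauchyI)
      fix e :: real assume e: "e > 0"
      have N0: "0 \<le> N n f" using norm_nonneg[OF n] .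
      have e': "e / (N n f + 1) > 0" using e N0 by simp
      obtain M where M: "\<forall>i\<ge>M. \<forall>j\<ge>M. \<forall>f'\<in>E n. norm (s i f' - s j f') \<le> e / (N n f + 1) * N n f'"
        using close[OF n(1) e'] by (elim exE) (rule that)
      have "e / (N n f + 1) * N n f < e" using e N0 by (simp add: field_simps)
      thus "\<exists>M. \<forall>i\<ge>M. \<forall>j\<ge>M. norm (s i f - s j f) < e"
        using M n(2) by (meson le_less_trans)
    qed
    thus ?thesis by (rule Cauchy_convergent)
  next
    case False
    \<comment> \<open>Off the union of the steps every \<open>s i\<close> vanishes, so the limit
      inherits the normalisation of functionals.\<close>
    hence "(\<lambda>i. s i f) = (\<lambda>_. 0)" using D_off[OF s] by (simp add: fun_eq_iff)
    thus ?thesis by (simp add: convergent_const)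
  qed
  define l where "l f = lim (\<lambda>i. s i f)" for f
  have l: "(\<lambda>i. s i f) \<longlonglongrightarrow> l f" for f
    using conv[of f] by (simp add: l_def convergent_LIMSEQ_iff)
  have lim_close: "\<exists>M. \<forall>i\<ge>M. \<forall>f\<in>E n. norm (s i f - l f) \<le> e * N n f" if n: "1 \<le> n" and e: "e > 0" for n e
  proof -
    obtain M where M: "\<forall>i\<ge>M. \<forall>j\<ge>M. \<forall>f\<in>E n. norm (s i f - s j f) \<le> e * N n f"
      using close[OF n e] by blast
    have "norm (s i f - l f) \<le> e * N n f" if "i \<ge> M" "f \<in> E n" for i f
    proof (rule LIMSEQ_le_const2[OF tendsto_norm[OF tendsto_diff[OF tendsto_const l]]])
      show "\<exists>N'. \<forall>j\<ge>N'. norm (s i f - s j f) \<le> e * N n f" using M that by blast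
    qed
    thus ?thesis by blast
  qed
  have lD: "l \<in> D"
  proof (rule DI)
    fix f g assume fg: "f \<in> X" "g \<in> X"
    have "(\<lambda>i. s i (\<lambda>x. f x + g x)) \<longlonglongrightarrow> l f + l g"
      unfolding D_add[OF s fg] by (intro tendsto_add l)
    thus "l (\<lambda>x. f x + g x) = l f + l g" using l LIMSEQ_unique by blast
  next
    fix c f assume f: "f \<in> X"
    have "(\<lambda>i. s i (\<lambda>x. c * f x)) \<longlonglongrightarrow> c * l f"
      unfolding D_scale[OF s f] by (intro tendsto_mult tendsto_const l)
    thus "l (\<lambda>x. c * f x) = c * l f" using l LIMSEQ_unique by blast
  next
    fix f assume f: "f \<notin> X"
    have "(\<lambda>i. s i f) \<longlonglongrightarrow> 0" unfolding D_off[OF s f] by (rule tendsto_const)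
    thus "l f = 0" using l LIMSEQ_unique by blast
  next
    fix n :: nat assume n: "1 \<le> n"
    obtain M where M: "\<forall>i\<ge>M. \<forall>f\<in>E n. norm (s i f - l f) \<le> 1 * N n f"
      using lim_close[OF n zero_less_one] by blast
    have "norm (l f) \<le> (dnorm n (s M) + 1) * N n f" if f: "f \<in> E n" for f
    proof -
      have "norm (s M f - l f) \<le> 1 * N n f" using M f by blast
      moreover have "norm (s M f) \<le> dnorm n (s M) * N n f" by (rule dnorm_bound[OF s n f])
      moreover have "norm (l f) \<le> norm (s M f) + norm (s M f - l f)" by (metis norm_triangle_sub norm_minus_commute)
      ultimately show ?thesis by (simp add: algebra_simps)
    qed
    thus "\<exists>C. \<forall>f\<in>E n. norm (l f) \<le> C * N n f" by blast
  qed
  let ?Q = "range (\<lambda>n. dnorm (Suc n))"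
  have ne: "?Q \<noteq> {}" by simp
  have ev: "\<forall>\<^sub>F i in sequentially. p (\<lambda>x. s i x - l x) < e" if p: "p \<in> ?Q" and e: "e > 0" for p e
  proof -
    obtain n where n: "p = dnorm n" "1 \<le> n" using p by auto
    obtain M where M: "\<forall>i\<ge>M. \<forall>f\<in>E n. norm (s i f - l f) \<le> (e/2) * N n f"
      using lim_close[OF n(2), of "e/2"] e by auto
    have "p (\<lambda>x. s i x - l x) < e" if i: "i \<ge> M" for i
    proof -
      have "dnorm n (\<lambda>x. s i x - l x) \<le> e / 2"
      proof (rule dnorm_least[OF n(2)])
        fix f assume f: "f \<in> unit_ball n"
        have "norm (s i f - l f) \<le> (e/2) * N n f" using M i f by (simp add: unit_ball_def)
        also have "\<dots> \<le> (e/2) * 1" using f e by (intro mult_left_mono) (auto simp: unit_ball_def)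
        finally show "norm (s i f - l f) \<le> e / 2" by simp
      qed
      thus ?thesis using e n(1) by simp
    qed
    thus ?thesis unfolding eventually_sequentially by (intro exI allI impI)
  qed
  have "limitin (SD) s l sequentially"
    unfolding limitin_def
  proof (intro conjI allI impI)
    show "l \<in> topspace (SD)"
      unfolding topspace_strong_dual by (rule lD)
    fix U assume U: "openin (SD) U \<and> l \<in> U"
    obtain F e where F: "finite F" "F \<subseteq> ?Q" "e > 0" "{g \<in> D. \<forall>p\<in>F. p (\<lambda>x. g x - l x) < e} \<subseteq> U"
      by (rule openin_lcE[OF subspace_D dnorms ne
            conjunct1[OF U, unfolded strong_dual_topology_eq] conjunct2[OF U]])
    have "\<forall>\<^sub>F i in sequentially. \<forall>p\<in>F. p (\<lambda>x. s i x - l x) < e"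
      by (rule eventually_ball_finite[OF F(1)]) (use ev F(2,3) in blast)
    thus "\<forall>\<^sub>F i in sequentially. s i \<in> U"
      by (rule eventually_mono) (use F(4) s in blast)
  qed
  thus ?thesis using that lD by blast
qed

theorem frechet_strong_dual: "frechet_space (top_dual T) (SD)"
  unfolding frechet_space_def D_def[symmetric]
proof (intro conjI subspace_D Hausdorff_strong_dual exI[of _ "\<lambda>n. dnorm (Suc n)"] strong_dual_fundamental allI impI)
  fix s :: "nat \<Rightarrow> ('a \<Rightarrow> complex) \<Rightarrow> complex"
  assume s: "(\<forall>j. s j \<in> D) \<and>
    (\<forall>n. \<forall>e>0. \<exists>M. \<forall>i\<ge>M. \<forall>j\<ge>M. dnorm (Suc n) (\<lambda>x. s i x - s j x) < e)"
  show "\<exists>l\<in>D. limitin (SD) s l sequentially"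
    by (rule strong_dual_complete[of s]) (use s in blast)+
qed

section \<open>Interpolation of dual norms from splittings of unit balls\<close>

definition splits :: "nat \<Rightarrow> real \<Rightarrow> real \<Rightarrow> ('a \<Rightarrow> complex) \<Rightarrow> bool" where
  "splits k a b f \<longleftrightarrow> (\<exists>g\<in>E 1. \<exists>h\<in>E k. f = (\<lambda>x. g x + h x) \<and> N 1 g \<le> a \<and> N k h \<le> b)"

lemma splits_mono: "splits k a b f \<Longrightarrow> a \<le> a' \<Longrightarrow> b \<le> b' \<Longrightarrow> splits k a' b' f"
  unfolding splits_def by (meson order_trans)

text \<open>Pairing \<open>u\<close> with both parts of a splitting gives, up to the factor
  \<open>C\<close>, the bound a exp(L s) + c exp(-b s), where a and c are the dual norms of index 1
  and \<open>k\<close>. The two terms are balanced by a suitable s, and their common value is the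
  weighted geometric mean.\<close>

lemma dnorm_interpolation:
  assumes L: "L > 0" and b: "b > 0" and C: "C > 0" and m: "1 \<le> m" "m \<le> k"
    and dec: "\<And>s f. s \<ge> 0 \<Longrightarrow> f \<in> unit_ball m \<Longrightarrow> splits k (C * exp (L * s)) (C * exp (- (b * s))) f"
    and u: "u \<in> D"
  shows "dnorm m u \<le> (2 * C) * dnorm 1 u powr (b / (L + b)) * dnorm k u powr (1 - b / (L + b))"
proof -
  define a where "a = dnorm 1 u"
  define c where "c = dnorm k u"
  have k: "1 \<le> k" using m by simp
  have a0: "0 \<le> a" and ac: "a \<le> c" and c0: "0 \<le> c"
    unfolding a_def c_def using dnorm_nonneg[OF u] dnorm_mono[OF u _ k] k by auto
  have est: "dnorm m u \<le> a * (C * exp (L * s)) + c * (C * exp (- (b * s)))" if s: "s \<ge> 0" for s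
  proof (rule dnorm_least[OF m(1)])
    fix f assume f: "f \<in> unit_ball m"
    obtain g h where gh: "g \<in> E 1" "h \<in> E k" "f = (\<lambda>x. g x + h x)"
      "N 1 g \<le> C * exp (L * s)" "N k h \<le> C * exp (- (b * s))"
      using dec[OF s f] unfolding splits_def by (elim bexE conjE) (rule that)
    have gX: "g \<in> X" using gh(1) EX[of 1] by auto
    have hX: "h \<in> X" using gh(2) EX[OF k] by auto
    have "norm (u f) \<le> norm (u g) + norm (u h)"
      unfolding gh(3) D_add[OF u gX hX] by (rule norm_triangle_ineq)
    also have "norm (u g) \<le> a * N 1 g" unfolding a_def by (rule dnorm_bound[OF u _ gh(1)]) simp
    also have "a * N 1 g \<le> a * (C * exp (L * s))" using gh(4) a0 by (rule mult_left_mono)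
    also have "norm (u h) \<le> c * N k h" unfolding c_def by (rule dnorm_bound[OF u k gh(2)])
    also have "c * N k h \<le> c * (C * exp (- (b * s)))" using gh(5) c0 by (rule mult_left_mono)
    finally show "norm (u f) \<le> a * (C * exp (L * s)) + c * (C * exp (- (b * s)))" by simp
  qed
  show ?thesis
  proof (cases "a = 0")
    \<comment> \<open>Here \<open>powr\<close> makes the right side 0, so the left side has to
      vanish as well. The term with \<open>c\<close> decays in \<open>s\<close>, and the
      \<open>s\<close> chosen below makes it at most half of \<open>dnorm m u\<close>.\<close>
    case True
    have "dnorm m u \<le> 0"
    proof (rule ccontr)
      assume "\<not> ?thesis"
      hence d: "dnorm m u > 0" by simp
      have "dnorm m u \<le> c * C" using est[of 0] True by simp
      hence cC: "c * C > 0" using d by linarith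
      define s where "s = max 0 (ln (2 * (c * C) / dnorm m u) / b)"
      have "ln (2 * (c * C) / dnorm m u) / b \<le> s" by (simp add: s_def)
      hence "ln (2 * (c * C) / dnorm m u) \<le> b * s" using b by (simp add: field_simps)
      hence "exp (ln (2 * (c * C) / dnorm m u)) \<le> exp (b * s)" by (simp only: exp_le_cancel_iff)
      hence "2 * (c * C) / dnorm m u \<le> exp (b * s)" using cC d by simp
      hence "2 * (c * C) * exp (- (b * s)) \<le> dnorm m u" using d by (simp add: exp_minus field_simps)
      moreover have "dnorm m u \<le> (c * C) * exp (- (b * s))" using est[of s] True by (simp add: s_def mult.assoc)
      ultimately show False using d by linarith
    qed
    thus ?thesis using True by (simp add: a_def)
  next
    case False
    hence a: "a > 0" using a0 by simp
    have c: "c > 0" using a ac by simp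
    \<comment> \<open>Solves exp((L + b) s) = c / a, so both terms agree. Dual norms increase with
      the index, hence \<open>a \<le> c\<close> and this \<open>s\<close> is admissible.\<close>
    define s where "s = (ln c - ln a) / (L + b)"
    have s: "s \<ge> 0" using a ac L b by (simp add: s_def)
    have Lb: "L + b > 0" using L b by simp
    have affine': "ln a + (1 - w) * (ln c - ln a) = w * ln a + (1 - w) * ln c" for w
      by (simp add: algebra_simps)
    have affine: "ln c + - (w * (ln c - ln a)) = w * ln a + (1 - w) * ln c" for w
      by (simp add: algebra_simps)
    define t where "t = exp (b / (L + b) * ln a + (1 - b / (L + b)) * ln c)"
    have t: "a powr (b / (L + b)) * c powr (1 - b / (L + b)) = t"
      using a c by (simp add: t_def powr_def exp_add)
    have Ls: "L * s = (1 - b / (L + b)) * (ln c - ln a)"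
      using Lb by (simp add: s_def field_simps)
    have bs: "b * s = b / (L + b) * (ln c - ln a)"
      by (simp add: s_def)
    have "a * exp (L * s) = exp (ln a + L * s)" using a by (simp add: exp_add)
    also have "ln a + L * s = b / (L + b) * ln a + (1 - b / (L + b)) * ln c"
      unfolding Ls by (rule affine')
    finally have 1: "a * exp (L * s) = t" by (simp add: t_def)
    have "c * exp (- (b * s)) = exp (ln c + - (b * s))" unfolding exp_add using c by simp
    also have "ln c + - (b * s) = b / (L + b) * ln a + (1 - b / (L + b)) * ln c"
      unfolding bs by (rule affine)
    finally have 2: "c * exp (- (b * s)) = t" by (simp add: t_def)
    have "dnorm m u \<le> C * (a * exp (L * s)) + C * (c * exp (- (b * s)))"
      using est[OF s] by (simp add: mult_ac)
    also have "\<dots> = (2 * C) * t" unfolding 1 2 by simp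
    finally show ?thesis using t by (simp add: a_def c_def mult.assoc)
  qed
qed

text \<open>An arbitrary fundamental sequence is compared with the dual norms in both directions:
  \<open>q m\<close> lies below some \<open>dnorm (Suc m')\<close>, while \<open>dnorm 1\<close> and
  \<open>dnorm k'\<close> lie below \<open>q n\<close> and \<open>q k\<close>, up to constants. The
  index \<open>n\<close> comes from \<open>dnorm 1\<close> alone and is therefore fixed before
  \<open>m\<close>.\<close>

theorem DN_strong_dual:
  assumes L: "L > 0"
    and dec: "\<And>m. 1 \<le> m \<Longrightarrow> \<exists>k\<ge>m. \<exists>b>0. \<exists>C>0. \<forall>s\<ge>0. \<forall>f\<in>unit_ball m. splits k (C * exp (L * s)) (C * exp (- (b * s))) f"
  shows "satisfies_DN_underlined (top_dual T) (SD)"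
  unfolding satisfies_DN_underlined_def D_def[symmetric]
proof (intro allI impI)
  fix q assume q: "fundamental_seminorms D (SD) q"
  note dom1 = fundamental_seminorms_dominate[OF subspace_D q strong_dual_fundamental]
  note dom2 = fundamental_seminorms_dominate[OF subspace_D strong_dual_fundamental q]
  obtain n A where n: "A > 0" "\<forall>u\<in>D. dnorm 1 u \<le> A * q n u"
    using dom1[of 0 0] by auto
  have sq: "seminorm_on D (q i)" for i using q unfolding fundamental_seminorms_def by blast
  have "\<exists>\<theta>\<in>{0<..<1}. \<exists>k\<ge>m. \<exists>C>0. \<forall>u\<in>D. q m u \<le> C * q n u powr \<theta> * q k u powr (1 - \<theta>)" for m
  proof -
    obtain m' B where m': "B > 0" "\<forall>u\<in>D. q m u \<le> B * dnorm (Suc m') u"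
      using dom2[of 0 m] by auto
    have Sm: "1 \<le> Suc m'" by simp
    obtain k' b C where k': "k' \<ge> Suc m'" "b > 0" "C > 0"
      "\<forall>s\<ge>0. \<forall>f\<in>unit_ball (Suc m'). splits k' (C * exp (L * s)) (C * exp (- (b * s))) f"
      using dec[OF Sm] by (elim exE conjE) (rule that)
    define \<theta> where "\<theta> = b / (L + b)"
    have \<theta>: "\<theta> \<in> {0<..<1}" using L k'(2) by (simp add: \<theta>_def)
    obtain k A' where k: "k \<ge> m" "A' > 0" "\<forall>u\<in>D. dnorm k' u \<le> A' * q k u"
      using dom1[of m "k' - 1"] k'(1) by auto
    have "q m u \<le> (B * (2 * C) * A powr \<theta> * A' powr (1 - \<theta>)) * q n u powr \<theta> * q k u powr (1 - \<theta>)" if u: "u \<in> D" for u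
    proof -
      have qn: "0 \<le> q n u" "0 \<le> q k u" using seminorm_nonneg[OF sq u] by auto
      have k1: "1 \<le> k'" using k'(1) by simp
      have "dnorm (Suc m') u \<le> (2 * C) * dnorm 1 u powr \<theta> * dnorm k' u powr (1 - \<theta>)"
        unfolding \<theta>_def by (rule dnorm_interpolation[OF L k'(2,3) Sm k'(1) _ u]) (use k'(4) in blast)
      also have "\<dots> \<le> (2 * C) * (A * q n u) powr \<theta> * (A' * q k u) powr (1 - \<theta>)"
        using \<theta> k'(3) dnorm_nonneg[OF u] k1 bspec[OF n(2) u] bspec[OF k(3) u]
        by (intro mult_mono powr_mono2 mult_nonneg_nonneg) auto
      also have "\<dots> = (2 * C) * A powr \<theta> * A' powr (1 - \<theta>) * q n u powr \<theta> * q k u powr (1 - \<theta>)"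
        using n(1) k(2) qn by (simp add: powr_mult)
      finally have "B * dnorm (Suc m') u \<le> B * ((2 * C) * A powr \<theta> * A' powr (1 - \<theta>) * q n u powr \<theta> * q k u powr (1 - \<theta>))"
        using m'(1) by (intro mult_left_mono) auto
      thus ?thesis using bspec[OF m'(2) u] by (simp add: mult_ac)
    qed
    moreover have "B * (2 * C) * A powr \<theta> * A' powr (1 - \<theta>) > 0" using m'(1) k'(3) n(1) k(2) by simp
    ultimately show ?thesis using \<theta> k(1) by blast
  qed
  thus "\<exists>n. \<forall>m\<ge>n. \<exists>\<theta>\<in>{0<..<1}. \<exists>k\<ge>m. \<exists>C>0. \<forall>u\<in>D. q m u \<le> C * q n u powr \<theta> * q k u powr (1 - \<theta>)"
    by blast
qed

end

section \<open>Weight functions and the Young conjugate\<close>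

locale weight =
  fixes \<omega> :: "real \<Rightarrow> real"
  assumes weight: "weight_function \<omega>"
begin

lemma cont: "continuous_on {0..} \<omega>"
  and mono: "0 \<le> s \<Longrightarrow> s \<le> t \<Longrightarrow> \<omega> s \<le> \<omega> t"
  and nonneg: "0 \<le> t \<Longrightarrow> 0 \<le> \<omega> t"
  and zero: "0 \<le> t \<Longrightarrow> t \<le> 1 \<Longrightarrow> \<omega> t = 0"
  and doubling: "(\<lambda>t. \<omega> (2 * t)) \<in> O(\<omega>)"
  and ln_small: "(\<lambda>t. ln t) \<in> o(\<omega>)"
  and convex: "convex_on {0..} (\<lambda>x. \<omega> (exp x))"
  using weight by (auto simp: weight_function_def mono_on_def)

text \<open>Condition (gamma) in the variable x = log t; the additive constant covers the bounded
  range where the asymptotic estimate is not yet in force.\<close>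

lemma le_eps:
  assumes e: "e > 0"
  obtains C where "C \<ge> 0" "\<And>x. x \<ge> 0 \<Longrightarrow> x \<le> e * \<omega> (exp x) + C"
proof -
  have "eventually (\<lambda>t. norm (ln t) \<le> e * norm (\<omega> t)) at_top"
    using landau_o.smallD[OF ln_small e] .
  then obtain T where T: "\<And>t. t \<ge> T \<Longrightarrow> norm (ln t) \<le> e * norm (\<omega> t)"
    by (auto simp: eventually_at_top_linorder)
  have "x \<le> e * \<omega> (exp x) + ln (max T 1)" if x: "x \<ge> 0" for x
  proof (cases "exp x \<ge> T")
    case True
    have "x \<le> e * \<omega> (exp x)" using T[OF True] x nonneg[of "exp x"] by simp
    moreover have "0 \<le> ln (max T 1)" by simp
    ultimately show ?thesis by linarith
  next
    case False
    hence "x \<le> ln (max T 1)" by (subst ln_ge_iff) auto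
    thus ?thesis using nonneg[of "exp x"] e by (simp add: add_increasing)
  qed
  thus ?thesis using that[of "ln (max T 1)"] by simp
qed

lemma psi_star_bdd: "bdd_above ((\<lambda>x. x * y - \<omega> (exp x)) ` {0..})"
proof -
  \<comment> \<open>Makes \<open>e * \<bar>y\<bar> \<le> 1\<close>, so that
    \<open>\<omega> (exp x)\<close> absorbs the linear term.\<close>
  define e where "e = 1 / (\<bar>y\<bar> + 1)"
  have e: "e > 0" by (simp add: e_def add_nonneg_pos)
  obtain C where C: "C \<ge> 0" "\<And>x. x \<ge> 0 \<Longrightarrow> x \<le> e * \<omega> (exp x) + C" using le_eps[OF e] by blast
  have "x * y - \<omega> (exp x) \<le> \<bar>y\<bar> * C" if x: "x \<in> {0..}" for x
  proof -
    have w: "0 \<le> \<omega> (exp x)" using nonneg by simp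
    have "x * y \<le> x * \<bar>y\<bar>" using x by (intro mult_left_mono) auto
    also have "\<dots> \<le> (e * \<omega> (exp x) + C) * \<bar>y\<bar>" using C(2)[of x] x by (intro mult_right_mono) auto
    also have "\<dots> = (e * \<bar>y\<bar>) * \<omega> (exp x) + \<bar>y\<bar> * C" by (simp add: algebra_simps)
    also have "(e * \<bar>y\<bar>) * \<omega> (exp x) \<le> 1 * \<omega> (exp x)"
      using w by (intro mult_right_mono) (auto simp: e_def field_simps)
    finally show ?thesis by simp
  qed
  thus ?thesis by (rule bdd_aboveI2)
qed

lemma young: "0 \<le> x \<Longrightarrow> x * y \<le> psi_star \<omega> y + \<omega> (exp x)"
  using cSUP_upper[OF _ psi_star_bdd, of x y] by (simp add: psi_star_def)

lemma psi_star_least: "(\<And>x. 0 \<le> x \<Longrightarrow> x * y - \<omega> (exp x) \<le> B) \<Longrightarrow> psi_star \<omega> y \<le> B"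
  unfolding psi_star_def by (rule cSUP_least) auto

lemma psi_star_zero: "psi_star \<omega> 0 = 0"
proof (rule antisym)
  show "psi_star \<omega> 0 \<le> 0" by (rule psi_star_least) (simp add: nonneg)
  show "0 \<le> psi_star \<omega> 0" using young[of 0 0] zero[of 1] by simp
qed

text \<open>A supremum of affine functions is convex. The doubled arguments anticipate the passage
  from index m to 2 m in the weights.\<close>

lemma psi_star_midpoint: "2 * psi_star \<omega> (a + b) \<le> psi_star \<omega> (2 * a) + psi_star \<omega> (2 * b)"
proof -
  have "psi_star \<omega> (a + b) \<le> (psi_star \<omega> (2 * a) + psi_star \<omega> (2 * b)) / 2"
  proof (rule psi_star_least)
    fix x :: real assume "0 \<le> x"
    thus "x * (a + b) - \<omega> (exp x) \<le> (psi_star \<omega> (2 * a) + psi_star \<omega> (2 * b)) / 2"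
      using young[of x "2 * a"] young[of x "2 * b"] by (simp add: algebra_simps)
  qed
  thus ?thesis by simp
qed

text \<open>The quotient is the supremum of x y - psi(x) / n, which grows with n because psi is
  non-negative. This is what makes the steps nested.\<close>

lemma psi_star_scale_mono:
  assumes n: "1 \<le> n" and nm: "n \<le> m"
  shows "psi_star \<omega> (real n * y) / real n \<le> psi_star \<omega> (real m * y) / real m"
proof -
  have n0: "0 < real n" "0 < real m" using n nm by auto
  have "psi_star \<omega> (real n * y) \<le> real n * (psi_star \<omega> (real m * y) / real m)"
  proof (rule psi_star_least)
    fix x :: real assume x: "0 \<le> x"
    have "x * (real m * y) \<le> psi_star \<omega> (real m * y) + \<omega> (exp x)" by (rule young[OF x])
    hence "x * y \<le> (psi_star \<omega> (real m * y) + \<omega> (exp x)) / real m" using n0 by (simp add: field_simps)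
    hence "real n * (x * y) \<le> real n * ((psi_star \<omega> (real m * y) + \<omega> (exp x)) / real m)"
      by (rule mult_left_mono) simp
    also have "\<dots> = real n * (psi_star \<omega> (real m * y) / real m) + real n / real m * \<omega> (exp x)"
      by (simp add: algebra_simps add_divide_distrib)
    also have "real n / real m * \<omega> (exp x) \<le> 1 * \<omega> (exp x)"
      using nm n0 nonneg by (intro mult_right_mono) auto
    finally show "x * (real n * y) - \<omega> (exp x) \<le> real n * (psi_star \<omega> (real m * y) / real m)"
      by (simp add: algebra_simps)
  qed
  thus ?thesis using n0 by (simp add: field_simps)
qed

text \<open>Condition (alpha) iterated \<open>j\<close> times; the summand 1 turns the asymptotic
  estimate into one for all \<open>t \<ge> 0\<close>.\<close>

lemma dilation_pow:
  "\<exists>L\<ge>0. \<forall>t\<ge>0. \<omega> (2 ^ j * t) \<le> L * (\<omega> t + 1)"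
proof -
  obtain c where c: "c > 0" "eventually (\<lambda>t. norm (\<omega> (2 * t)) \<le> c * norm (\<omega> t)) at_top"
    using landau_o.bigE[OF doubling] by blast
  then obtain T where T: "\<And>t. t \<ge> T \<Longrightarrow> norm (\<omega> (2 * t)) \<le> c * norm (\<omega> t)"
    by (auto simp: eventually_at_top_linorder)
  \<comment> \<open>By monotonicity the second entry bounds \<open>\<omega> (2 * t)\<close> for
    \<open>t\<close> below \<open>T\<close>.\<close>
  define c' where "c' = max c (\<omega> (2 * max T 0))"
  have c': "c' > 0" using c by (simp add: c'_def)
  have dbl: "\<omega> (2 * t) \<le> c' * (\<omega> t + 1)" if t: "t \<ge> 0" for t
  proof (cases "t \<ge> T")
    case True
    have "\<omega> (2 * t) \<le> c * \<omega> t" using T[OF True] nonneg t by simp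
    also have "\<dots> \<le> c' * (\<omega> t + 1)" using c' nonneg[OF t] c by (intro mult_mono) (auto simp: c'_def)
    finally show ?thesis .
  next
    case False
    have "\<omega> (2 * t) \<le> \<omega> (2 * max T 0)" by (rule mono) (use False t in auto)
    also have "\<dots> \<le> c'" by (simp add: c'_def)
    also have "\<dots> \<le> c' * (\<omega> t + 1)" using c' nonneg[OF t] by simp
    finally show ?thesis .
  qed
  show ?thesis
  proof (induction j)
    case 0
    show ?case by (rule exI[of _ 1]) auto
  next
    case (Suc j)
    then obtain L where L: "L \<ge> 0" "\<forall>t\<ge>0. \<omega> (2 ^ j * t) \<le> L * (\<omega> t + 1)" by blast
    have "\<omega> (2 ^ Suc j * t) \<le> (c' * (L + 1)) * (\<omega> t + 1)" if t: "t \<ge> 0" for t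
    proof -
      have "\<omega> (2 ^ Suc j * t) = \<omega> (2 * (2 ^ j * t))" by (simp add: mult.assoc)
      also have "\<dots> \<le> c' * (\<omega> (2 ^ j * t) + 1)" by (rule dbl) (use t in simp)
      also have "\<dots> \<le> c' * (L * (\<omega> t + 1) + 1 * (\<omega> t + 1))"
        using L(2) t c' nonneg[OF t] by (intro mult_left_mono add_mono) auto
      finally show ?thesis by (simp add: algebra_simps)
    qed
    thus ?case using L(1) c' by (intro exI[of _ "c' * (L + 1)"]) auto
  qed
qed

lemma dilation:
  assumes r: "r \<ge> 0"
  obtains L where "L \<ge> 0" "\<And>t. t \<ge> 0 \<Longrightarrow> \<omega> (r * t) \<le> L * (\<omega> t + 1)"
proof -
  obtain j where j: "r < 2 ^ j" using real_arch_pow[of 2 r] by auto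
  obtain L where L: "L \<ge> 0" "\<forall>t\<ge>0. \<omega> (2 ^ j * t) \<le> L * (\<omega> t + 1)" using dilation_pow by blast
  have "\<omega> (r * t) \<le> L * (\<omega> t + 1)" if t: "t \<ge> 0" for t
  proof -
    have "\<omega> (r * t) \<le> \<omega> (2 ^ j * t)" by (rule mono) (use j t r in \<open>auto intro!: mult_right_mono\<close>)
    thus ?thesis using L(2) t by (meson order_trans)
  qed
  thus ?thesis using that L(1) by blast
qed

text \<open>With \<open>\<eta>\<close> the right derivative of \<open>\<psi>\<close> at \<open>x\<close>, \<open>\<psi>\<^sup>*(\<eta>) = x \<eta> - \<psi>(x)\<close>; \<open>N\<close> is the integer part of
  \<open>\<eta> / (2 m)\<close>, which costs the factor \<open>e\<^sup>x\<close>.\<close>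

lemma optimal_order:
  assumes x: "x \<ge> 0" and k: "1 \<le> k"
  obtains N :: nat where "real N \<le> \<omega> (exp (x + 1))"
    "psi_star \<omega> (real k * real N) / real k - real N * x \<le> x - \<omega> (exp x) / real k"
proof (cases "x = 0")
  case True
  \<comment> \<open>Here \<open>\<omega> 1 = 0\<close>, so \<open>N = 0\<close> works. A positive
    \<open>x\<close> is interior to the half-line, as the supporting line below requires.\<close>
  thus ?thesis using that[of 0] nonneg zero[of 1] by (simp add: psi_star_zero)
next
  case False
  hence x0: "x > 0" using x by simp
  define \<psi> where "\<psi> z = \<omega> (exp z)" for z
  define \<eta> where "\<eta> = Inf ((\<lambda>t. (\<psi> x - \<psi> t) / (x - t)) ` ({x<..} \<inter> {0..}))"
  have xi: "x \<in> interior {0..}" using x0 by (simp add: interior_real_atLeast)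
  have sub: "\<psi> z \<ge> \<psi> x + \<eta> * (z - x)" if "z \<ge> 0" for z
    unfolding \<eta>_def by (rule convex_le_Inf_differential[OF _ xi]) (use convex that in \<open>auto simp: \<psi>_def\<close>)
  \<comment> \<open>The supporting slope at \<open>x\<close> is at most the increment of
    \<open>\<psi>\<close> over the unit interval to its right.\<close>
  have eta1: "\<eta> \<le> \<omega> (exp (x + 1))"
    using sub[of "x + 1"] x nonneg[of "exp x"] by (simp add: \<psi>_def)
  have eta0: "\<eta> \<ge> 0"
  proof -
    have "\<psi> x + \<eta> * (0 - x) \<le> \<psi> 0" by (rule sub) simp
    also have "\<psi> 0 \<le> \<psi> x" unfolding \<psi>_def by (rule mono) (use x in auto)
    finally have "0 \<le> \<eta> * x" by simp
    thus ?thesis using x0 by (simp add: zero_le_mult_iff)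
  qed
  have k0: "real k > 0" using k by simp
  define N where "N = nat \<lfloor>\<eta> / real k\<rfloor>"
  have N: "real N \<le> \<eta> / real k" "\<eta> / real k < real N + 1"
    using eta0 k0 by (auto simp: N_def)
  have Nk: "real k * real N \<le> \<eta>" "\<eta> < real k * real N + real k"
    using N k0 by (auto simp: field_simps)
  show ?thesis
  proof (rule that)
    have "1 * real N \<le> real k * real N" using k by (intro mult_right_mono) auto
    hence "real N \<le> \<eta>" using Nk(1) by simp
    thus "real N \<le> \<omega> (exp (x + 1))" using eta1 by simp
    \<comment> \<open>The supporting line bounds every term of the supremum; replacing
      \<open>\<eta>\<close> by \<open>real k * real N\<close> costs at most
      \<open>real k * x\<close>, since the rounding error is below \<open>k\<close>.\<close>
    have "psi_star \<omega> (real k * real N) \<le> real k * real N * x - \<psi> x + real k * x"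
    proof (rule psi_star_least)
      fix z :: real assume z: "0 \<le> z"
      have "(\<eta> - real k * real N) * x \<le> real k * x" using Nk x by (intro mult_right_mono) auto
      moreover have "0 \<le> (\<eta> - real k * real N) * z" using Nk z by simp
      ultimately show "z * (real k * real N) - \<omega> (exp z) \<le> real k * real N * x - \<psi> x + real k * x"
        using sub[OF z] by (simp add: \<psi>_def algebra_simps)
    qed
    hence "psi_star \<omega> (real k * real N) / real k \<le> (real k * real N * x - \<psi> x + real k * x) / real k"
      using k0 by (intro divide_right_mono) auto
    also have "\<dots> = real N * x + x - \<omega> (exp x) / real k" using k0 by (simp add: \<psi>_def field_simps)
    finally show "psi_star \<omega> (real k * real N) / real k - real N * x \<le> x - \<omega> (exp x) / real k" by simp
  qed
qed

text \<open>The estimate x <= omega(exp x) + C supplies an upper end point for the intermediate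
  value theorem. The lemma converts the free parameter \<open>s\<close> of a splitting into a scale
  \<open>x\<close>.\<close>

lemma attains:
  assumes s: "s \<ge> 0"
  obtains x where "x \<ge> 0" "\<omega> (exp x) = s"
proof -
  obtain C where C: "C \<ge> 0" "\<And>x. x \<ge> 0 \<Longrightarrow> x \<le> 1 * \<omega> (exp x) + C" using le_eps[of 1] by auto
  have "\<exists>x\<ge>0. x \<le> s + C \<and> \<omega> (exp x) = s"
  proof (rule IVT')
    show "\<omega> (exp 0) \<le> s" using zero[of 1] s by simp
    show "s \<le> \<omega> (exp (s + C))" using C(2)[of "s + C"] s C(1) by simp
    show "0 \<le> s + C" using s C by simp
    have "continuous_on {0..s + C} (\<omega> \<circ> exp)"
      by (rule continuous_on_compose[OF continuous_on_exp[OF continuous_on_id] continuous_on_subset[OF cont]]) auto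
    thus "continuous_on {0..s + C} (\<lambda>x. \<omega> (exp x))" by (simp add: o_def)
  qed
  thus ?thesis using that by blast
qed

end

section \<open>A band-limited kernel\<close>

text \<open>The \<open>j\<close>-th derivative of sin x / x, written as a cosine transform over
  [0, 1]. This form has no singularity at 0, and since the frequencies do not exceed 1, all
  derivatives are bounded by 1.\<close>

definition dsinc :: "nat \<Rightarrow> real \<Rightarrow> real" where
  "dsinc j x = integral {0..1} (\<lambda>t. t ^ j * cos (t * x + real j * pi / 2))"

lemma dsinc_DERIV: "(dsinc j has_real_derivative dsinc (Suc j) x) (at x)"
proof -
  have "((\<lambda>x. integral (cbox 0 1) (\<lambda>t::real. t ^ j * cos (t * x + real j * pi / 2))) has_real_derivative
      integral (cbox 0 1) (\<lambda>t. t ^ Suc j * cos (t * x + real (Suc j) * pi / 2))) (at x within UNIV)"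
  proof (rule leibniz_rule_field_derivative[where fx = "\<lambda>x t. t ^ Suc j * cos (t * x + real (Suc j) * pi / 2)"])
    fix x t :: real
    have "t * x + real (Suc j) * pi / 2 = (t * x + real j * pi / 2) + pi / 2" by (simp add: field_simps)
    hence *: "cos (t * x + real (Suc j) * pi / 2) = - sin (t * x + real j * pi / 2)"
      by (simp only: cos_add) simp
    show "((\<lambda>x. t ^ j * cos (t * x + real j * pi / 2)) has_real_derivative
        t ^ Suc j * cos (t * x + real (Suc j) * pi / 2)) (at x within UNIV)"
      unfolding * by (auto intro!: derivative_eq_intros)
  next
    show "(\<lambda>t::real. t ^ j * cos (t * x + real j * pi / 2)) integrable_on cbox 0 1" for x
      by (intro integrable_continuous continuous_intros)
    show "continuous_on (UNIV \<times> cbox 0 1) (\<lambda>(x, t::real). t ^ Suc j * cos (t * x + real (Suc j) * pi / 2))"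
      unfolding split_def by (intro continuous_intros)
  qed auto
  thus ?thesis by (simp add: dsinc_def[abs_def])
qed

lemma dsinc_le_1: "\<bar>dsinc j x\<bar> \<le> 1"
proof -
  have "norm (integral {0..1} (\<lambda>t. t ^ j * cos (t * x + real j * pi / 2))) \<le> integral {0..1::real} (\<lambda>t. 1::real)"
  proof (rule integral_norm_bound_integral)
    fix t :: real assume t: "t \<in> {0..1}"
    have "\<bar>t\<bar> ^ j * \<bar>cos (t * x + real j * pi / 2)\<bar> \<le> 1 * 1"
      using t by (intro mult_mono power_le_one) auto
    thus "norm (t ^ j * cos (t * x + real j * pi / 2)) \<le> 1" by (simp add: abs_mult power_abs)
  qed (auto intro!: integrable_continuous_real continuous_intros)
  thus ?thesis by (simp add: dsinc_def)
qed

text \<open>Integration by parts in the transform. The weight t^j has total variation at most 1 on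
  [0, 1], so the bound 2 does not depend on \<open>j\<close>.\<close>

lemma dsinc_decay: "\<bar>x * dsinc j x\<bar> \<le> 2"
proof -
  let ?\<phi> = "\<lambda>t. t * x + real j * pi / 2"
  define F where "F t = t ^ j * sin (?\<phi> t)" for t
  define g where "g t = real j * t ^ (j - 1)" for t :: real
  define I where "I = integral {0..1} (\<lambda>t. g t * sin (?\<phi> t))"
  have "((\<lambda>t. g t * sin (?\<phi> t) + x * (t ^ j * cos (?\<phi> t))) has_integral F 1 - F 0) {0..1}"
    unfolding F_def
    by (intro fundamental_theorem_of_calculus)
      (auto simp flip: has_real_derivative_iff_has_vector_derivative intro!: derivative_eq_intros simp: algebra_simps g_def)
  moreover have "((\<lambda>t. g t * sin (?\<phi> t)) has_integral I) {0..1}"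
    unfolding I_def g_def by (intro integrable_integral integrable_continuous_real continuous_intros)
  ultimately have "((\<lambda>t. (g t * sin (?\<phi> t) + x * (t ^ j * cos (?\<phi> t))) - g t * sin (?\<phi> t)) has_integral (F 1 - F 0) - I) {0..1}"
    by (rule has_integral_diff)
  hence "((\<lambda>t. x * (t ^ j * cos (?\<phi> t))) has_integral (F 1 - F 0) - I) {0..1}" by simp
  hence "integral {0..1} (\<lambda>t. x * (t ^ j * cos (?\<phi> t))) = (F 1 - F 0) - I" by (rule integral_unique)
  hence eq: "x * dsinc j x = (F 1 - F 0) - I" by (simp add: dsinc_def)
  \<comment> \<open>For \<open>j = 0\<close> the sine has phase 0; otherwise the power
    vanishes.\<close>
  have F0: "F 0 = 0" by (cases j) (auto simp: F_def)
  have "\<bar>F 1\<bar> \<le> 1" by (simp add: F_def)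
  moreover have "norm I \<le> 1"
  proof -
    have gI: "(g has_integral (1 ^ j - 0 ^ j)) {0..1}"
      unfolding g_def by (intro fundamental_theorem_of_calculus)
        (auto simp flip: has_real_derivative_iff_has_vector_derivative intro!: derivative_eq_intros)
    have "norm I \<le> integral {0..1} g" unfolding I_def
    proof (rule integral_norm_bound_integral)
      show "norm (g t * sin (?\<phi> t)) \<le> g t" if "t \<in> {0..1}" for t
        using that mult_left_mono[OF abs_sin_le_one[of "?\<phi> t"], of "\<bar>g t\<bar>"] by (simp add: abs_mult g_def)
    qed (auto simp: g_def intro!: integrable_continuous_real continuous_intros)
    also have "\<dots> = 1 ^ j - 0 ^ j" using gI by (rule integral_unique)
    also have "\<dots> \<le> 1" by simp
    finally show ?thesis .
  qed
  ultimately show ?thesis unfolding eq F0 by simp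
qed

text \<open>The constant is 5 = 1 + 4, from the squares of the two preceding bounds. The square root
  is the form in which a product of two factors decays like 1 / (1 + x^2).\<close>

lemma dsinc_bound: "\<bar>dsinc j x\<bar> \<le> sqrt (5 / (1 + x\<^sup>2))"
proof (rule real_le_rsqrt)
  have "\<bar>dsinc j x\<bar>\<^sup>2 \<le> 1\<^sup>2" by (intro power_mono dsinc_le_1) simp
  moreover have "\<bar>x * dsinc j x\<bar>\<^sup>2 \<le> 2\<^sup>2" by (intro power_mono dsinc_decay) simp
  ultimately have "(1 + x\<^sup>2) * (dsinc j x)\<^sup>2 \<le> 5" by (simp add: power_mult_distrib algebra_simps)
  moreover have "1 + x\<^sup>2 > 0" by (simp add: add_pos_nonneg)
  ultimately show "\<bar>dsinc j x\<bar>\<^sup>2 \<le> 5 / (1 + x\<^sup>2)" by (simp add: field_simps)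
qed

text \<open>A sequence stands for a function together with its successive derivatives. Shifting one
  sequence at a time gives the derivatives of the product without binomial coefficients.\<close>

fun leibniz :: "nat \<Rightarrow> (nat \<Rightarrow> real \<Rightarrow> real) \<Rightarrow> (nat \<Rightarrow> real \<Rightarrow> real) \<Rightarrow> real \<Rightarrow> real" where
  "leibniz 0 F G x = F 0 x * G 0 x"
| "leibniz (Suc j) F G x = leibniz j (\<lambda>i. F (Suc i)) G x + leibniz j F (\<lambda>i. G (Suc i)) x"

lemma leibniz_DERIV:
  assumes "\<And>i x. (F i has_real_derivative F (Suc i) x) (at x)"
    and "\<And>i x. (G i has_real_derivative G (Suc i) x) (at x)"
  shows "(leibniz j F G has_real_derivative leibniz (Suc j) F G x) (at x)"
  using assms
proof (induction j arbitrary: F G)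
  case 0
  have "((\<lambda>x. F 0 x * G 0 x) has_real_derivative F (Suc 0) x * G 0 x + F 0 x * G (Suc 0) x) (at x)"
    using 0 by (auto intro!: derivative_eq_intros)
  thus ?case by (simp add: leibniz.simps[abs_def])
next
  case (Suc j)
  have "((\<lambda>x. leibniz j (\<lambda>i. F (Suc i)) G x + leibniz j F (\<lambda>i. G (Suc i)) x) has_real_derivative
      leibniz (Suc j) (\<lambda>i. F (Suc i)) G x + leibniz (Suc j) F (\<lambda>i. G (Suc i)) x) (at x)"
    by (intro DERIV_add Suc.IH Suc.prems)
  thus ?case by (simp only: leibniz.simps(2)[abs_def])
qed

text \<open>Geometric rates add under multiplication, as in the binomial theorem. \<open>A\<close>
  and \<open>B\<close> vary in the induction because shifting a sequence produces a factor
  \<open>C\<close> or \<open>D\<close>.\<close>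

lemma leibniz_bound:
  assumes "\<And>i. \<bar>F i x\<bar> \<le> A * C ^ i" "\<And>i. \<bar>G i x\<bar> \<le> B * D ^ i" and "C \<ge> 0" "D \<ge> 0"
  shows "\<bar>leibniz j F G x\<bar> \<le> A * B * (C + D) ^ j"
  using assms(1,2)
proof (induction j arbitrary: F G A B)
  case 0
  have "\<bar>F 0 x\<bar> * \<bar>G 0 x\<bar> \<le> A * B"
    using "0.prems"(1)[of 0] "0.prems"(2)[of 0] by (intro mult_mono) auto
  thus ?case by (simp add: abs_mult)
next
  case (Suc j)
  have 1: "\<bar>leibniz j (\<lambda>i. F (Suc i)) G x\<bar> \<le> (A * C) * B * (C + D) ^ j"
    by (rule Suc.IH) (use Suc.prems(1)[of "Suc _"] Suc.prems(2) in \<open>simp_all add: mult.assoc\<close>)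
  have 2: "\<bar>leibniz j F (\<lambda>i. G (Suc i)) x\<bar> \<le> A * (B * D) * (C + D) ^ j"
    by (rule Suc.IH) (use Suc.prems(2)[of "Suc _"] Suc.prems(1) in \<open>simp_all add: mult.assoc\<close>)
  show ?case using 1 2 by (simp add: algebra_simps)
qed

text \<open>The derivatives of \<open>sinc\<^sup>4\<close>. This kernel is non-negative with a finite first moment, and it is
  band-limited, so its \<open>j\<close>-th derivative is only of size \<open>4\<^sup>j\<close>.\<close>

definition sinc4 :: "nat \<Rightarrow> real \<Rightarrow> real" where
  "sinc4 j = leibniz j (\<lambda>i. leibniz i dsinc dsinc) (\<lambda>i. leibniz i dsinc dsinc)"

lemma sinc4_DERIV: "(sinc4 j has_real_derivative sinc4 (Suc j) x) (at x)"
  unfolding sinc4_def by (intro leibniz_DERIV dsinc_DERIV)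

text \<open>Each factor has rate 1, so the square has rate 2 and the fourth power rate 4, while the
  decay of the four factors multiplies.\<close>

lemma sinc4_bound: "\<bar>sinc4 j x\<bar> \<le> 25 / (1 + x\<^sup>2)\<^sup>2 * 4 ^ j"
proof -
  have pos: "1 + x\<^sup>2 > 0" by (simp add: add_pos_nonneg)
  let ?w = "sqrt (5 / (1 + x\<^sup>2))"
  have "\<bar>leibniz i dsinc dsinc x\<bar> \<le> ?w * ?w * (1 + 1) ^ i" for i
    by (rule leibniz_bound) (use dsinc_bound in auto)
  hence "\<bar>leibniz i dsinc dsinc x\<bar> \<le> (5 / (1 + x\<^sup>2)) * 2 ^ i" for i
    using pos by simp
  hence "\<bar>sinc4 j x\<bar> \<le> (5 / (1 + x\<^sup>2)) * (5 / (1 + x\<^sup>2)) * (2 + 2) ^ j"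
    unfolding sinc4_def by (intro leibniz_bound) auto
  thus ?thesis by (simp add: power2_eq_square)
qed

lemma sinc4_0: "sinc4 0 x = (dsinc 0 x) ^ 4"
  by (simp add: sinc4_def power4_eq_xxxx mult.assoc)

lemma sinc4_continuous: "continuous_on UNIV (sinc4 j)"
  using sinc4_DERIV by (intro DERIV_continuous_on) (auto intro: has_field_derivative_at_within)

section \<open>Mass and first moment of the one-dimensional kernel\<close>

abbreviation nn_int :: "('a::euclidean_space \<Rightarrow> real) \<Rightarrow> ennreal" where
  "nn_int f \<equiv> \<integral>\<^sup>+x. ennreal (f x) \<partial>lborel"

lemma nn_integral_inverse_1_plus_square: "nn_int (\<lambda>x. 1 / (1 + x\<^sup>2)) = ennreal pi"
proof -
  have half: "(\<integral>\<^sup>+x. ennreal (1 / (1 + x\<^sup>2)) * indicator {0..} x \<partial>lborel) = ennreal (pi / 2)"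
  proof -
    have "(\<integral>\<^sup>+x. ennreal (1 / (1 + x\<^sup>2)) * indicator {0..} x \<partial>lborel) = ennreal (pi / 2 - arctan 0)"
    proof (rule nn_integral_FTC_atLeast)
      show "(\<lambda>x::real. 1 / (1 + x\<^sup>2)) \<in> borel_measurable borel" by measurable
      show "(arctan has_real_derivative 1 / (1 + x\<^sup>2)) (at x)" for x
        using DERIV_arctan[of x] by (simp add: inverse_eq_divide)
      show "(arctan \<longlongrightarrow> pi / 2) at_top" by (rule tendsto_arctan_at_top)
    qed (simp add: add_nonneg_nonneg)
    thus ?thesis by simp
  qed
  have "(\<integral>\<^sup>+x. ennreal (1 / (1 + x\<^sup>2)) * indicator {..<0} x \<partial>lborel)
      = ennreal \<bar>-1\<bar> * (\<integral>\<^sup>+x. ennreal (1 / (1 + (0 + (-1) * x)\<^sup>2)) * indicator {..<0} (0 + (-1) * x) \<partial>lborel)"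
    by (rule nn_integral_real_affine) auto
  also have "\<dots> = (\<integral>\<^sup>+x. ennreal (1 / (1 + x\<^sup>2)) * indicator {0<..} x \<partial>lborel)"
    by (auto intro!: nn_integral_cong simp: indicator_def)
  also have "\<dots> = (\<integral>\<^sup>+x. ennreal (1 / (1 + x\<^sup>2)) * indicator {0..} x \<partial>lborel)"
  proof (rule nn_integral_cong_AE)
    show "AE x in lborel. ennreal (1 / (1 + x\<^sup>2)) * indicator {0<..} x = ennreal (1 / (1 + x\<^sup>2)) * indicator {0::real..} x"
      using AE_lborel_singleton[of "0::real"] by eventually_elim (auto simp: indicator_def)
  qed
  finally have half': "(\<integral>\<^sup>+x. ennreal (1 / (1 + x\<^sup>2)) * indicator {..<0} x \<partial>lborel) = ennreal (pi / 2)"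
    using half by simp
  have "nn_int (\<lambda>x. 1 / (1 + x\<^sup>2)) =
      (\<integral>\<^sup>+x. ennreal (1 / (1 + x\<^sup>2)) * indicator {0..} x + ennreal (1 / (1 + x\<^sup>2)) * indicator {..<0} x \<partial>lborel)"
    by (intro nn_integral_cong) (auto simp: indicator_def)
  also have "\<dots> = ennreal (pi / 2) + ennreal (pi / 2)"
    by (subst nn_integral_add) (auto simp: half half')
  also have "\<dots> = ennreal pi" by (simp flip: ennreal_plus)
  finally show ?thesis .
qed

definition jackson_mass :: real where
  "jackson_mass = enn2real (nn_int (\<lambda>x. sinc4 0 x))"

lemma sinc4_0_nonneg: "0 \<le> sinc4 0 x"
  by (simp add: sinc4_0)

lemma sinc4_measurable [measurable]: "sinc4 j \<in> borel_measurable borel"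
  by (intro borel_measurable_continuous_onI sinc4_continuous)

lemma sinc4_bound_weak: "\<bar>sinc4 j x\<bar> \<le> 25 * 4 ^ j * (1 / (1 + x\<^sup>2))"
proof -
  define w where "w = 1 + x\<^sup>2"
  have w: "w \<ge> 1" by (simp add: w_def)
  hence "w \<le> w\<^sup>2" by (simp add: power2_eq_square)
  hence "25 / w\<^sup>2 * 4 ^ j \<le> 25 / w * 4 ^ j"
    using w by (intro mult_right_mono divide_left_mono) auto
  hence "25 / (1 + x\<^sup>2)\<^sup>2 * 4 ^ j \<le> 25 / (1 + x\<^sup>2) * 4 ^ j" by (simp add: w_def)
  thus ?thesis using sinc4_bound[of j x] by simp
qed

lemma nn_integral_le_inverse_1_plus_square:
  assumes c: "0 \<le> c" and le: "\<And>x. h x \<le> c * (1 / (1 + x\<^sup>2))"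
  shows "nn_int (\<lambda>x. h x) \<le> ennreal (c * pi)"
proof -
  have "nn_int (\<lambda>x. h x) \<le> (\<integral>\<^sup>+x. ennreal c * ennreal (1 / (1 + x\<^sup>2)) \<partial>lborel)"
  proof (rule nn_integral_mono)
    fix x :: real
    have "ennreal (h x) \<le> ennreal (c * (1 / (1 + x\<^sup>2)))" by (rule ennreal_leI[OF le])
    thus "ennreal (h x) \<le> ennreal c * ennreal (1 / (1 + x\<^sup>2))" by (simp only: ennreal_mult'[OF c])
  qed
  also have "\<dots> = ennreal c * ennreal pi"
    by (subst nn_integral_cmult) (auto simp: nn_integral_inverse_1_plus_square)
  finally show ?thesis by (simp only: ennreal_mult'[OF c])
qed

lemma sinc4_integral: "nn_int (\<lambda>x. \<bar>sinc4 j x\<bar>) \<le> ennreal (25 * 4 ^ j * pi)"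
  by (rule nn_integral_le_inverse_1_plus_square[OF _ sinc4_bound_weak]) simp

text \<open>Decay of order four leaves room for the factor \<open>\<bar>x\<bar>\<close>. This is why
  the fourth power is taken: the square of sinc has infinite first moment.\<close>

lemma sinc4_moment: "nn_int (\<lambda>x. \<bar>x\<bar> * sinc4 0 x) \<le> ennreal (25 * pi)"
proof (rule nn_integral_le_inverse_1_plus_square)
  fix x :: real
  have pos: "1 + x\<^sup>2 > 0" by (simp add: add_pos_nonneg)
  have "\<bar>x\<bar> \<le> 1 + x\<^sup>2" using sum_squares_ge_zero[of "\<bar>x\<bar> - 1/2" 0] by (simp add: power2_eq_square algebra_simps)
  hence "\<bar>x\<bar> * sinc4 0 x \<le> (1 + x\<^sup>2) * (25 / (1 + x\<^sup>2)\<^sup>2)"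
    using sinc4_bound[of 0 x] sinc4_0_nonneg[of x] by (intro mult_mono) auto
  also have "\<dots> = 25 * (1 / (1 + x\<^sup>2))"
  proof -
    have "w * (25 / w\<^sup>2) = 25 * (1 / w)" if "w > 0" for w :: real using that by (simp add: power2_eq_square)
    thus ?thesis using pos by blast
  qed
  finally show "\<bar>x\<bar> * sinc4 0 x \<le> 25 * (1 / (1 + x\<^sup>2))" .
qed simp

text \<open>The kernel is continuous with value 1 at the origin. Its zero set is closed, so it would
  be the whole line if it had full measure.\<close>

lemma jackson_mass: "jackson_mass > 0" "nn_int (\<lambda>x. sinc4 0 x) = ennreal jackson_mass"
proof -
  have fin: "nn_int (\<lambda>x. sinc4 0 x) < \<infinity>"
    using sinc4_integral[of 0] by (simp add: sinc4_0_nonneg order_le_less_trans)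
  have "nn_int (\<lambda>x. sinc4 0 x) \<noteq> 0"
  proof
    assume "nn_int (\<lambda>x. sinc4 0 x) = 0"
    hence "AE x in lborel. ennreal (sinc4 0 x) = 0" by (subst (asm) nn_integral_0_iff_AE) auto
    hence "AE x in lborel. sinc4 0 x = 0"
      by eventually_elim (use sinc4_0_nonneg in \<open>simp add: ennreal_eq_0_iff antisym\<close>)
    hence "AE x in lebesgue. x \<in> {x. sinc4 0 x = 0}" by (simp add: AE_completion)
    moreover have "closed {x. sinc4 0 x = 0}"
      by (rule closed_Collect_eq[OF sinc4_continuous continuous_on_const])
    ultimately have "0 \<in> {x. sinc4 0 x = 0}" by (metis mem_closed_if_AE_lebesgue)
    moreover have "sinc4 0 0 = 1" by (simp add: sinc4_0 dsinc_def)
    ultimately show False by simp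
  qed
  thus "jackson_mass > 0" unfolding jackson_mass_def using fin by (simp add: enn2real_positive_iff zero_less_iff_neq_zero)
  show "nn_int (\<lambda>x. sinc4 0 x) = ennreal jackson_mass"
    unfolding jackson_mass_def using fin by simp
qed

text \<open>The number 25 pi bounds the first moment and, up to the factor 4^j, the L1 norms of the
  derivatives, so one normalised constant serves for both.\<close>

definition jconst :: real where
  "jconst = 25 * pi / jackson_mass"

lemma jconst_pos: "jconst > 0"
  using jackson_mass(1) by (simp add: jconst_def)

text \<open>Dilation with preserved mass contributes one factor \<open>R\<close> and each derivative
  another, hence the exponent \<open>Suc j\<close>.\<close>

definition jackson :: "real \<Rightarrow> nat \<Rightarrow> real \<Rightarrow> real" where
  "jackson R j x = R ^ Suc j * sinc4 j (R * x) / jackson_mass"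

lemma jackson_DERIV: "(jackson R j has_real_derivative jackson R (Suc j) x) (at x)"
proof -
  have "((\<lambda>x. sinc4 j (R * x)) has_real_derivative sinc4 (Suc j) (R * x) * R) (at x)"
    by (rule DERIV_chain2[where f = "sinc4 j" and g = "\<lambda>x. R * x", OF sinc4_DERIV])
      (auto intro!: derivative_eq_intros)
  hence "((\<lambda>x. R ^ Suc j * sinc4 j (R * x) / jackson_mass) has_real_derivative
      R ^ Suc j * (sinc4 (Suc j) (R * x) * R) / jackson_mass) (at x)"
    by (intro DERIV_cdivide DERIV_cmult)
  thus ?thesis by (simp add: jackson_def[abs_def] mult_ac)
qed

lemma jackson_continuous: "continuous_on UNIV (jackson R j)"
  using jackson_DERIV by (intro DERIV_continuous_on) (auto intro: has_field_derivative_at_within)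

lemma jackson_measurable [measurable]: "jackson R j \<in> borel_measurable borel"
  by (intro borel_measurable_continuous_onI jackson_continuous)

lemma jackson_bound:
  assumes R: "R > 0"
  shows "\<bar>jackson R j x\<bar> \<le> jconst * R * (4 * R) ^ j"
proof -
  have "1 / (1 + (R * x)\<^sup>2) \<le> 1" by (simp add: add_pos_nonneg)
  hence "25 * 4 ^ j * (1 / (1 + (R * x)\<^sup>2)) \<le> 25 * 4 ^ j * 1" by (intro mult_left_mono) auto
  \<comment> \<open>The factor \<open>pi\<close> brings the bound into the form of
    \<open>jconst\<close>.\<close>
  also have "\<dots> \<le> 25 * 4 ^ j * pi" using pi_ge_two by (intro mult_left_mono) auto
  finally have b: "\<bar>sinc4 j (R * x)\<bar> \<le> 25 * 4 ^ j * pi"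
    using sinc4_bound_weak[of j "R * x"] by simp
  have "\<bar>jackson R j x\<bar> = R ^ Suc j * \<bar>sinc4 j (R * x)\<bar> / jackson_mass"
    using R jackson_mass(1) by (simp add: jackson_def abs_mult)
  also have "\<dots> \<le> R ^ Suc j * (25 * 4 ^ j * pi) / jackson_mass"
    using R jackson_mass(1) b by (intro divide_right_mono mult_left_mono) auto
  also have "\<dots> = jconst * R * (4 * R) ^ j"
    by (simp add: jconst_def power_mult_distrib)
  finally show ?thesis .
qed

lemma nn_integral_scale:
  assumes R: "R > 0" and c: "0 \<le> c" and [measurable]: "h \<in> borel_measurable borel"
  shows "nn_int (\<lambda>x. c * h (R * x)) = ennreal (c / R) * nn_int (\<lambda>x. h x)"
proof -
  have "nn_int (\<lambda>x. c * h (R * x))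
      = ennreal \<bar>1 / R\<bar> * nn_int (\<lambda>x. c * h (R * (0 + 1 / R * x)))"
    by (rule nn_integral_real_affine) (use R in auto)
  also have "\<dots> = ennreal (1 / R) * (ennreal c * nn_int (\<lambda>x. h x))"
    using R c by (simp add: ennreal_mult' nn_integral_cmult)
  also have "\<dots> = ennreal (1 / R * c) * nn_int (\<lambda>x. h x)"
    using R by (simp only: ennreal_mult' mult.assoc zero_le_divide_1_iff less_imp_le)
  finally show ?thesis by simp
qed

lemma jackson_nn_integral:
  assumes R: "R > 0"
  shows "nn_int (\<lambda>x. \<bar>jackson R j x\<bar>) \<le> ennreal (jconst * (4 * R) ^ j)"
proof -
  let ?c = "R ^ Suc j / jackson_mass"
  have c: "?c \<ge> 0" "?c / R \<ge> 0" using R jackson_mass(1) by simp_all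
  have "nn_int (\<lambda>x. \<bar>jackson R j x\<bar>) = nn_int (\<lambda>x. ?c * \<bar>sinc4 j (R * x)\<bar>)"
    using R jackson_mass(1) by (intro nn_integral_cong) (simp add: jackson_def abs_mult)
  also have "\<dots> = ennreal (?c / R) * nn_int (\<lambda>x. \<bar>sinc4 j x\<bar>)"
    by (rule nn_integral_scale[OF R c(1)]) measurable
  also have "\<dots> \<le> ennreal (?c / R) * ennreal (25 * 4 ^ j * pi)"
    by (intro mult_left_mono sinc4_integral) simp
  also have "\<dots> = ennreal (?c / R * (25 * 4 ^ j * pi))"
    by (rule ennreal_mult'[OF c(2), symmetric])
  also have "?c / R * (25 * 4 ^ j * pi) = jconst * (4 * R) ^ j"
    using R by (simp add: jconst_def power_mult_distrib)
  finally show ?thesis .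
qed

lemma jackson_0_nonneg: "R > 0 \<Longrightarrow> 0 \<le> jackson R 0 x"
  using sinc4_0_nonneg jackson_mass(1) by (simp add: jackson_def)

lemma jackson_nn_integral_0:
  assumes R: "R > 0"
  shows "nn_int (\<lambda>x. jackson R 0 x) = 1"
proof -
  have c: "0 \<le> R / jackson_mass" using R jackson_mass(1) by simp
  have "nn_int (\<lambda>x. jackson R 0 x) = ennreal (R / jackson_mass / R) * ennreal jackson_mass"
    using nn_integral_scale[OF R c sinc4_measurable, of 0] by (simp add: jackson_def jackson_mass(2))
  also have "\<dots> = ennreal (R / jackson_mass / R * jackson_mass)"
    using R jackson_mass(1) by (intro ennreal_mult'[symmetric]) simp
  finally show ?thesis using R jackson_mass(1) by simp
qed

lemma jackson_moment:
  assumes R: "R > 0"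
  shows "nn_int (\<lambda>x. \<bar>x\<bar> * jackson R 0 x) \<le> ennreal (jconst / R)"
proof -
  let ?c = "1 / jackson_mass"
  have c: "?c \<ge> 0" "?c / R \<ge> 0" using R jackson_mass(1) by simp_all
  have "nn_int (\<lambda>x. \<bar>x\<bar> * jackson R 0 x) = nn_int (\<lambda>x. ?c * (\<bar>R * x\<bar> * sinc4 0 (R * x)))"
    using R by (intro nn_integral_cong) (simp add: jackson_def abs_mult mult_ac)
  also have "\<dots> = ennreal (?c / R) * nn_int (\<lambda>x. \<bar>x\<bar> * sinc4 0 x)"
    by (rule nn_integral_scale[OF R c(1), of "\<lambda>x. \<bar>x\<bar> * sinc4 0 x"]) measurable
  also have "\<dots> \<le> ennreal (?c / R) * ennreal (25 * pi)"
    by (intro mult_left_mono sinc4_moment) simp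
  also have "\<dots> = ennreal (?c / R * (25 * pi))"
    by (rule ennreal_mult'[OF c(2), symmetric])
  also have "?c / R * (25 * pi) = jconst / R" by (simp add: jconst_def)
  finally show ?thesis .
qed

section \<open>The kernel on R^d as a product of one-dimensional kernels\<close>

lemma nn_integral_vec_prod:
  fixes f :: "'d::finite \<Rightarrow> real \<Rightarrow> ennreal"
  assumes [measurable]: "\<And>i. f i \<in> borel_measurable borel"
  shows "(\<integral>\<^sup>+x. (\<Prod>i\<in>UNIV. f i (x $ i)) \<partial>lborel) = (\<Prod>i\<in>UNIV. \<integral>\<^sup>+t. f i t \<partial>lborel)"
proof -
  define ax where "ax i = (axis i 1 :: real^'d)" for i
  have inj: "inj ax" by (auto simp: ax_def inj_on_def axis_eq_axis)
  have Basis: "(Basis :: (real^'d) set) = range ax" by (auto simp: Basis_vec_def ax_def)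
  have inner_ax: "x \<bullet> ax i = x $ i" for x i by (simp add: ax_def inner_axis)
  define g where "g b = f (inv ax b)" for b
  have [measurable]: "g b \<in> borel_measurable borel" for b by (simp add: g_def)
  have "(\<integral>\<^sup>+x. (\<Prod>b\<in>Basis. g b (x \<bullet> b)) \<partial>(lborel :: (real^'d) measure)) = (\<Prod>b\<in>(Basis :: (real^'d) set). \<integral>\<^sup>+t. g b t \<partial>lborel)"
    by (rule nn_integral_lborel_prod) auto
  also have "(\<Prod>b\<in>(Basis :: (real^'d) set). \<integral>\<^sup>+t. g b t \<partial>lborel) = (\<Prod>i\<in>UNIV. \<integral>\<^sup>+t. f i t \<partial>lborel)"
    unfolding Basis using inj by (subst prod.reindex) (auto simp: g_def)
  also have "(\<lambda>x. \<Prod>b\<in>(Basis :: (real^'d) set). g b (x \<bullet> b)) = (\<lambda>x. \<Prod>i\<in>UNIV. f i (x $ i))"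
    unfolding Basis using inj by (subst prod.reindex) (simp_all add: g_def inner_ax)
  finally show ?thesis .
qed

definition inc :: "'d \<Rightarrow> ('d \<Rightarrow> nat) \<Rightarrow> 'd \<Rightarrow> nat" where
  "inc i \<alpha> = \<alpha>(i := Suc (\<alpha> i))"

lemma multi_abs_inc: "multi_abs (inc i \<alpha>) = Suc (multi_abs (\<alpha> :: 'd::finite \<Rightarrow> nat))"
proof -
  have "multi_abs (inc i \<alpha>) = (\<Sum>j\<in>UNIV. \<alpha> j + (if j = i then 1 else 0))"
    unfolding multi_abs_def by (intro sum.cong) (auto simp: inc_def)
  also have "\<dots> = Suc (multi_abs \<alpha>)" by (subst sum.distrib) (simp add: multi_abs_def)
  finally show ?thesis .
qed

text \<open>\<open>jker R \<alpha>\<close> is the derivative of order \<open>\<alpha>\<close> of the kernel \<open>jker R 0\<close>.\<close>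

definition jker :: "real \<Rightarrow> ('d \<Rightarrow> nat) \<Rightarrow> real^'d::finite \<Rightarrow> real" where
  "jker R \<alpha> x = (\<Prod>i\<in>UNIV. jackson R (\<alpha> i) (x $ i))"

lemma jker_has_derivative:
  fixes x :: "real^'d::finite"
  shows "(jker R \<alpha> has_derivative (\<lambda>h. \<Sum>i\<in>UNIV. h $ i * jker R (inc i \<alpha>) x)) (at x)"
proof -
  have "((\<lambda>x. \<Prod>i\<in>UNIV. jackson R (\<alpha> i) (x $ i)) has_derivative
     (\<lambda>h. \<Sum>i\<in>UNIV. (h $ i * jackson R (Suc (\<alpha> i)) (x $ i)) * (\<Prod>j\<in>UNIV - {i}. jackson R (\<alpha> j) (x $ j)))) (at x)"
  proof (rule has_derivative_prod)
    fix i :: 'd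
    have "(jackson R (\<alpha> i) has_derivative (\<lambda>t. t * jackson R (Suc (\<alpha> i)) (x $ i))) (at (x $ i))"
      using jackson_DERIV[of R "\<alpha> i" "x $ i"] by (simp add: has_field_derivative_def mult_commute_abs)
    from has_derivative_compose[OF bounded_linear_imp_has_derivative[OF bounded_linear_vec_nth] this]
    show "((\<lambda>x. jackson R (\<alpha> i) (x $ i)) has_derivative (\<lambda>h. h $ i * jackson R (Suc (\<alpha> i)) (x $ i))) (at x)"
      by simp
  qed
  also have "(\<lambda>h. \<Sum>i\<in>UNIV. (h $ i * jackson R (Suc (\<alpha> i)) (x $ i)) * (\<Prod>j\<in>UNIV - {i}. jackson R (\<alpha> j) (x $ j)))
     = (\<lambda>h. \<Sum>i\<in>UNIV. h $ i * jker R (inc i \<alpha>) x)"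
  proof (intro ext sum.cong refl)
    fix h :: "real^'d" and i :: 'd
    have "jker R (inc i \<alpha>) x = jackson R (Suc (\<alpha> i)) (x $ i) * (\<Prod>j\<in>UNIV - {i}. jackson R (inc i \<alpha> j) (x $ j))"
      unfolding jker_def by (subst prod.remove[of UNIV i]) (auto simp: inc_def)
    also have "(\<Prod>j\<in>UNIV - {i}. jackson R (inc i \<alpha> j) (x $ j)) = (\<Prod>j\<in>UNIV - {i}. jackson R (\<alpha> j) (x $ j))"
      by (intro prod.cong) (auto simp: inc_def)
    finally show "h $ i * jackson R (Suc (\<alpha> i)) (x $ i) * (\<Prod>j\<in>UNIV - {i}. jackson R (\<alpha> j) (x $ j))
        = h $ i * jker R (inc i \<alpha>) x" by simp
  qed
  finally show ?thesis by (simp add: jker_def[abs_def])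
qed

lemma jker_continuous: "continuous_on UNIV (jker R \<alpha> :: real^'d::finite \<Rightarrow> real)"
  by (simp add: continuous_on_eq_continuous_at has_derivative_continuous[OF jker_has_derivative])

lemma jker_measurable [measurable]: "jker R \<alpha> \<in> borel_measurable borel"
  by (intro borel_measurable_continuous_onI jker_continuous)

abbreviation jker_sup :: "real \<Rightarrow> ('d::finite \<Rightarrow> nat) \<Rightarrow> real" where
  "jker_sup R \<alpha> \<equiv> (jconst * R) ^ CARD('d) * (4 * R) ^ multi_abs \<alpha>"

lemma jker_bound:
  fixes x :: "real^'d::finite"
  assumes R: "R > 0"
  shows "\<bar>jker R \<alpha> x\<bar> \<le> jker_sup R \<alpha>"
proof -
  have "\<bar>jker R \<alpha> x\<bar> = (\<Prod>i\<in>UNIV. \<bar>jackson R (\<alpha> i) (x $ i)\<bar>)" by (simp add: jker_def abs_prod)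
  also have "\<dots> \<le> (\<Prod>i\<in>UNIV. (jconst * R) * (4 * R) ^ \<alpha> i)"
    by (intro prod_mono conjI abs_ge_zero jackson_bound R)
  also have "\<dots> = jker_sup R \<alpha>"
    by (simp add: prod.distrib multi_abs_def power_sum)
  finally show ?thesis .
qed

lemma prod_le_ennreal:
  fixes f g :: "'b \<Rightarrow> ennreal"
  assumes "\<And>i. i \<in> A \<Longrightarrow> f i \<le> g i"
  shows "prod f A \<le> prod g A"
  using assms by (induction A rule: infinite_finite_induct) (auto intro: mult_mono)

lemma jker_nn_integral:
  assumes R: "R > 0"
  shows "nn_int (\<lambda>x. \<bar>jker R \<alpha> (x :: real^'d::finite)\<bar>) \<le> ennreal (jconst ^ CARD('d) * (4 * R) ^ multi_abs \<alpha>)"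
proof -
  have "nn_int (\<lambda>x. \<bar>jker R \<alpha> (x :: real^'d)\<bar>) = (\<integral>\<^sup>+x. (\<Prod>i\<in>UNIV. ennreal \<bar>jackson R (\<alpha> i) (x $ i)\<bar>) \<partial>(lborel :: (real^'d) measure))"
    by (intro nn_integral_cong) (simp add: jker_def abs_prod prod_ennreal)
  also have "\<dots> = (\<Prod>i\<in>UNIV. \<integral>\<^sup>+t. ennreal \<bar>jackson R (\<alpha> i) t\<bar> \<partial>lborel)"
    by (rule nn_integral_vec_prod) measurable
  also have "\<dots> \<le> (\<Prod>i\<in>UNIV. ennreal (jconst * (4 * R) ^ \<alpha> i))"
    by (intro prod_le_ennreal jackson_nn_integral R)
  also have "\<dots> = ennreal (jconst ^ CARD('d) * (4 * R) ^ multi_abs \<alpha>)"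
    using R jconst_pos by (subst prod_ennreal) (auto simp: prod.distrib multi_abs_def power_sum)
  finally show ?thesis .
qed

lemma jker_0_nonneg: "R > 0 \<Longrightarrow> 0 \<le> jker R (\<lambda>_. 0) x"
  unfolding jker_def by (intro prod_nonneg) (simp add: jackson_0_nonneg)

lemma jker_nn_integral_0:
  assumes R: "R > 0"
  shows "nn_int (\<lambda>x. jker R (\<lambda>_. 0) (x :: real^'d::finite)) = 1"
proof -
  have "nn_int (\<lambda>x. jker R (\<lambda>_. 0) (x :: real^'d)) = (\<integral>\<^sup>+x. (\<Prod>i\<in>UNIV. ennreal (jackson R 0 (x $ i))) \<partial>(lborel :: (real^'d) measure))"
    by (intro nn_integral_cong) (simp add: jker_def prod_ennreal jackson_0_nonneg R)
  also have "\<dots> = (\<Prod>i\<in>(UNIV::'d set). \<integral>\<^sup>+t. ennreal (jackson R 0 t) \<partial>lborel)"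
    by (rule nn_integral_vec_prod) measurable
  finally show ?thesis by (simp add: jackson_nn_integral_0[OF R])
qed

text \<open>The integral factorises: coordinate \<open>i\<close> contributes its first moment and
  every other coordinate its mass 1.\<close>

lemma jker_moment:
  assumes R: "R > 0"
  shows "nn_int (\<lambda>x. \<bar>x $ i\<bar> * jker R (\<lambda>_. 0) (x :: real^'d::finite)) \<le> ennreal (jconst / R)"
proof -
  define f where "f j t = ennreal (if j = i then \<bar>t\<bar> * jackson R 0 t else jackson R 0 t)" for j :: 'd and t
  have [measurable]: "f j \<in> borel_measurable borel" for j by (cases "j = i") (auto simp: f_def[abs_def])
  have "nn_int (\<lambda>x. \<bar>x $ i\<bar> * jker R (\<lambda>_. 0) (x :: real^'d)) = (\<integral>\<^sup>+x. (\<Prod>j\<in>UNIV. f j (x $ j)) \<partial>(lborel :: (real^'d) measure))"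
  proof (intro nn_integral_cong)
    fix x :: "real^'d"
    have "(\<Prod>j\<in>UNIV. f j (x $ j)) = f i (x $ i) * (\<Prod>j\<in>UNIV - {i}. f j (x $ j))"
      by (subst prod.remove[of UNIV i]) auto
    also have "(\<Prod>j\<in>UNIV - {i}. f j (x $ j)) = (\<Prod>j\<in>UNIV - {i}. ennreal (jackson R 0 (x $ j)))"
      by (intro prod.cong) (auto simp: f_def)
    also have "\<dots> = ennreal (\<Prod>j\<in>UNIV - {i}. jackson R 0 (x $ j))"
      by (intro prod_ennreal) (simp add: jackson_0_nonneg R)
    also have "f i (x $ i) * \<dots> = ennreal ((\<bar>x $ i\<bar> * jackson R 0 (x $ i)) * (\<Prod>j\<in>UNIV - {i}. jackson R 0 (x $ j)))"
      unfolding f_def if_P[OF refl] by (intro ennreal_mult'[symmetric]) (simp add: jackson_0_nonneg R)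
    also have "(\<bar>x $ i\<bar> * jackson R 0 (x $ i)) * (\<Prod>j\<in>UNIV - {i}. jackson R 0 (x $ j)) = \<bar>x $ i\<bar> * jker R (\<lambda>_. 0) x"
      unfolding jker_def prod.remove[OF finite UNIV_I, of "\<lambda>j. jackson R 0 (x $ j)" i] by simp
    finally show "ennreal (\<bar>x $ i\<bar> * jker R (\<lambda>_. 0) x) = (\<Prod>j\<in>UNIV. f j (x $ j))" by simp
  qed
  also have "\<dots> = (\<Prod>j\<in>UNIV. \<integral>\<^sup>+t. f j t \<partial>lborel)"
    by (rule nn_integral_vec_prod) measurable
  also have "\<dots> = (\<integral>\<^sup>+t. f i t \<partial>lborel) * (\<Prod>j\<in>UNIV - {i}. \<integral>\<^sup>+t. f j t \<partial>lborel)"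
    by (subst prod.remove[of UNIV i]) auto
  also have "(\<Prod>j\<in>UNIV - {i}. \<integral>\<^sup>+t. f j t \<partial>lborel) = 1"
    by (rule prod.neutral) (simp add: f_def jackson_nn_integral_0[OF R])
  also have "(\<integral>\<^sup>+t. f i t \<partial>lborel) * 1 \<le> ennreal (jconst / R)"
    by (simp add: f_def jackson_moment[OF R])
  finally show ?thesis .
qed

section \<open>Convolution\<close>

lemma lborel_distr_reflect: "distr lborel borel (\<lambda>y. x - y) = (lborel :: 'a::euclidean_space measure)"
  by (subst lborel_affine[of "-1" x]) (auto simp: density_1)

lemma nn_integral_reflect:
  fixes f :: "'a::euclidean_space \<Rightarrow> ennreal"
  assumes [measurable]: "f \<in> borel_measurable borel"
  shows "(\<integral>\<^sup>+y. f (x - y) \<partial>lborel) = (\<integral>\<^sup>+y. f y \<partial>lborel)"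
  by (subst (2) lborel_distr_reflect[of x, symmetric]) (simp add: nn_integral_distr)

lemma nn_integral_translate:
  fixes f :: "'a::euclidean_space \<Rightarrow> ennreal"
  assumes [measurable]: "f \<in> borel_measurable borel"
  shows "(\<integral>\<^sup>+y. f (y + x) \<partial>lborel) = (\<integral>\<^sup>+y. f y \<partial>lborel)"
  by (subst (2) lborel_distr_plus[of x, symmetric]) (simp add: nn_integral_distr add.commute)

lemma nn_integral_translate_minus:
  fixes f :: "'a::euclidean_space \<Rightarrow> ennreal"
  assumes "f \<in> borel_measurable borel"
  shows "(\<integral>\<^sup>+y. f (y - x) \<partial>lborel) = (\<integral>\<^sup>+y. f y \<partial>lborel)"
  using nn_integral_translate[OF assms, of "- x"] by simp

lemma integral_translate_lborel:
  fixes f :: "'a::euclidean_space \<Rightarrow> 'b::{banach, second_countable_topology}"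
  assumes [measurable]: "f \<in> borel_measurable borel"
  shows "(LINT y|lborel. f (y + x)) = (LINT y|lborel. f y)"
  by (subst (2) lborel_distr_plus[of x, symmetric]) (simp add: integral_distr add.commute)

lemma integrable_translate_lborel:
  fixes f :: "'a::euclidean_space \<Rightarrow> 'b::{banach, second_countable_topology}"
  assumes f: "integrable lborel f"
  shows "integrable lborel (\<lambda>y. f (y + x))"
proof -
  have "integrable (distr lborel borel ((+) x)) f" using f by (simp add: lborel_distr_plus)
  hence "integrable lborel (\<lambda>y. f (x + y))"
    using f by (subst (asm) integrable_distr_eq) auto
  thus ?thesis by (simp add: add.commute)
qed

definition L1 :: "('a::euclidean_space \<Rightarrow> complex) \<Rightarrow> real" where
  "L1 f = (LINT x|lborel. norm (f x))"

lemma nn_integral_L1: "integrable lborel f \<Longrightarrow> nn_int (\<lambda>x. norm (f x)) = ennreal (L1 f)"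
  unfolding L1_def by (rule nn_integral_eq_integral) auto

lemma L1_nonneg: "0 \<le> L1 f"
  by (simp add: L1_def)

lemma L1_leI:
  assumes "integrable lborel f" "nn_int (\<lambda>x. norm (f x)) \<le> ennreal B" "0 \<le> B"
  shows "L1 f \<le> B"
  using assms by (simp add: nn_integral_L1 L1_nonneg)

lemma L1_add_le:
  assumes "integrable lborel f" "integrable lborel g"
  shows "L1 (\<lambda>x. f x + g x) \<le> L1 f + L1 g"
proof -
  have "L1 (\<lambda>x. f x + g x) \<le> (LINT x|lborel. norm (f x) + norm (g x))"
    unfolding L1_def using assms by (intro integral_mono) (auto intro: norm_triangle_ineq)
  thus ?thesis using assms by (simp add: L1_def)
qed

lemma L1_scale: "L1 (\<lambda>x. c * f x) = norm c * L1 f"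
  by (simp add: L1_def norm_mult)

lemma L1_diff_le:
  assumes "integrable lborel f" "integrable lborel g"
  shows "L1 (\<lambda>x. f x - g x) \<le> L1 f + L1 g"
  using L1_add_le[OF assms(1), of "\<lambda>x. (-1) * g x"] L1_scale[of "-1" g] assms(2) by simp

definition conv :: "('a::euclidean_space \<Rightarrow> real) \<Rightarrow> ('a \<Rightarrow> complex) \<Rightarrow> 'a \<Rightarrow> complex" where
  "conv k f x = (LINT y|lborel. k (x - y) *\<^sub>R f y)"

text \<open>A bounded kernel makes the convolution integral converge at every point, as pointwise
  differentiation requires. Integrability of the kernel enters separately, through the bound
  \<open>B\<close> of the later lemmas.\<close>

locale conv_pair =
  fixes k :: "'a::euclidean_space \<Rightarrow> real" and f :: "'a \<Rightarrow> complex" and M :: real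
  assumes k_measurable [measurable]: "k \<in> borel_measurable borel"
    and k_bounded: "\<And>x. \<bar>k x\<bar> \<le> M"
    and f_integrable: "integrable lborel f"
begin

lemma f_measurable [measurable]: "f \<in> borel_measurable borel"
  using f_integrable by (simp add: borel_measurable_integrable)

lemma integrand: "integrable lborel (\<lambda>y. k (x - y) *\<^sub>R f y)"
proof (rule Bochner_Integration.integrable_bound)
  show "integrable lborel (\<lambda>y. M * norm (f y))" using f_integrable by auto
  show "AE y in lborel. norm (k (x - y) *\<^sub>R f y) \<le> norm (M * norm (f y))"
  proof (rule AE_I2)
    fix y
    have "\<bar>k (x - y)\<bar> * norm (f y) \<le> \<bar>M\<bar> * norm (f y)"
      using k_bounded[of "x - y"] by (intro mult_right_mono) auto
    thus "norm (k (x - y) *\<^sub>R f y) \<le> norm (M * norm (f y))" by (simp add: abs_mult)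
  qed
qed measurable

lemma conv_measurable [measurable]: "conv k f \<in> borel_measurable borel"
  unfolding conv_def[abs_def] by measurable

text \<open>Young's inequality for convolutions in L1, by Tonelli and translation
  invariance.\<close>

lemma nn_integral_conv:
  "nn_int (\<lambda>x. norm (conv k f x)) \<le> nn_int (\<lambda>x. \<bar>k x\<bar>) * ennreal (L1 f)"
proof -
  have "nn_int (\<lambda>x. norm (conv k f x)) \<le> (\<integral>\<^sup>+x. \<integral>\<^sup>+y. ennreal \<bar>k (x - y)\<bar> * ennreal (norm (f y)) \<partial>lborel \<partial>lborel)"
  proof (rule nn_integral_mono)
    fix x
    have "ennreal (norm (conv k f x)) \<le> nn_int (\<lambda>y. norm (k (x - y) *\<^sub>R f y))"
      unfolding conv_def by (rule integral_norm_bound_ennreal[OF integrand])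
    thus "ennreal (norm (conv k f x)) \<le> (\<integral>\<^sup>+y. ennreal \<bar>k (x - y)\<bar> * ennreal (norm (f y)) \<partial>lborel)"
      by (simp add: ennreal_mult')
  qed
  also have "\<dots> = (\<integral>\<^sup>+y. \<integral>\<^sup>+x. ennreal \<bar>k (x - y)\<bar> * ennreal (norm (f y)) \<partial>lborel \<partial>lborel)"
    by (rule lborel_pair.Fubini'[symmetric]) measurable
  also have "\<dots> = (\<integral>\<^sup>+y. nn_int (\<lambda>x. \<bar>k x\<bar>) * ennreal (norm (f y)) \<partial>lborel)"
    by (intro nn_integral_cong, subst nn_integral_multc) (auto simp: nn_integral_translate_minus[of "\<lambda>x. ennreal \<bar>k x\<bar>"])
  also have "\<dots> = nn_int (\<lambda>x. \<bar>k x\<bar>) * ennreal (L1 f)"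
    by (subst nn_integral_cmult) (auto simp: nn_integral_L1 f_integrable)
  finally show ?thesis .
qed

lemma nn_integral_conv_le:
  assumes "nn_int (\<lambda>x. \<bar>k x\<bar>) \<le> ennreal B"
  shows "nn_int (\<lambda>x. norm (conv k f x)) \<le> ennreal B * ennreal (L1 f)"
  by (rule order_trans[OF nn_integral_conv mult_right_mono[OF assms zero_le]])

lemma integrable_conv:
  assumes "nn_int (\<lambda>x. \<bar>k x\<bar>) \<le> ennreal B"
  shows "integrable lborel (conv k f)"
  by (rule integrableI_bounded[OF _ order_le_less_trans[OF nn_integral_conv_le[OF assms]]])
    (measurable, simp add: ennreal_mult_less_top)

lemma L1_conv_le:
  assumes "nn_int (\<lambda>x. \<bar>k x\<bar>) \<le> ennreal B" and B: "0 \<le> B"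
  shows "L1 (conv k f) \<le> B * L1 f"
  by (rule L1_leI[OF integrable_conv[OF assms(1)]])
    (use nn_integral_conv_le[OF assms(1)] in \<open>simp_all add: ennreal_mult'[OF B] B L1_nonneg\<close>)

end

section \<open>Partial derivatives of smooth functions\<close>

lemma partial_eq:
  assumes "(f has_derivative f') (at x)"
  shows "partial i f x = f' (axis i 1)"
proof -
  have "((\<lambda>t. x + t *\<^sub>R axis i 1) has_derivative (\<lambda>t. t *\<^sub>R axis i 1)) (at 0)"
    by (auto intro!: derivative_eq_intros)
  moreover have "(f has_derivative f') (at (x + 0 *\<^sub>R axis i 1))" using assms by simp
  ultimately have "((\<lambda>t. f (x + t *\<^sub>R axis i 1)) has_derivative (\<lambda>t. f' (t *\<^sub>R axis i 1))) (at 0)"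
    by (rule has_derivative_compose)
  moreover have "(\<lambda>t. f' (t *\<^sub>R axis i 1)) = (\<lambda>t. t *\<^sub>R f' (axis i 1))"
    using has_derivative_linear[OF assms] by (simp add: linear_scale)
  ultimately show ?thesis
    unfolding partial_def by (intro vector_derivative_at) (simp add: has_vector_derivative_def)
qed

lemma vec_eq_sum_axis: "(h :: real^'d::finite) = (\<Sum>i\<in>UNIV. (h $ i) *\<^sub>R axis i 1)"
  by (simp add: vec_eq_iff axis_def if_distrib[of "\<lambda>c. _ * c"] sum.delta cong: if_cong)

lemma has_derivative_partials:
  assumes "f differentiable (at x)"
  shows "(f has_derivative (\<lambda>h. \<Sum>i\<in>UNIV. (h $ i) *\<^sub>R partial i f x)) (at x)"
proof -
  obtain f' where f': "(f has_derivative f') (at x)" using assms by (auto simp: differentiable_def)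
  interpret f': linear f' by (rule has_derivative_linear[OF f'])
  have "f' h = (\<Sum>i\<in>UNIV. (h $ i) *\<^sub>R partial i f x)" for h
  proof -
    have "f' h = f' (\<Sum>i\<in>UNIV. (h $ i) *\<^sub>R axis i 1)" using vec_eq_sum_axis[of h] by simp
    also have "\<dots> = (\<Sum>i\<in>UNIV. (h $ i) *\<^sub>R partial i f x)"
      by (simp add: f'.sum f'.scale partial_eq[OF f'])
    finally show ?thesis .
  qed
  hence "f' = (\<lambda>h. \<Sum>i\<in>UNIV. (h $ i) *\<^sub>R partial i f x)" by (rule ext)
  thus ?thesis using f' by simp
qed

lemma partial_has_vector_derivative:
  assumes "\<And>x. f differentiable (at x)"
  shows "((\<lambda>t. f (x + t *\<^sub>R axis i 1)) has_vector_derivative partial i f (x + t *\<^sub>R axis i 1)) (at t within S)"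
proof -
  have "((\<lambda>t. x + t *\<^sub>R axis i 1) has_derivative (\<lambda>t. t *\<^sub>R axis i 1)) (at t within S)"
    by (auto intro!: derivative_eq_intros)
  from has_derivative_compose[OF this has_derivative_partials[OF assms]]
  show ?thesis
    by (simp add: has_vector_derivative_def axis_def if_distrib[of "\<lambda>c. _ * c"] if_distrib[of "\<lambda>c. c *\<^sub>R _"]
        sum.delta cong: if_cong)
qed

lemma smooth_diffble: "smooth f \<Longrightarrow> f differentiable (at x)"
  unfolding smooth_def by (metis C_times.simps(2))

lemma smooth_partial: "smooth f \<Longrightarrow> smooth (partial i f)"
  unfolding smooth_def by (metis C_times.simps(2))

lemma smooth_continuous: "smooth f \<Longrightarrow> continuous_on UNIV f"
  unfolding smooth_def by (metis C_times.simps(1))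

lemma partial_lincomb:
  assumes "\<And>x. f differentiable (at x)" "\<And>x. g differentiable (at x)"
  shows "partial i (\<lambda>x. a * f x + b * g x) = (\<lambda>x. a * partial i f x + b * partial i g x)"
proof
  fix x
  have "((\<lambda>x. a * f x + b * g x) has_derivative
      (\<lambda>h. a * (\<Sum>i\<in>UNIV. (h $ i) *\<^sub>R partial i f x) + b * (\<Sum>i\<in>UNIV. (h $ i) *\<^sub>R partial i g x))) (at x)"
    by (intro has_derivative_add has_derivative_mult_right has_derivative_partials assms)
  from partial_eq[OF this, of i]
  show "partial i (\<lambda>x. a * f x + b * g x) x = a * partial i f x + b * partial i g x"
    by (simp add: axis_def if_distrib[of "\<lambda>c. c *\<^sub>R _"] sum.delta cong: if_cong)
qed

lemma C_times_lincomb: "C_times k f \<Longrightarrow> C_times k g \<Longrightarrow> C_times k (\<lambda>x. a * f x + b * g x)"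
proof (induction k arbitrary: f g)
  case 0
  thus ?case by (auto intro!: continuous_intros)
next
  case (Suc k)
  have d: "\<And>x. f differentiable (at x)" "\<And>x. g differentiable (at x)" using Suc.prems by auto
  show ?case unfolding C_times.simps partial_lincomb[OF d]
  proof (intro conjI allI)
    show "(\<lambda>x. a * f x + b * g x) differentiable at x" for x
      by (intro differentiable_add differentiable_mult differentiable_const d)
    show "C_times k (\<lambda>x. a * partial i f x + b * partial i g x)" for i
      by (rule Suc.IH) (use Suc.prems in auto)
  qed
qed

lemma smooth_lincomb: "smooth f \<Longrightarrow> smooth g \<Longrightarrow> smooth (\<lambda>x. a * f x + b * g x)"
  by (simp add: smooth_def C_times_lincomb)

lemma norm_diff_le_vector_derivative:
  fixes \<phi> :: "real \<Rightarrow> complex"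
  assumes h: "0 \<le> h" and d: "\<And>t. t \<in> {0..h} \<Longrightarrow> (\<phi> has_vector_derivative \<phi>' t) (at t within {0..h})"
    and b: "\<And>t. t \<in> {0..h} \<Longrightarrow> norm (\<phi>' t) \<le> B"
  shows "norm (\<phi> h - \<phi> 0) \<le> B * h"
proof -
  have "norm (\<phi> h - \<phi> 0) \<le> B * norm (h - 0)"
  proof (rule differentiable_bound[of "{0..h}"])
    show "(\<phi> has_derivative (\<lambda>s. s *\<^sub>R \<phi>' t)) (at t within {0..h})" if "t \<in> {0..h}" for t
      using d[OF that] by (simp add: has_vector_derivative_def)
    show "onorm (\<lambda>s. s *\<^sub>R \<phi>' t) \<le> B" if "t \<in> {0..h}" for t
      by (rule onorm_le) (use b[OF that] in \<open>simp add: mult.commute[of B] mult_left_mono\<close>)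
  qed (use h in auto)
  thus ?thesis using h by simp
qed

section \<open>Symmetry of second derivatives\<close>

abbreviation second_diff :: "(real^'d::finite \<Rightarrow> complex) \<Rightarrow> real^'d \<Rightarrow> real \<Rightarrow> 'd \<Rightarrow> 'd \<Rightarrow> complex" where
  "second_diff f x h i j \<equiv> f (x + h *\<^sub>R axis i 1 + h *\<^sub>R axis j 1) - f (x + h *\<^sub>R axis i 1) - f (x + h *\<^sub>R axis j 1) + f x"

text \<open>Two uses of the mean value inequality: in direction \<open>i\<close> for the
  \<open>j\<close>-th derivative, then in direction \<open>j\<close> for a difference of
  \<open>f\<close>. Subtracting linear terms leaves derivatives controlled by the oscillation of the
  mixed derivative near \<open>x\<close>.\<close>

lemma second_difference:
  fixes f :: "real^'d::finite \<Rightarrow> complex"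
  assumes f: "smooth f" and e: "e > 0"
  obtains d where "d > 0" "\<And>h. 0 < h \<Longrightarrow> h < d \<Longrightarrow>
    norm (second_diff f x h i j
      - (h * h) *\<^sub>R partial i (partial j f) x) \<le> e * (h * h)"
proof -
  let ?A = "partial i (partial j f)"
  have "isCont ?A x"
    using smooth_continuous[OF smooth_partial[OF smooth_partial[OF f]]] by (simp add: continuous_on_eq_continuous_at)
  then obtain d where d: "d > 0" "\<And>y. dist y x < d \<Longrightarrow> dist (?A y) (?A x) < e"
    using e unfolding continuous_at_eps_delta by blast
  have near: "norm (?A (x + s *\<^sub>R axis i 1 + t *\<^sub>R axis j 1) - ?A x) \<le> e"
    if "0 \<le> s" "0 \<le> t" "s + t < d" for s t
  proof -
    have "norm (s *\<^sub>R axis i (1::real) + t *\<^sub>R axis j 1 :: real^'d) \<le> s + t"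
      using norm_triangle_ineq[of "s *\<^sub>R axis i (1::real) :: real^'d" "t *\<^sub>R axis j 1"] that by (simp add: norm_axis_1)
    hence "dist (x + s *\<^sub>R axis i 1 + t *\<^sub>R axis j 1) x < d" using that by (simp add: dist_norm add.assoc)
    from d(2)[OF this] show ?thesis by (simp add: dist_norm)
  qed
  show ?thesis
  \<comment> \<open>Half of \<open>d\<close>, because the displacements in the two directions add
    up.\<close>
  proof (rule that[of "d / 2"])
    fix h :: real assume h: "0 < h" "h < d / 2"
    have inner: "norm (partial j f (x + t *\<^sub>R axis j 1 + h *\<^sub>R axis i 1) - partial j f (x + t *\<^sub>R axis j 1) - h *\<^sub>R ?A x) \<le> e * h"
      if t: "t \<in> {0..h}" for t
    proof -
      let ?\<phi> = "\<lambda>s. partial j f (x + t *\<^sub>R axis j 1 + s *\<^sub>R axis i 1) - s *\<^sub>R ?A x"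
      have "norm (?\<phi> h - ?\<phi> 0) \<le> e * h"
      proof (rule norm_diff_le_vector_derivative)
        fix s assume s: "s \<in> {0..h}"
        show "(?\<phi> has_vector_derivative (?A (x + t *\<^sub>R axis j 1 + s *\<^sub>R axis i 1) - ?A x)) (at s within {0..h})"
          by (intro has_vector_derivative_diff partial_has_vector_derivative smooth_diffble smooth_partial f)
            (auto intro!: derivative_eq_intros)
        show "norm (?A (x + t *\<^sub>R axis j 1 + s *\<^sub>R axis i 1) - ?A x) \<le> e"
          using near[of s t] s t h by (simp add: add_ac)
      qed (use h in auto)
      thus ?thesis by (simp add: algebra_simps)
    qed
    let ?\<psi> = "\<lambda>t. f (x + h *\<^sub>R axis i 1 + t *\<^sub>R axis j 1) - f (x + t *\<^sub>R axis j 1) - t *\<^sub>R (h *\<^sub>R ?A x)"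
    have "norm (?\<psi> h - ?\<psi> 0) \<le> (e * h) * h"
    proof (rule norm_diff_le_vector_derivative)
      fix t assume t: "t \<in> {0..h}"
      show "(?\<psi> has_vector_derivative (partial j f (x + h *\<^sub>R axis i 1 + t *\<^sub>R axis j 1)
          - partial j f (x + t *\<^sub>R axis j 1) - h *\<^sub>R ?A x)) (at t within {0..h})"
        by (intro has_vector_derivative_diff partial_has_vector_derivative smooth_diffble f)
          (auto intro!: derivative_eq_intros)
      show "norm (partial j f (x + h *\<^sub>R axis i 1 + t *\<^sub>R axis j 1)
          - partial j f (x + t *\<^sub>R axis j 1) - h *\<^sub>R ?A x) \<le> e * h"
        using inner[OF t] by (simp add: add_ac)
    qed (use h in auto)
    thus "norm (second_diff f x h i j
      - (h * h) *\<^sub>R ?A x) \<le> e * (h * h)" by (simp add: algebra_simps)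
  qed (use d in auto)
qed

text \<open>The second difference is symmetric in \<open>i\<close> and \<open>j\<close>, and after
  division by h^2 it approximates either mixed derivative.\<close>

lemma partial_commute:
  assumes f: "smooth f"
  shows "partial i (partial j f) = partial j (partial i f)"
proof
  fix x
  let ?A = "partial i (partial j f) x" and ?B = "partial j (partial i f) x"
  have "norm (?A - ?B) \<le> 0 + e" if e: "e > 0" for e
  proof -
    have e2: "e / 2 > 0" using e by simp
    obtain d where d: "d > 0" "\<And>h. 0 < h \<Longrightarrow> h < d \<Longrightarrow>
      norm (second_diff f x h i j
      - (h * h) *\<^sub>R ?A) \<le> e / 2 * (h * h)"
      by (rule second_difference[OF f e2, of x i j]) blast
    obtain d' where d': "d' > 0" "\<And>h. 0 < h \<Longrightarrow> h < d' \<Longrightarrow>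
      norm (second_diff f x h j i
      - (h * h) *\<^sub>R ?B) \<le> e / 2 * (h * h)"
      by (rule second_difference[OF f e2, of x j i]) blast
    define h where "h = min d d' / 2"
    have h: "0 < h" "h < d" "h < d'" using d(1) d'(1) by (auto simp: h_def)
    define S where "S = second_diff f x h i j"
    have A: "norm (S - (h * h) *\<^sub>R ?A) \<le> e / 2 * (h * h)" unfolding S_def by (rule d(2)[OF h(1,2)])
    have "S = second_diff f x h j i"
      by (simp add: S_def add_ac)
    hence B: "norm (S - (h * h) *\<^sub>R ?B) \<le> e / 2 * (h * h)" using d'(2)[OF h(1,3)] by simp
    have "(h * h) *\<^sub>R (?A - ?B) = (S - (h * h) *\<^sub>R ?B) - (S - (h * h) *\<^sub>R ?A)"
      by (simp add: scaleR_diff_right)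
    hence "norm ((h * h) *\<^sub>R (?A - ?B)) \<le> (h * h) * e"
      using norm_triangle_ineq4[of "S - (h * h) *\<^sub>R ?B" "S - (h * h) *\<^sub>R ?A"] A B
      by (simp add: field_simps)
    moreover have "norm ((h * h) *\<^sub>R (?A - ?B)) = (h * h) * norm (?A - ?B)"
      unfolding norm_scaleR by simp
    ultimately have "(h * h) * norm (?A - ?B) \<le> (h * h) * e" by (simp only:)
    thus ?thesis using h(1) by simp
  qed
  hence "norm (?A - ?B) \<le> 0" by (rule field_le_epsilon)
  thus "?A = ?B" by simp
qed

lemma smooth_partial_funpow: "smooth f \<Longrightarrow> smooth ((partial i ^^ n) f)"
  by (induction n) (auto intro: smooth_partial)

lemma partial_funpow_commute: "smooth f \<Longrightarrow> (partial i ^^ n) (partial j f) = partial j ((partial i ^^ n) f)"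
  by (induction n) (auto simp: partial_commute smooth_partial_funpow)

section \<open>Derivatives along multi-indices\<close>

lemma multi_deriv_zero: "multi_deriv (\<lambda>_. 0) f = f"
proof -
  have "foldr (\<lambda>i. partial i ^^ 0) is f = f" for "is" :: "'a list" by (induction "is") auto
  thus ?thesis by (simp add: multi_deriv_def)
qed

lemma smooth_foldr: "smooth f \<Longrightarrow> smooth (foldr (\<lambda>i. partial i ^^ \<alpha> i) is f)"
  by (induction "is") (auto intro: smooth_partial_funpow)

lemma smooth_multi_deriv: "smooth f \<Longrightarrow> smooth (multi_deriv \<alpha> f)"
  by (simp add: multi_deriv_def smooth_foldr)

lemma foldr_inc_notin: "i \<notin> set is \<Longrightarrow> foldr (\<lambda>j. partial j ^^ inc i \<alpha> j) is f = foldr (\<lambda>j. partial j ^^ \<alpha> j) is f"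
  by (induction "is") (auto simp: inc_def)

text \<open>The extra derivative acts at the position of \<open>i\<close> in the enumeration; on
  smooth functions it commutes with those applied after it.\<close>

lemma foldr_inc:
  assumes "smooth f" "distinct is" "i \<in> set is"
  shows "foldr (\<lambda>j. partial j ^^ inc i \<alpha> j) is f = partial i (foldr (\<lambda>j. partial j ^^ \<alpha> j) is f)"
  using assms(2,3)
proof (induction "is")
  case (Cons j js)
  show ?case
  proof (cases "i = j")
    case True
    hence "i \<notin> set js" using Cons.prems by auto
    moreover have "inc i \<alpha> j = Suc (\<alpha> j)" using True by (simp add: inc_def)
    ultimately show ?thesis using True by (simp add: foldr_inc_notin)
  next
    case False
    hence "i \<in> set js" "distinct js" using Cons.prems by auto
    hence "foldr (\<lambda>j. partial j ^^ inc i \<alpha> j) js f = partial i (foldr (\<lambda>j. partial j ^^ \<alpha> j) js f)"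
      by (intro Cons.IH)
    thus ?thesis using False
      by (simp add: inc_def partial_funpow_commute smooth_foldr assms(1))
  qed
qed simp

text \<open>Together with \<open>multi_deriv_zero\<close> this determines all multi-index
  derivatives, so the chosen enumeration disappears from here on and proofs run by
  \<open>multi_index_induct\<close>.\<close>

lemma multi_deriv_inc:
  fixes f :: "real^'d::finite \<Rightarrow> complex"
  assumes "smooth f"
  shows "multi_deriv (inc i \<alpha>) f = partial i (multi_deriv \<alpha> f)"
proof -
  obtain xs :: "'d list" where "distinct xs \<and> set xs = UNIV"
    using finite_distinct_list[OF finite] by metis
  hence "distinct (SOME is. distinct is \<and> set is = (UNIV :: 'd set)) \<and> set (SOME is. distinct is \<and> set is = (UNIV :: 'd set)) = UNIV"
    by (rule someI)
  thus ?thesis unfolding multi_deriv_def by (intro foldr_inc assms) auto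
qed

lemma multi_index_induct [case_names zero inc]:
  fixes \<alpha> :: "'d::finite \<Rightarrow> nat"
  assumes "P (\<lambda>_. 0)" and "\<And>i \<alpha>. P \<alpha> \<Longrightarrow> P (inc i \<alpha>)"
  shows "P \<alpha>"
proof (induction "multi_abs \<alpha>" arbitrary: \<alpha>)
  case 0
  hence "\<alpha> = (\<lambda>_. 0)" by (auto simp: multi_abs_def fun_eq_iff)
  thus ?case using assms(1) by simp
next
  case (Suc n)
  hence "\<exists>i. \<alpha> i \<noteq> 0" by (metis multi_abs_def nat.distinct(1) sum.neutral)
  then obtain i where i: "\<alpha> i \<noteq> 0" by blast
  define \<beta> where "\<beta> = \<alpha>(i := \<alpha> i - 1)"
  have \<beta>: "\<alpha> = inc i \<beta>" using i by (auto simp: \<beta>_def inc_def fun_eq_iff)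
  have "n = multi_abs \<beta>" using Suc.hyps(2) by (simp add: \<beta> multi_abs_inc)
  thus ?case unfolding \<beta> by (intro assms(2) Suc.hyps(1))
qed

lemma multi_deriv_lincomb:
  assumes f: "smooth f" and g: "smooth g"
  shows "multi_deriv \<alpha> (\<lambda>x. a * f x + b * g x) = (\<lambda>x. a * multi_deriv \<alpha> f x + b * multi_deriv \<alpha> g x)"
proof (induction \<alpha> rule: multi_index_induct)
  case zero
  show ?case by (simp add: multi_deriv_zero)
next
  case (inc i \<alpha>)
  show ?case
    by (simp add: multi_deriv_inc f g smooth_lincomb inc.IH partial_lincomb smooth_diffble smooth_multi_deriv)
qed

section \<open>Regularisation by the kernel\<close>

lemma jker_conv_pair: "R > 0 \<Longrightarrow> integrable lborel f \<Longrightarrow>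
    conv_pair (jker R \<alpha>) (f :: real^'d::finite \<Rightarrow> complex) (jker_sup R \<alpha>)"
  by (intro conv_pair.intro jker_measurable jker_bound)

lemma sum_component_norm_le:
  fixes h :: "real^'d::finite" and c :: "'d \<Rightarrow> 'b::real_normed_vector" and B :: real
  assumes "\<And>i. norm (c i) \<le> B"
  shows "norm (\<Sum>i\<in>UNIV. (h $ i) *\<^sub>R c i) \<le> CARD('d) * B * norm h"
proof -
  have "norm (\<Sum>i\<in>UNIV. (h $ i) *\<^sub>R c i) \<le> (\<Sum>i\<in>(UNIV :: 'd set). norm h * B)"
  proof (rule sum_norm_le)
    fix i
    have "\<bar>h $ i\<bar> * norm (c i) \<le> norm h * B"
      by (intro mult_mono component_le_norm_cart assms) auto
    thus "norm ((h $ i) *\<^sub>R c i) \<le> norm h * B" by simp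
  qed
  thus ?thesis by (simp add: mult_ac)
qed

lemma jker_Lipschitz:
  fixes x y :: "real^'d::finite"
  assumes R: "R > 0"
  shows "\<bar>jker R \<alpha> x - jker R \<alpha> y\<bar> \<le>
    (CARD('d) * ((jconst * R) ^ CARD('d) * (4 * R) ^ Suc (multi_abs \<alpha>))) * norm (x - y)"
proof -
  let ?B = "(jconst * R) ^ CARD('d) * (4 * R) ^ Suc (multi_abs \<alpha>)"
  have "norm (jker R \<alpha> x - jker R \<alpha> y) \<le> (CARD('d) * ?B) * norm (x - y)"
  proof (rule differentiable_bound[of UNIV])
    show "(jker R \<alpha> has_derivative (\<lambda>h. \<Sum>i\<in>UNIV. (h $ i) *\<^sub>R jker R (inc i \<alpha>) z)) (at z within UNIV)" for z
      using jker_has_derivative[of R \<alpha> z] by simp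
    show "onorm (\<lambda>h::real^'d. \<Sum>i\<in>UNIV. (h $ i) *\<^sub>R jker R (inc i \<alpha>) z) \<le> CARD('d) * ?B" for z
    proof (rule onorm_le, rule sum_component_norm_le)
      show "norm (jker R (inc i \<alpha>) z) \<le> ?B" for i
        using jker_bound[OF R, of "inc i \<alpha>" z] by (simp only: multi_abs_inc real_norm_def)
    qed
  qed auto
  thus ?thesis by simp
qed

text \<open>The remainder is quadratic with \<open>K\<close> independent of the base point
  \<open>z\<close>; this uniformity allows integration against any integrable function.\<close>

lemma jker_linearization:
  assumes R: "R > 0"
  obtains K where "\<And>z h :: real^'d::finite.
    \<bar>jker R \<alpha> (z + h) - jker R \<alpha> z - (\<Sum>i\<in>UNIV. h $ i * jker R (inc i \<alpha>) z)\<bar> \<le> K * (norm h * norm h)"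
proof
  \<comment> \<open>A Lipschitz constant of the first derivatives of \<open>jker R \<alpha>\<close>,
    hence two orders above \<open>\<alpha>\<close>.\<close>
  define B where "B = CARD('d) * ((jconst * R) ^ CARD('d) * (4 * R) ^ Suc (Suc (multi_abs \<alpha>)))"
  have B: "B \<ge> 0" using R jconst_pos by (simp add: B_def)
  have Lip: "\<bar>jker R (inc i \<alpha>) x - jker R (inc i \<alpha>) y\<bar> \<le> B * norm (x - y)" for i and x y :: "real^'d"
    using jker_Lipschitz[OF R, of "inc i \<alpha>" x y] by (simp add: B_def multi_abs_inc)
  fix z h :: "real^'d"
  let ?S = "(\<lambda>t. z + t *\<^sub>R h) ` {0..1}"
  let ?f' = "\<lambda>x h. \<Sum>i\<in>UNIV. h $ i * jker R (inc i \<alpha>) x"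
  have "norm (jker R \<alpha> (z + h) - jker R \<alpha> z - ?f' z ((z + h) - z)) \<le> norm ((z + h) - z) * (CARD('d) * (B * norm h))"
  proof (rule differentiable_bound_linearization[where S = ?S])
    show "z + t *\<^sub>R (z + h - z) \<in> ?S" if "t \<in> {0..1}" for t using that by auto
    show "z \<in> ?S" by (rule image_eqI[of _ _ 0]) auto
    fix x assume x: "x \<in> ?S"
    show "(jker R \<alpha> has_derivative ?f' x) (at x within ?S)"
      using jker_has_derivative[of R \<alpha> x] by (rule has_derivative_at_withinI)
    obtain t where t: "t \<in> {0..1}" "x = z + t *\<^sub>R h" using x by auto
    have "norm (x - z) \<le> norm h" using t by (simp add: mult_left_le_one_le)
    hence "B * norm (x - z) \<le> B * norm h" using B by (rule mult_left_mono)
    hence "norm (jker R (inc i \<alpha>) x - jker R (inc i \<alpha>) z) \<le> B * norm h" for i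
      using Lip[of i x z] by simp
    from sum_component_norm_le[OF this]
    have "onorm (\<lambda>k. \<Sum>i\<in>UNIV. (k $ i) *\<^sub>R (jker R (inc i \<alpha>) x - jker R (inc i \<alpha>) z)) \<le> CARD('d) * (B * norm h)"
      by (rule onorm_le)
    moreover have "?f' x - ?f' z = (\<lambda>k. \<Sum>i\<in>UNIV. (k $ i) *\<^sub>R (jker R (inc i \<alpha>) x - jker R (inc i \<alpha>) z))"
      by (simp add: fun_eq_iff sum_subtractf right_diff_distrib)
    ultimately show "onorm (?f' x - ?f' z) \<le> CARD('d) * (B * norm h)" by simp
  qed
  thus "\<bar>jker R \<alpha> (z + h) - jker R \<alpha> z - (\<Sum>i\<in>UNIV. h $ i * jker R (inc i \<alpha>) z)\<bar>
      \<le> (CARD('d) * B) * (norm h * norm h)" by (simp add: mult_ac)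
qed

text \<open>Integrating the uniform quadratic remainder against \<open>f\<close> leaves an error of
  at most \<open>K * L1 f\<close> times the square of the increment, so the derivative passes under
  the integral.\<close>

lemma conv_jker_has_derivative:
  fixes f :: "real^'d::finite \<Rightarrow> complex"
  assumes R: "R > 0" and f: "integrable lborel f"
  shows "(conv (jker R \<alpha>) f has_derivative (\<lambda>h. \<Sum>i\<in>UNIV. (h $ i) *\<^sub>R conv (jker R (inc i \<alpha>)) f x)) (at x)"
proof -
  interpret c: conv_pair "jker R \<beta>" f "jker_sup R \<beta>" for \<beta>
    by (rule jker_conv_pair[OF R f])
  obtain K where K: "\<And>z h :: real^'d.
    \<bar>jker R \<alpha> (z + h) - jker R \<alpha> z - (\<Sum>i\<in>UNIV. h $ i * jker R (inc i \<alpha>) z)\<bar> \<le> K * (norm h * norm h)"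
    by (rule jker_linearization[OF R, of \<alpha>]) blast
  let ?F = "conv (jker R \<alpha>) f" and ?D = "\<lambda>h. \<Sum>i\<in>UNIV. (h $ i) *\<^sub>R conv (jker R (inc i \<alpha>)) f x"
  have est: "norm (?F (x + h) - ?F x - ?D h) \<le> K * L1 f * (norm h * norm h)" for h
  proof -
    let ?r = "\<lambda>y. jker R \<alpha> (x + h - y) - jker R \<alpha> (x - y) - (\<Sum>i\<in>UNIV. h $ i * jker R (inc i \<alpha>) (x - y))"
    have ints: "integrable lborel (\<lambda>y. \<Sum>i\<in>UNIV. (h $ i) *\<^sub>R (jker R (inc i \<alpha>) (x - y) *\<^sub>R f y))"
      by (intro Bochner_Integration.integrable_sum integrable_scaleR_right c.integrand)
    have eq: "?r y *\<^sub>R f y = jker R \<alpha> (x + h - y) *\<^sub>R f y - jker R \<alpha> (x - y) *\<^sub>R f y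
        - (\<Sum>i\<in>UNIV. (h $ i) *\<^sub>R (jker R (inc i \<alpha>) (x - y) *\<^sub>R f y))" for y
      by (simp add: scaleR_diff_left scaleR_sum_left)
    have intr: "integrable lborel (\<lambda>y. ?r y *\<^sub>R f y)"
      unfolding eq by (intro Bochner_Integration.integrable_diff c.integrand ints)
    have "?F (x + h) - ?F x - ?D h = (LINT y|lborel. ?r y *\<^sub>R f y)"
    proof -
      have "(LINT y|lborel. (\<Sum>i\<in>UNIV. (h $ i) *\<^sub>R (jker R (inc i \<alpha>) (x - y) *\<^sub>R f y))) = ?D h"
        unfolding conv_def integral_scaleR_right[symmetric]
        by (rule Bochner_Integration.integral_sum) (intro integrable_scaleR_right c.integrand)
      thus ?thesis unfolding eq
        by (simp only: Bochner_Integration.integral_diff Bochner_Integration.integrable_diff c.integrand ints)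
          (simp only: conv_def)
    qed
    also have "norm \<dots> \<le> (LINT y|lborel. norm (?r y *\<^sub>R f y))" by (rule integral_norm_bound)
    also have "\<dots> \<le> (LINT y|lborel. K * (norm h * norm h) * norm (f y))"
    proof (rule integral_mono)
      show "integrable lborel (\<lambda>y. norm (?r y *\<^sub>R f y))" by (rule integrable_norm[OF intr])
      show "integrable lborel (\<lambda>y. K * (norm h * norm h) * norm (f y))" using f by auto
      show "norm (?r y *\<^sub>R f y) \<le> K * (norm h * norm h) * norm (f y)" for y
      proof -
        have "x - y + h = x + h - y" by simp
        thus ?thesis unfolding norm_scaleR real_norm_def
          using mult_right_mono[OF K[of "x - y" h] norm_ge_zero[of "f y"]] by (simp only:)
      qed
    qed
    finally show ?thesis by (simp add: L1_def mult_ac)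
  qed
  show ?thesis
  proof (rule has_derivativeI_sandwich[of 1])
    show "bounded_linear ?D"
      by (intro bounded_linear_sum bounded_linear_compose[OF bounded_linear_scaleR_left bounded_linear_vec_nth])
    show "norm (?F y - ?F x - ?D (y - x)) / norm (y - x) \<le> K * L1 f * norm (y - x)" if "y \<noteq> x" for y
      using est[of "y - x"] that by (simp add: field_simps)
    have "((\<lambda>y. K * L1 f * norm (y - x)) \<longlongrightarrow> K * L1 f * norm (x - x)) (at x)"
      by (intro tendsto_intros)
    thus "((\<lambda>y. K * L1 f * norm (y - x)) \<longlongrightarrow> 0) (at x)" by simp
  qed auto
qed

lemma partial_conv_jker:
  assumes R: "R > 0" and f: "integrable lborel f"
  shows "partial i (conv (jker R \<alpha>) f) = conv (jker R (inc i \<alpha>)) f"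
  by (rule ext, subst partial_eq[OF conv_jker_has_derivative[OF R f]])
    (simp add: axis_def if_distrib[of "\<lambda>c. c *\<^sub>R _"] sum.delta cong: if_cong)

lemma smooth_conv_jker:
  assumes R: "R > 0" and f: "integrable lborel f"
  shows "smooth (conv (jker R \<alpha>) f)"
proof -
  have "C_times k (conv (jker R \<alpha>) f)" for k \<alpha>
  proof (induction k arbitrary: \<alpha>)
    case 0
    show ?case using has_derivative_continuous[OF conv_jker_has_derivative[OF R f]]
      by (simp add: continuous_on_eq_continuous_at)
  next
    case (Suc k)
    have "conv (jker R \<alpha>) f differentiable (at x)" for x
      using conv_jker_has_derivative[OF R f] by (auto simp: differentiable_def)
    thus ?case by (simp add: partial_conv_jker[OF R f] Suc.IH)
  qed
  thus ?thesis by (simp add: smooth_def)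
qed

text \<open>The increment \<open>F(x + e\<^sub>i) - F(x)\<close> has integral zero, and it is the integral of \<open>\<partial>\<^sub>iF\<close> over
  a unit segment.\<close>

lemma integral_partial_eq_0:
  fixes F :: "real^'d::finite \<Rightarrow> complex"
  assumes d: "\<And>x. F differentiable (at x)" and c: "continuous_on UNIV (partial i F)"
    and F: "integrable lborel F" and G: "integrable lborel (partial i F)"
  shows "(LINT x|lborel. partial i F x) = 0"
proof -
  let ?G = "partial i F" and ?v = "axis i 1 :: real^'d"
  have [measurable]: "F \<in> borel_measurable borel" "?G \<in> borel_measurable borel"
    using F G by (auto simp: borel_measurable_integrable)
  have ftc: "(LINT s|lborel. indicator {0..1} s *\<^sub>R ?G (x + s *\<^sub>R ?v)) = F (x + ?v) - F x" for x
  proof -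
    have "(LINT s|lborel. indicator {0..1} s *\<^sub>R ?G (x + s *\<^sub>R ?v)) = F (x + 1 *\<^sub>R ?v) - F (x + 0 *\<^sub>R ?v)"
    proof (rule integral_FTC_atLeastAtMost)
      show "((\<lambda>s. F (x + s *\<^sub>R ?v)) has_vector_derivative ?G (x + s *\<^sub>R ?v)) (at s within {0..1})" for s
        by (rule partial_has_vector_derivative[OF d])
      show "continuous_on {0..1} (\<lambda>s. ?G (x + s *\<^sub>R ?v))"
        by (intro continuous_on_compose2[OF c] continuous_intros) auto
    qed simp
    thus ?thesis by simp
  qed
  have tr: "nn_int (\<lambda>x. norm (?G (x + s *\<^sub>R ?v))) = ennreal (L1 ?G)" for s
    using nn_integral_translate[of "\<lambda>x. ennreal (norm (?G x))" "s *\<^sub>R ?v"] by (simp add: nn_integral_L1 G)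
  have int: "integrable (lborel \<Otimes>\<^sub>M lborel) (\<lambda>(s, x). indicator {0..1::real} s *\<^sub>R ?G (x + s *\<^sub>R ?v))"
  proof (rule integrableI_bounded)
    have "(\<integral>\<^sup>+p. ennreal (norm (case p of (s, x) \<Rightarrow> indicator {0..1::real} s *\<^sub>R ?G (x + s *\<^sub>R ?v))) \<partial>(lborel \<Otimes>\<^sub>M lborel))
      = (\<integral>\<^sup>+s. \<integral>\<^sup>+x. ennreal (norm (indicator {0..1::real} s *\<^sub>R ?G (x + s *\<^sub>R ?v))) \<partial>lborel \<partial>lborel)"
      by (subst lborel.nn_integral_fst[symmetric]) auto
    also have "\<dots> = (\<integral>\<^sup>+s. ennreal (L1 ?G) * indicator {0..1::real} s \<partial>lborel)"
      by (intro nn_integral_cong) (auto simp: indicator_def tr)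
    also have "\<dots> < \<infinity>" by (subst nn_integral_cmult_indicator) (auto simp: ennreal_mult_less_top)
    finally show "(\<integral>\<^sup>+p. ennreal (norm (case p of (s, x) \<Rightarrow> indicator {0..1::real} s *\<^sub>R ?G (x + s *\<^sub>R ?v))) \<partial>(lborel \<Otimes>\<^sub>M lborel)) < \<infinity>" .
  qed measurable
  have "0 = (LINT x|lborel. F (x + ?v)) - (LINT x|lborel. F x)"
    by (simp add: integral_translate_lborel)
  also have "\<dots> = (LINT x|lborel. F (x + ?v) - F x)"
    by (rule Bochner_Integration.integral_diff[symmetric]) (auto intro: integrable_translate_lborel F)
  also have "\<dots> = (LINT x|lborel. LINT s|lborel. indicator {0..1} s *\<^sub>R ?G (x + s *\<^sub>R ?v))"
    by (simp only: ftc)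
  also have "\<dots> = (LINT s|lborel. LINT x|lborel. indicator {0..1} s *\<^sub>R ?G (x + s *\<^sub>R ?v))"
    by (rule lborel_pair.Fubini_integral[OF int])
  also have "\<dots> = (LINT s|lborel. indicator {0..1::real} s *\<^sub>R (LINT x|lborel. ?G x))"
    by (simp add: integral_translate_lborel[of ?G])
  also have "\<dots> = (LINT x|lborel. ?G x)" by simp
  finally show ?thesis by simp
qed

text \<open>Integration by parts: the product \<open>jker R \<alpha> (x - y) *\<^sub>R f y\<close>,
  as a function of \<open>y\<close>, has an integrable partial derivative, whose integral is zero.
  The reflection in the kernel supplies the sign.\<close>

lemma conv_jker_partial:
  fixes f :: "real^'d::finite \<Rightarrow> complex"
  assumes R: "R > 0" and f: "smooth f" "integrable lborel f" "integrable lborel (partial i f)"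
  shows "conv (jker R (inc i \<alpha>)) f = conv (jker R \<alpha>) (partial i f)"
proof
  fix x :: "real^'d"
  interpret c: conv_pair "jker R \<beta>" f "jker_sup R \<beta>" for \<beta>
    by (rule jker_conv_pair[OF R f(2)])
  interpret c': conv_pair "jker R \<alpha>" "partial i f" "jker_sup R \<alpha>"
    by (rule jker_conv_pair[OF R f(3)])
  let ?F = "\<lambda>y. jker R \<alpha> (x - y) *\<^sub>R f y"
  have der: "(?F has_derivative (\<lambda>h. jker R \<alpha> (x - y) *\<^sub>R (\<Sum>i\<in>UNIV. (h $ i) *\<^sub>R partial i f y)
      + (\<Sum>i\<in>UNIV. (- h) $ i * jker R (inc i \<alpha>) (x - y)) *\<^sub>R f y)) (at y)" for y
  proof (rule has_derivative_scaleR)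
    have "((\<lambda>y. x - y) has_derivative (\<lambda>h. - h)) (at y)" by (auto intro!: derivative_eq_intros)
    from has_derivative_compose[OF this jker_has_derivative]
    show "((\<lambda>y. jker R \<alpha> (x - y)) has_derivative (\<lambda>h. \<Sum>i\<in>UNIV. (- h) $ i * jker R (inc i \<alpha>) (x - y))) (at y)" .
    show "(f has_derivative (\<lambda>h. \<Sum>i\<in>UNIV. (h $ i) *\<^sub>R partial i f y)) (at y)"
      by (rule has_derivative_partials[OF smooth_diffble[OF f(1)]])
  qed
  have part: "partial i ?F = (\<lambda>y. jker R \<alpha> (x - y) *\<^sub>R partial i f y - jker R (inc i \<alpha>) (x - y) *\<^sub>R f y)"
    by (rule ext, subst partial_eq[OF der])
      (simp add: axis_def if_distrib[of "\<lambda>c. c *\<^sub>R _"] if_distrib[of "\<lambda>c. c * _"] if_distrib[of uminus] sum.delta cong: if_cong)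
  have cont: "continuous_on UNIV (\<lambda>y. jker R \<beta> (x - y))" for \<beta> :: "'d \<Rightarrow> nat"
    by (intro continuous_on_compose2[OF jker_continuous] continuous_intros) auto
  have "(LINT y|lborel. partial i ?F y) = 0"
  proof (rule integral_partial_eq_0)
    show "?F differentiable (at y)" for y using der unfolding differentiable_def by blast
    show "continuous_on UNIV (partial i ?F)" unfolding part
      by (intro continuous_intros cont smooth_continuous smooth_partial f(1))
    show "integrable lborel ?F" by (rule c.integrand)
    show "integrable lborel (partial i ?F)" unfolding part
      by (intro Bochner_Integration.integrable_diff c.integrand c'.integrand)
  qed
  thus "conv (jker R (inc i \<alpha>)) f x = conv (jker R \<alpha>) (partial i f) x"
    unfolding part conv_def by (simp add: Bochner_Integration.integral_diff c.integrand c'.integrand)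
qed

text \<open>The increment is an integral over the segment from x - y to x; after Tonelli, every
  translate of a partial derivative has the same L1 norm.\<close>

lemma nn_integral_translate_diff:
  assumes f: "smooth f" and p: "\<And>i. integrable lborel (partial i f)"
  shows "nn_int (\<lambda>x. norm (f x - f (x - y))) \<le> (\<Sum>i\<in>UNIV. ennreal (\<bar>y $ i\<bar> * L1 (partial i f)))"
proof -
  have [measurable]: "f \<in> borel_measurable borel" "\<And>i. partial i f \<in> borel_measurable borel"
    using smooth_continuous[OF f] smooth_continuous[OF smooth_partial[OF f]]
    by (auto intro: borel_measurable_continuous_onI)
  let ?g = "\<lambda>x s. \<Sum>i\<in>UNIV. (y $ i) *\<^sub>R partial i f (x - y + s *\<^sub>R y)"
  let ?S = "\<lambda>x s. (\<Sum>i\<in>UNIV. ennreal \<bar>y $ i\<bar> * ennreal (norm (partial i f (x - y + s *\<^sub>R y))))"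
  have pw: "ennreal (norm (f x - f (x - y))) \<le>
      (\<integral>\<^sup>+s. indicator {0..1} s * ?S x s \<partial>lborel)" for x
  proof -
    have cont: "continuous_on {0..1} (?g x)"
      by (intro continuous_intros continuous_on_compose2[OF smooth_continuous[OF smooth_partial[OF f]]]) auto
    have "(LINT s|lborel. indicator {0..1} s *\<^sub>R ?g x s) = f (x - y + 1 *\<^sub>R y) - f (x - y + 0 *\<^sub>R y)"
    proof (rule integral_FTC_atLeastAtMost[OF _ _ cont])
      fix s :: real
      have "((\<lambda>s. x - y + s *\<^sub>R y) has_derivative (\<lambda>s. s *\<^sub>R y)) (at s within {0..1})"
        by (auto intro!: derivative_eq_intros)
      from has_derivative_compose[OF this has_derivative_partials[OF smooth_diffble[OF f]]]
      show "((\<lambda>s. f (x - y + s *\<^sub>R y)) has_vector_derivative ?g x s) (at s within {0..1})"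
        by (simp add: has_vector_derivative_def scaleR_sum_right)
    qed simp
    hence eq: "f x - f (x - y) = (LINT s|lborel. indicator {0..1} s *\<^sub>R ?g x s)" by simp
    have ints: "integrable lborel (\<lambda>s. indicator {0..1} s *\<^sub>R ?g x s)"
      using borel_integrable_atLeastAtMost'[OF cont] unfolding set_integrable_def .
    have "ennreal (norm (f x - f (x - y))) \<le> nn_int (\<lambda>s. norm (indicator {0..1::real} s *\<^sub>R ?g x s))"
      unfolding eq by (rule integral_norm_bound_ennreal[OF ints])
    also have "\<dots> \<le> (\<integral>\<^sup>+s. indicator {0..1} s * ?S x s \<partial>lborel)"
    proof (rule nn_integral_mono)
      fix s :: real
      have "ennreal (norm (?g x s)) \<le> ennreal (\<Sum>i\<in>UNIV. \<bar>y $ i\<bar> * norm (partial i f (x - y + s *\<^sub>R y)))"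
        by (intro ennreal_leI order_trans[OF norm_sum]) simp
      also have "\<dots> = ?S x s"
        by (subst sum_ennreal[symmetric]) (auto simp: ennreal_mult')
      finally show "ennreal (norm (indicator {0..1::real} s *\<^sub>R ?g x s)) \<le>
          indicator {0..1} s * ?S x s"
        by (simp add: indicator_def)
    qed
    finally show ?thesis .
  qed
  have tr: "nn_int (\<lambda>x. norm (partial i f (x - y + s *\<^sub>R y))) = ennreal (L1 (partial i f))" for i s
    using nn_integral_translate[of "\<lambda>x. ennreal (norm (partial i f x))" "s *\<^sub>R y - y"]
    by (simp add: nn_integral_L1[OF p] algebra_simps)
  have "nn_int (\<lambda>x. norm (f x - f (x - y))) \<le>
      (\<integral>\<^sup>+x. \<integral>\<^sup>+s. indicator {0..1} s * ?S x s \<partial>lborel \<partial>lborel)"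
    by (intro nn_integral_mono pw)
  also have "\<dots> = (\<integral>\<^sup>+s. \<integral>\<^sup>+x. indicator {0..1} s * ?S x s \<partial>lborel \<partial>lborel)"
    by (rule lborel_pair.Fubini'[symmetric]) measurable
  also have "\<dots> = (\<integral>\<^sup>+s. (\<Sum>i\<in>UNIV. ennreal (\<bar>y $ i\<bar> * L1 (partial i f))) * indicator {0..1::real} s \<partial>lborel)"
  proof (rule nn_integral_cong)
    fix s :: real
    have "(\<integral>\<^sup>+x. ?S x s \<partial>lborel)
        = (\<Sum>i\<in>UNIV. ennreal (\<bar>y $ i\<bar> * L1 (partial i f)))"
      by (subst nn_integral_sum) (auto simp: nn_integral_cmult tr ennreal_mult' L1_nonneg)
    thus "(\<integral>\<^sup>+x. indicator {0..1} s * ?S x s \<partial>lborel)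
        = (\<Sum>i\<in>UNIV. ennreal (\<bar>y $ i\<bar> * L1 (partial i f))) * indicator {0..1::real} s"
      by (simp add: indicator_def)
  qed
  also have "\<dots> = (\<Sum>i\<in>UNIV. ennreal (\<bar>y $ i\<bar> * L1 (partial i f)))"
    by (subst nn_integral_cmult_indicator) auto
  finally show ?thesis .
qed

text \<open>Unit mass makes the difference an average of f(x) - f(x - y) over the kernel.
  Non-negativity and the first moment then give the factor 1/R at the price of one
  derivative.\<close>

lemma L1_diff_conv_jker:
  fixes f :: "real^'d::finite \<Rightarrow> complex"
  assumes R: "R > 0" and f: "smooth f" "integrable lborel f" and p: "\<And>i. integrable lborel (partial i f)"
  shows "L1 (\<lambda>x. f x - conv (jker R (\<lambda>_. 0)) f x) \<le> jconst / R * (\<Sum>i\<in>UNIV. L1 (partial i f))"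
proof -
  let ?k = "jker R (\<lambda>_. 0) :: real^'d \<Rightarrow> real"
  interpret c: conv_pair ?k f "jker_sup R (\<lambda>_::'d. 0)"
    by (rule jker_conv_pair[OF R f(2)])
  have k0: "0 \<le> ?k y" for y by (rule jker_0_nonneg[OF R])
  have [measurable]: "f \<in> borel_measurable borel" by (rule c.f_measurable)
  have kint: "nn_int (\<lambda>y. \<bar>?k y\<bar>) \<le> ennreal 1"
    using jker_nn_integral_0[OF R, where ?'d = 'd] by (simp add: k0)
  have pw: "ennreal (norm (f x - conv ?k f x)) \<le> (\<integral>\<^sup>+y. ennreal (?k y) * ennreal (norm (f x - f (x - y))) \<partial>lborel)" for x
  proof -
    have "nn_int (\<lambda>y. ?k (x - y)) = ennreal 1"
      using nn_integral_reflect[of "\<lambda>y. ennreal (?k y)" x] jker_nn_integral_0[OF R, where ?'d = 'd] by simp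
    hence hb: "has_bochner_integral lborel (\<lambda>y. ?k (x - y)) 1"
      by (intro has_bochner_integral_nn_integral) (auto simp: k0)
    have int1: "integrable lborel (\<lambda>y. ?k (x - y) *\<^sub>R f x)"
      using hb by (intro integrable_scaleR_left) (auto simp: has_bochner_integral_iff)
    have "f x - conv ?k f x = (LINT y|lborel. ?k (x - y) *\<^sub>R f x) - conv ?k f x"
      using hb by (simp add: has_bochner_integral_iff)
    also have "\<dots> = (LINT y|lborel. ?k (x - y) *\<^sub>R f x - ?k (x - y) *\<^sub>R f y)"
      unfolding conv_def by (rule Bochner_Integration.integral_diff[OF int1 c.integrand, symmetric])
    finally have eq: "f x - conv ?k f x = (LINT y|lborel. ?k (x - y) *\<^sub>R f x - ?k (x - y) *\<^sub>R f y)" .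
    have "ennreal (norm (f x - conv ?k f x)) \<le> nn_int (\<lambda>y. norm (?k (x - y) *\<^sub>R f x - ?k (x - y) *\<^sub>R f y))"
      unfolding eq by (rule integral_norm_bound_ennreal[OF Bochner_Integration.integrable_diff[OF int1 c.integrand]])
    also have "\<dots> = (\<integral>\<^sup>+y. ennreal (?k (x - y)) * ennreal (norm (f x - f y)) \<partial>lborel)"
      by (intro nn_integral_cong) (simp add: k0 ennreal_mult' flip: scaleR_diff_right)
    also have "\<dots> = (\<integral>\<^sup>+y. ennreal (?k y) * ennreal (norm (f x - f (x - y))) \<partial>lborel)"
      using nn_integral_reflect[of "\<lambda>y. ennreal (?k (x - y)) * ennreal (norm (f x - f y))" x] by simp
    finally show ?thesis .
  qed
  have int: "integrable lborel (\<lambda>x. f x - conv ?k f x)"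
    by (intro Bochner_Integration.integrable_diff f(2) c.integrable_conv[OF kint])
  have "nn_int (\<lambda>x. norm (f x - conv ?k f x)) \<le>
      (\<integral>\<^sup>+x. \<integral>\<^sup>+y. ennreal (?k y) * ennreal (norm (f x - f (x - y))) \<partial>lborel \<partial>lborel)"
    by (intro nn_integral_mono pw)
  also have "\<dots> = (\<integral>\<^sup>+y. \<integral>\<^sup>+x. ennreal (?k y) * ennreal (norm (f x - f (x - y))) \<partial>lborel \<partial>lborel)"
    by (rule lborel_pair.Fubini'[symmetric]) measurable
  also have "\<dots> \<le> (\<integral>\<^sup>+y. (\<Sum>i\<in>UNIV. ennreal (L1 (partial i f)) * ennreal (\<bar>y $ i\<bar> * ?k y)) \<partial>lborel)"
  proof (rule nn_integral_mono)
    fix y :: "real^'d"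
    have "(\<integral>\<^sup>+x. ennreal (?k y) * ennreal (norm (f x - f (x - y))) \<partial>lborel)
        = ennreal (?k y) * nn_int (\<lambda>x. norm (f x - f (x - y)))"
      by (rule nn_integral_cmult) measurable
    also have "\<dots> \<le> ennreal (?k y) * (\<Sum>i\<in>UNIV. ennreal (\<bar>y $ i\<bar> * L1 (partial i f)))"
      by (intro mult_left_mono nn_integral_translate_diff f p) simp
    also have "\<dots> = (\<Sum>i\<in>UNIV. ennreal (L1 (partial i f)) * ennreal (\<bar>y $ i\<bar> * ?k y))"
      unfolding sum_distrib_left by (intro sum.cong refl) (simp add: k0 L1_nonneg mult_ac flip: ennreal_mult)
    finally show "(\<integral>\<^sup>+x. ennreal (?k y) * ennreal (norm (f x - f (x - y))) \<partial>lborel)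
        \<le> (\<Sum>i\<in>UNIV. ennreal (L1 (partial i f)) * ennreal (\<bar>y $ i\<bar> * ?k y))" .
  qed
  also have "\<dots> = (\<Sum>i\<in>UNIV. ennreal (L1 (partial i f)) * nn_int (\<lambda>y. \<bar>y $ i\<bar> * ?k y))"
    by (subst nn_integral_sum) (auto simp: nn_integral_cmult)
  also have "\<dots> \<le> (\<Sum>i\<in>UNIV. ennreal (L1 (partial i f)) * ennreal (jconst / R))"
    by (intro sum_mono mult_left_mono jker_moment R) simp
  also have "\<dots> = ennreal (jconst / R * (\<Sum>i\<in>UNIV. L1 (partial i f)))"
    using R jconst_pos
    by (simp add: sum_distrib_left L1_nonneg mult.commute sum_ennreal flip: ennreal_mult)
  finally show ?thesis
  proof (rule L1_leI[OF int])
    show "0 \<le> jconst / R * (\<Sum>i\<in>UNIV. L1 (partial i f))"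
      by (rule mult_nonneg_nonneg) (use R jconst_pos in \<open>auto intro: sum_nonneg L1_nonneg\<close>)
  qed
qed

section \<open>Smooth functions with all derivatives integrable\<close>

definition sobolev :: "(real^'d::finite \<Rightarrow> complex) \<Rightarrow> bool" where
  "sobolev f \<longleftrightarrow> smooth f \<and> (\<forall>\<alpha>. integrable lborel (multi_deriv \<alpha> f))"

lemma sobolev_smooth: "sobolev f \<Longrightarrow> smooth f"
  and sobolev_integrable: "sobolev f \<Longrightarrow> integrable lborel (multi_deriv \<alpha> f)"
  by (auto simp: sobolev_def)

lemma sobolev_integrable_0: "sobolev f \<Longrightarrow> integrable lborel f"
  using sobolev_integrable[of f "\<lambda>_. 0"] by (simp add: multi_deriv_zero)

lemma sobolev_lincomb: "sobolev f \<Longrightarrow> sobolev g \<Longrightarrow> sobolev (\<lambda>x. a * f x + b * g x)"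
  by (simp add: sobolev_def smooth_lincomb multi_deriv_lincomb)

lemma sobolev_diff: "sobolev f \<Longrightarrow> sobolev g \<Longrightarrow> sobolev (\<lambda>x. f x - g x)"
  using sobolev_lincomb[of f g 1 "-1"] by simp

lemma sobolev_add: "sobolev f \<Longrightarrow> sobolev g \<Longrightarrow> sobolev (\<lambda>x. f x + g x)"
  using sobolev_lincomb[of f g 1 1] by simp

lemma multi_deriv_diff: "smooth f \<Longrightarrow> smooth g \<Longrightarrow>
    multi_deriv \<alpha> (\<lambda>x. f x - g x) = (\<lambda>x. multi_deriv \<alpha> f x - multi_deriv \<alpha> g x)"
  using multi_deriv_lincomb[of f g \<alpha> 1 "-1"] by simp

lemma multi_deriv_add: "smooth f \<Longrightarrow> smooth g \<Longrightarrow>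
    multi_deriv \<alpha> (\<lambda>x. f x + g x) = (\<lambda>x. multi_deriv \<alpha> f x + multi_deriv \<alpha> g x)"
  using multi_deriv_lincomb[of f g \<alpha> 1 1] by simp

lemma L1_multi_deriv_add_le:
  assumes f: "sobolev f" and g: "sobolev g"
  shows "L1 (multi_deriv \<alpha> (\<lambda>x. f x + g x)) \<le> L1 (multi_deriv \<alpha> f) + L1 (multi_deriv \<alpha> g)"
  unfolding multi_deriv_add[OF sobolev_smooth[OF f] sobolev_smooth[OF g]]
  by (intro L1_add_le sobolev_integrable f g)

lemma L1_multi_deriv_scale: "sobolev f \<Longrightarrow> L1 (multi_deriv \<alpha> (\<lambda>x. c * f x)) = norm c * L1 (multi_deriv \<alpha> f)"
  using multi_deriv_lincomb[of f f \<alpha> c 0] by (simp add: sobolev_smooth L1_scale)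

lemma smooth_0: "smooth (\<lambda>_. 0)"
proof -
  have "partial i (\<lambda>_. 0) = (\<lambda>_. 0)" for i :: 'a
    by (rule ext, subst partial_eq[OF has_derivative_const]) simp
  hence "C_times k (\<lambda>_::real^'a. 0)" for k by (induction k) auto
  thus ?thesis by (simp add: smooth_def)
qed

lemma multi_deriv_0: "multi_deriv \<alpha> (\<lambda>_. 0) = (\<lambda>_. 0)"
  using multi_deriv_lincomb[OF smooth_0 smooth_0, of \<alpha> 0 0] by simp

lemma sobolev_0: "sobolev (\<lambda>_. 0)"
  by (simp add: sobolev_def smooth_0 multi_deriv_0)

section \<open>Derivatives of the mollified function\<close>

abbreviation mollify :: "real \<Rightarrow> (real^'d::finite \<Rightarrow> complex) \<Rightarrow> real^'d \<Rightarrow> complex" where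
  "mollify R \<equiv> conv (jker R (\<lambda>_. 0))"

lemma L1_conv_jker:
  fixes f :: "real^'d::finite \<Rightarrow> complex"
  assumes R: "R > 0" and f: "integrable lborel f"
  shows "integrable lborel (conv (jker R \<alpha>) f)"
    and "L1 (conv (jker R \<alpha>) f) \<le> jconst ^ CARD('d) * (4 * R) ^ multi_abs \<alpha> * L1 f"
proof -
  interpret c: conv_pair "jker R \<alpha>" f "jker_sup R \<alpha>"
    by (rule jker_conv_pair[OF R f])
  show "integrable lborel (conv (jker R \<alpha>) f)" by (rule c.integrable_conv[OF jker_nn_integral[OF R]])
  show "L1 (conv (jker R \<alpha>) f) \<le> jconst ^ CARD('d) * (4 * R) ^ multi_abs \<alpha> * L1 f"
    by (rule c.L1_conv_le[OF jker_nn_integral[OF R]])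
      (use R jconst_pos in \<open>auto intro!: mult_nonneg_nonneg zero_le_power less_imp_le\<close>)
qed

text \<open>Non-negativity and unit mass give the constant 1 in place of
  \<open>jconst ^ CARD('d)\<close>, which would otherwise enter at each of the \<open>N\<close>
  iterations.\<close>

lemma L1_mollify:
  fixes f :: "real^'d::finite \<Rightarrow> complex"
  assumes R: "R > 0" and f: "integrable lborel f"
  shows "L1 (mollify R f) \<le> L1 f"
proof -
  interpret c: conv_pair "jker R (\<lambda>_. 0)" f "jker_sup R (\<lambda>_::'d. 0)"
    by (rule jker_conv_pair[OF R f])
  have "nn_int (\<lambda>y. \<bar>jker R (\<lambda>_. 0) (y :: real^'d)\<bar>) \<le> ennreal 1"
    using jker_nn_integral_0[OF R, where ?'d = 'd] by (simp add: jker_0_nonneg[OF R])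
  from c.L1_conv_le[OF this] show ?thesis by simp
qed

text \<open>Derivatives are placed on the kernel: their order is paid for in powers of
  \<open>4 * R\<close>, and \<open>f\<close> enters through its L1 norm alone. This serves the
  approximating part.\<close>

lemma multi_deriv_mollify_kernel:
  assumes R: "R > 0" and f: "integrable lborel f"
  shows "multi_deriv \<alpha> (mollify R f) = conv (jker R \<alpha>) f"
proof (induction \<alpha> rule: multi_index_induct)
  case zero
  show ?case by (simp add: multi_deriv_zero)
next
  case (inc i \<alpha>)
  thus ?case by (simp add: multi_deriv_inc smooth_conv_jker R f partial_conv_jker)
qed

text \<open>Derivatives are placed on \<open>f\<close>: smoothing commutes with differentiation, so
  the gain of a factor 1 - A is available for every derivative of a residual.\<close>

lemma multi_deriv_mollify:
  assumes R: "R > 0" and f: "sobolev f"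
  shows "multi_deriv \<alpha> (mollify R f) = mollify R (multi_deriv \<alpha> f)"
proof (induction \<alpha> rule: multi_index_induct)
  case zero
  show ?case by (simp add: multi_deriv_zero)
next
  case (inc i \<alpha>)
  have sm: "smooth f" and int: "\<And>\<beta>. integrable lborel (multi_deriv \<beta> f)"
    using f by (auto simp: sobolev_def)
  have "multi_deriv (inc i \<alpha>) (mollify R f) = partial i (mollify R (multi_deriv \<alpha> f))"
    by (simp add: multi_deriv_inc smooth_conv_jker R sobolev_integrable_0[OF f] inc.IH)
  also have "\<dots> = conv (jker R (inc i (\<lambda>_. 0))) (multi_deriv \<alpha> f)"
    by (rule partial_conv_jker[OF R int])
  also have "\<dots> = mollify R (partial i (multi_deriv \<alpha> f))"
    using int[of "inc i \<alpha>"] by (intro conv_jker_partial R smooth_multi_deriv sm int) (simp add: multi_deriv_inc sm)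
  finally show ?case by (simp add: multi_deriv_inc sm)
qed

lemma sobolev_mollify: "R > 0 \<Longrightarrow> sobolev f \<Longrightarrow> sobolev (mollify R f)"
  by (simp add: sobolev_def smooth_conv_jker multi_deriv_mollify_kernel L1_conv_jker sobolev_integrable_0[unfolded sobolev_def])

section \<open>Powers of 1 - A and the complementary sums\<close>

fun residual :: "real \<Rightarrow> nat \<Rightarrow> (real^'d::finite \<Rightarrow> complex) \<Rightarrow> real^'d \<Rightarrow> complex" where
  "residual R 0 f = f"
| "residual R (Suc N) f = (\<lambda>x. residual R N f x - mollify R (residual R N f) x)"

fun approx :: "real \<Rightarrow> nat \<Rightarrow> (real^'d::finite \<Rightarrow> complex) \<Rightarrow> real^'d \<Rightarrow> complex" where
  "approx R 0 f = (\<lambda>_. 0)"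
| "approx R (Suc N) f = (\<lambda>x. approx R N f x + mollify R (residual R N f) x)"

lemma approx_plus_residual: "f x = approx R N f x + residual R N f x"
  by (induction N) auto

lemma sobolev_residual: "R > 0 \<Longrightarrow> sobolev f \<Longrightarrow> sobolev (residual R N f)"
  by (induction N) (auto intro: sobolev_diff sobolev_mollify)

lemma sobolev_approx: "R > 0 \<Longrightarrow> sobolev f \<Longrightarrow> sobolev (approx R N f)"
  by (induction N) (auto intro: sobolev_add sobolev_mollify sobolev_residual sobolev_0)

lemma L1_residual_le:
  assumes R: "R > 0" and f: "sobolev f"
  shows "L1 (residual R N f) \<le> 2 ^ N * L1 f"
proof (induction N)
  case (Suc N)
  have int: "integrable lborel (residual R N f)" by (intro sobolev_integrable_0 sobolev_residual R f)
  have "L1 (residual R (Suc N) f) \<le> L1 (residual R N f) + L1 (mollify R (residual R N f))"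
    unfolding residual.simps by (intro L1_diff_le int L1_conv_jker R)
  also have "L1 (mollify R (residual R N f)) \<le> L1 (residual R N f)" by (rule L1_mollify[OF R int])
  finally show ?case using Suc by simp
qed simp

lemma L1_multi_deriv_approx:
  fixes f :: "real^'d::finite \<Rightarrow> complex"
  assumes R: "R > 0" and f: "sobolev f"
  shows "L1 (multi_deriv \<alpha> (approx R N f)) \<le> jconst ^ CARD('d) * (4 * R) ^ multi_abs \<alpha> * (2 ^ N * L1 f)"
proof -
  let ?B = "jconst ^ CARD('d) * (4 * R) ^ multi_abs \<alpha>"
  have B: "0 \<le> ?B" using R jconst_pos by simp
  \<comment> \<open>The exact geometric sum makes the induction close; it is weakened to
    \<open>2 ^ N\<close> at the end.\<close>
  have "L1 (multi_deriv \<alpha> (approx R N f)) \<le> ?B * ((2 ^ N - 1) * L1 f)"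
  proof (induction N)
    case 0
    show ?case by (simp add: multi_deriv_0 L1_def)
  next
    case (Suc N)
    have s: "sobolev (residual R N f)" "sobolev (approx R N f)"
      using sobolev_residual sobolev_approx R f by auto
    have int: "integrable lborel (residual R N f)" by (rule sobolev_integrable_0[OF s(1)])
    have "L1 (multi_deriv \<alpha> (approx R (Suc N) f))
        \<le> L1 (multi_deriv \<alpha> (approx R N f)) + L1 (multi_deriv \<alpha> (mollify R (residual R N f)))"
      unfolding approx.simps by (intro L1_multi_deriv_add_le sobolev_mollify R s)
    also have "L1 (multi_deriv \<alpha> (mollify R (residual R N f))) \<le> ?B * L1 (residual R N f)"
      unfolding multi_deriv_mollify_kernel[OF R int] by (rule L1_conv_jker[OF R int])
    also have "?B * L1 (residual R N f) \<le> ?B * (2 ^ N * L1 f)"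
      by (intro mult_left_mono L1_residual_le R f B)
    finally have "L1 (multi_deriv \<alpha> (approx R (Suc N) f)) \<le> ?B * ((2 ^ N - 1) * L1 f) + ?B * (2 ^ N * L1 f)"
      using Suc by linarith
    also have "\<dots> = ?B * ((2 ^ Suc N - 1) * L1 f)" by (simp add: algebra_simps)
    finally show ?case .
  qed
  also have "\<dots> \<le> ?B * (2 ^ N * L1 f)"
    by (intro mult_left_mono mult_right_mono B L1_nonneg) simp
  finally show ?thesis .
qed

text \<open>Each factor 1 - A is traded for one derivative, and the sum over the directions produces
  \<open>CARD('d)\<close>. After \<open>N\<close> factors the bound uses derivatives of
  \<open>f\<close> that are \<open>N\<close> orders higher, without any loss like 2^N.\<close>

lemma L1_multi_deriv_residual:
  fixes f :: "real^'d::finite \<Rightarrow> complex"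
  assumes R: "R > 0" and f: "sobolev f" and b: "\<And>\<alpha>. L1 (multi_deriv \<alpha> f) \<le> b (multi_abs \<alpha>)"
  shows "L1 (multi_deriv \<alpha> (residual R N f)) \<le> (CARD('d) * jconst / R) ^ N * b (multi_abs \<alpha> + N)"
proof (induction N arbitrary: \<alpha>)
  case 0
  show ?case using b by simp
next
  case (Suc N)
  let ?h = "residual R N f"
  let ?q = "CARD('d) * jconst / R"
  have s: "sobolev ?h" by (rule sobolev_residual[OF R f])
  have int: "integrable lborel (partial i (multi_deriv \<alpha> ?h))" for i
    using sobolev_integrable[OF s, of "inc i \<alpha>"] by (simp add: multi_deriv_inc sobolev_smooth[OF s])
  have "multi_deriv \<alpha> (residual R (Suc N) f) = (\<lambda>x. multi_deriv \<alpha> ?h x - mollify R (multi_deriv \<alpha> ?h) x)"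
    unfolding residual.simps multi_deriv_mollify[OF R s, symmetric]
    by (intro multi_deriv_diff sobolev_smooth sobolev_mollify R s)
  hence "L1 (multi_deriv \<alpha> (residual R (Suc N) f)) \<le> jconst / R * (\<Sum>i\<in>UNIV. L1 (partial i (multi_deriv \<alpha> ?h)))"
    using L1_diff_conv_jker[OF R smooth_multi_deriv[OF sobolev_smooth[OF s]] sobolev_integrable[OF s] int] by simp
  also have "\<dots> \<le> jconst / R * (\<Sum>i\<in>(UNIV :: 'd set). ?q ^ N * b (Suc (multi_abs \<alpha>) + N))"
  proof (intro mult_left_mono sum_mono)
    fix i :: 'd
    show "L1 (partial i (multi_deriv \<alpha> ?h)) \<le> ?q ^ N * b (Suc (multi_abs \<alpha>) + N)"
      using Suc[of "inc i \<alpha>"] by (simp only: multi_deriv_inc[OF sobolev_smooth[OF s]] multi_abs_inc)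
    show "0 \<le> jconst / R" using R jconst_pos by simp
  qed
  also have "\<dots> = ?q ^ Suc N * b (multi_abs \<alpha> + Suc N)" by simp
  finally show ?case .
qed

section \<open>The decomposition in the inductive system\<close>

context weight
begin

abbreviation growth :: "nat \<Rightarrow> ('d::finite \<Rightarrow> nat) \<Rightarrow> real" where
  "growth n \<alpha> \<equiv> exp (psi_star \<omega> (real n * real (multi_abs \<alpha>)) / real n)"

lemma weighted_L1_eq:
  "weighted_L1 \<omega> n f \<alpha> = L1 (multi_deriv \<alpha> f) * exp (- (psi_star \<omega> (real n * real (multi_abs \<alpha>)) / real n))"
  by (simp add: weighted_L1_def L1_def)

lemma DL1_iff: "f \<in> DL1 \<omega> n \<longleftrightarrow> sobolev f \<and> bdd_above (range (weighted_L1 \<omega> n f))"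
  by (auto simp: DL1_def sobolev_def)

lemma L1_multi_deriv_le_DL1_norm:
  assumes "f \<in> DL1 \<omega> n"
  shows "L1 (multi_deriv \<alpha> f) \<le> DL1_norm \<omega> n f * growth n \<alpha>"
proof -
  have "weighted_L1 \<omega> n f \<alpha> \<le> DL1_norm \<omega> n f"
    unfolding DL1_norm_def using assms by (intro cSUP_upper) (auto simp: DL1_iff)
  thus ?thesis unfolding weighted_L1_eq by (simp add: exp_minus field_simps)
qed

lemma DL1_I:
  assumes f: "sobolev f"
    and b: "\<And>\<alpha>. L1 (multi_deriv \<alpha> f) \<le> B * growth n \<alpha>"
  shows "f \<in> DL1 \<omega> n" "DL1_norm \<omega> n f \<le> B"
proof -
  have le: "weighted_L1 \<omega> n f \<alpha> \<le> B" for \<alpha>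
    using b[of \<alpha>] unfolding weighted_L1_eq by (simp add: exp_minus field_simps)
  show "f \<in> DL1 \<omega> n" unfolding DL1_iff using f bdd_aboveI2[of UNIV "weighted_L1 \<omega> n f" B, OF le] by blast
  show "DL1_norm \<omega> n f \<le> B" unfolding DL1_norm_def using le by (intro cSUP_least) auto
qed

lemma subspace_DL1: "complex_subspace (DL1 \<omega> n :: (real^'d::finite \<Rightarrow> complex) set)"
  unfolding complex_subspace_def
proof (intro conjI ballI allI)
  show "(\<lambda>_. 0) \<in> DL1 \<omega> n"
    by (rule DL1_I[OF sobolev_0, of 0]) (simp add: multi_deriv_0 L1_def)
  fix f :: "real^'d \<Rightarrow> complex" assume f: "f \<in> DL1 \<omega> n"
  hence sf: "sobolev f" by (simp add: DL1_iff)
  show "(\<lambda>x. c * f x) \<in> DL1 \<omega> n" for c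
  proof (rule DL1_I[where B = "norm c * DL1_norm \<omega> n f"])
    show "sobolev (\<lambda>x. c * f x)" using sobolev_lincomb[OF sf sf, of c 0] by simp
    show "L1 (multi_deriv \<alpha> (\<lambda>x. c * f x)) \<le> norm c * DL1_norm \<omega> n f * growth n \<alpha>" for \<alpha>
      using mult_left_mono[OF L1_multi_deriv_le_DL1_norm[OF f, of \<alpha>], of "norm c"]
      by (simp add: L1_multi_deriv_scale[OF sf] mult.assoc)
  qed
  fix g :: "real^'d \<Rightarrow> complex" assume g: "g \<in> DL1 \<omega> n"
  hence sg: "sobolev g" by (simp add: DL1_iff)
  show "(\<lambda>x. f x + g x) \<in> DL1 \<omega> n"
  proof (rule DL1_I[where B = "DL1_norm \<omega> n f + DL1_norm \<omega> n g"])
    show "sobolev (\<lambda>x. f x + g x)" by (rule sobolev_add[OF sf sg])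
    show "L1 (multi_deriv \<alpha> (\<lambda>x. f x + g x)) \<le> (DL1_norm \<omega> n f + DL1_norm \<omega> n g) * growth n \<alpha>" for \<alpha>
      using L1_multi_deriv_add_le[OF sf sg, of \<alpha>] L1_multi_deriv_le_DL1_norm[OF f, of \<alpha>]
        L1_multi_deriv_le_DL1_norm[OF g, of \<alpha>]
      by (simp add: distrib_right)
  qed
qed

lemma seminorm_DL1: "seminorm_on (DL1 \<omega> n :: (real^'d::finite \<Rightarrow> complex) set) (DL1_norm \<omega> n)"
proof -
  have "seminorm_on (DL1 \<omega> n) (\<lambda>f :: real^'d \<Rightarrow> complex. SUP \<alpha>. weighted_L1 \<omega> n f \<alpha>)"
  proof (rule seminorm_SUP[OF subspace_DL1])
    fix \<alpha> :: "'d \<Rightarrow> nat"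
    let ?e = "exp (- (psi_star \<omega> (real n * real (multi_abs \<alpha>)) / real n))"
    show "seminorm_on (DL1 \<omega> n) (\<lambda>f. weighted_L1 \<omega> n f \<alpha>)"
      unfolding seminorm_on_def weighted_L1_eq
    proof (intro conjI ballI allI)
      fix f :: "real^'d \<Rightarrow> complex" assume "f \<in> DL1 \<omega> n"
      hence sf: "sobolev f" by (simp add: DL1_iff)
      show "0 \<le> L1 (multi_deriv \<alpha> f) * ?e" by (simp add: L1_nonneg)
      show "L1 (multi_deriv \<alpha> (\<lambda>x. c * f x)) * ?e = norm c * (L1 (multi_deriv \<alpha> f) * ?e)" for c
        by (simp add: L1_multi_deriv_scale[OF sf])
      fix g :: "real^'d \<Rightarrow> complex" assume "g \<in> DL1 \<omega> n"
      hence sg: "sobolev g" by (simp add: DL1_iff)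
      show "L1 (multi_deriv \<alpha> (\<lambda>x. f x + g x)) * ?e \<le> L1 (multi_deriv \<alpha> f) * ?e + L1 (multi_deriv \<alpha> g) * ?e"
        unfolding distrib_right[symmetric] by (intro mult_right_mono L1_multi_deriv_add_le sf sg) simp
    qed
  qed (auto simp: DL1_iff)
  moreover have "DL1_norm \<omega> n = (\<lambda>f :: real^'d \<Rightarrow> complex. SUP \<alpha>. weighted_L1 \<omega> n f \<alpha>)"
    by (rule ext) (simp add: DL1_norm_def)
  ultimately show ?thesis by simp
qed

lemma DL1_mono:
  assumes n: "1 \<le> n" "n \<le> m" and f: "f \<in> DL1 \<omega> n"
  shows "f \<in> DL1 \<omega> m" "DL1_norm \<omega> m f \<le> DL1_norm \<omega> n f"
proof -
  have sf: "sobolev f" using f by (simp add: DL1_iff)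
  have nn: "0 \<le> DL1_norm \<omega> n f" by (rule seminorm_nonneg[OF seminorm_DL1 f])
  have "L1 (multi_deriv \<alpha> f) \<le> DL1_norm \<omega> n f * growth m \<alpha>" for \<alpha>
    by (rule order_trans[OF L1_multi_deriv_le_DL1_norm[OF f]])
      (intro mult_left_mono nn, simp add: psi_star_scale_mono[OF n])
  from DL1_I[OF sf this] show "f \<in> DL1 \<omega> m" "DL1_norm \<omega> m f \<le> DL1_norm \<omega> n f" .
qed

sublocale DL1: lb_system "DL1 \<omega> :: nat \<Rightarrow> (real^'d::finite \<Rightarrow> complex) set" "DL1_norm \<omega>"
  by unfold_locales (auto intro: subspace_DL1 seminorm_DL1 DL1_mono)

text \<open>\<open>L\<close> and \<open>A\<close> are fixed before \<open>m\<close>: the part in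
  step 1 sees \<open>f\<close> only through \<open>L1 f \<le> 1\<close>, which holds in every unit
  ball because \<open>psi_star \<omega> 0 = 0\<close>. The factor exp x in the other bound is the
  rounding loss of \<open>optimal_order\<close>.\<close>

lemma decomposition:
  "\<exists>L>0. \<exists>A\<ge>0. \<forall>m\<ge>1. \<forall>x\<ge>0. \<forall>f :: real^'d::finite \<Rightarrow> complex. f \<in> DL1 \<omega> m \<longrightarrow> DL1_norm \<omega> m f \<le> 1 \<longrightarrow>
      DL1.splits (2 * m) (A * exp (L * \<omega> (exp x))) (exp (x - \<omega> (exp x) / real (2 * m))) f"
proof -
  \<comment> \<open>The second entry makes every residual step gain a factor of at most exp(-x); the
    first ensures 4 R >= 1, so that log(4 R) is admissible in \<open>young\<close>.\<close>
  define a where "a = max 1 (CARD('d) * jconst)"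
  have a: "a \<ge> 1" "CARD('d) * jconst \<le> a" by (auto simp: a_def)
  have e0: "exp (1::real) \<ge> 0" "4 * a \<ge> 0" using a by auto
  \<comment> \<open>\<open>L1'\<close> controls \<open>N\<close>, which is at most
    \<open>\<omega> (exp 1 * exp x)\<close>, and thereby 2^N; \<open>L2'\<close> controls the weight
    function at 4 R.\<close>
  obtain L1' where L1': "L1' \<ge> 0" "\<And>t. t \<ge> 0 \<Longrightarrow> \<omega> (exp 1 * t) \<le> L1' * (\<omega> t + 1)"
    using dilation[OF e0(1)] by blast
  obtain L2' where L2': "L2' \<ge> 0" "\<And>t. t \<ge> 0 \<Longrightarrow> \<omega> (4 * a * t) \<le> L2' * (\<omega> t + 1)"
    using dilation[OF e0(2)] by blast
  define L where "L = L1' + L2' + 1"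
  \<comment> \<open>The factor \<open>exp L\<close> takes up the summand 1 in
    \<open>L * (s + 1)\<close>.\<close>
  define A where "A = jconst ^ CARD('d) * exp L"
  show ?thesis
  proof (intro exI conjI allI impI)
    show L: "L > 0" using L1' L2' by (simp add: L_def)
    show "A \<ge> 0" using jconst_pos by (simp add: A_def)
    fix m :: nat and x :: real and f :: "real^'d \<Rightarrow> complex"
    assume m: "1 \<le> m" and x: "0 \<le> x" and f: "f \<in> DL1 \<omega> m" "DL1_norm \<omega> m f \<le> 1"
    have m2: "1 \<le> 2 * m" using m by simp
    have m0: "0 < real m" using m by simp
    define s where "s = \<omega> (exp x)"
    define R where "R = a * exp x"
    have R: "R > 0" using a by (simp add: R_def)
    obtain N where N: "real N \<le> \<omega> (exp (x + 1))"
      "psi_star \<omega> (real (2 * m) * real N) / real (2 * m) - real N * x \<le> x - \<omega> (exp x) / real (2 * m)"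
      by (rule optimal_order[OF x m2])
    have sf: "sobolev f" using f by (simp add: DL1_iff)
    have fb: "L1 (multi_deriv \<alpha> f) \<le> growth m \<alpha>" for \<alpha>
    proof -
      have "DL1_norm \<omega> m f * growth m \<alpha>
          \<le> 1 * growth m \<alpha>"
        by (intro mult_right_mono f) simp
      thus ?thesis using L1_multi_deriv_le_DL1_norm[OF f(1), of \<alpha>] by linarith
    qed
    have f1: "L1 f \<le> 1" using fb[of "\<lambda>_. 0"] by (simp add: multi_deriv_zero multi_abs_def psi_star_zero)
    let ?g = "approx R N f" and ?h = "residual R N f"
    have g: "L1 (multi_deriv \<alpha> ?g) \<le> (A * exp (L * s)) * growth 1 \<alpha>" for \<alpha>
    proof -
      have xe: "exp (x + 1) = exp 1 * exp x" by (simp add: exp_add)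
      have "(2::real) ^ N \<le> exp 1 ^ N" using exp_ge_add_one_self[of 1] by (intro power_mono) auto
      also have "\<dots> = exp (real N)" by (simp add: exp_of_nat_mult[symmetric])
      also have "\<dots> \<le> exp (L1' * (s + 1))" using N(1) L1'(2)[of "exp x"] by (simp add: xe s_def)
      finally have p2: "(2::real) ^ N \<le> exp (L1' * (s + 1))" .
      have R1: "1 \<le> 4 * R" using a x mult_mono[of 1 a 1 "exp x"] by (simp add: R_def)
      \<comment> \<open>Young's inequality at log(4 R) converts the geometric growth of derivatives
        into the weight of step 1.\<close>
      have "ln (4 * R) * real (multi_abs \<alpha>) \<le> psi_star \<omega> (real (multi_abs \<alpha>)) + \<omega> (exp (ln (4 * R)))"
        by (rule young) (use R1 in simp)
      also have "\<omega> (exp (ln (4 * R))) \<le> L2' * (s + 1)"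
        using L2'(2)[of "exp x"] R by (simp add: R_def s_def mult.assoc)
      finally have "real (multi_abs \<alpha>) * ln (4 * R) \<le> psi_star \<omega> (real (multi_abs \<alpha>)) + L2' * (s + 1)"
        by (simp add: mult.commute)
      moreover have "(4 * R) ^ multi_abs \<alpha> = exp (real (multi_abs \<alpha>) * ln (4 * R))"
        using R by (simp add: exp_of_nat_mult)
      ultimately have pR: "(4 * R) ^ multi_abs \<alpha> \<le> exp (psi_star \<omega> (real (multi_abs \<alpha>)) + L2' * (s + 1))" by simp
      have jc: "0 \<le> jconst ^ CARD('d)" using jconst_pos by simp
      have "L1 (multi_deriv \<alpha> ?g) \<le> jconst ^ CARD('d) * (4 * R) ^ multi_abs \<alpha> * (2 ^ N * L1 f)"
        by (rule L1_multi_deriv_approx[OF R sf])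
      also have "\<dots> \<le> jconst ^ CARD('d) * exp (psi_star \<omega> (real (multi_abs \<alpha>)) + L2' * (s + 1)) * (exp (L1' * (s + 1)) * 1)"
        using R by (intro mult_mono order_refl pR p2 f1 jc mult_nonneg_nonneg L1_nonneg) auto
      also have "\<dots> = jconst ^ CARD('d) * exp ((L1' + L2') * (s + 1)) * exp (psi_star \<omega> (real (multi_abs \<alpha>)))"
        by (simp add: algebra_simps flip: exp_add)
      also have "\<dots> \<le> jconst ^ CARD('d) * exp (L * (s + 1)) * exp (psi_star \<omega> (real (multi_abs \<alpha>)))"
      proof (intro mult_right_mono mult_left_mono jc)
        have "0 \<le> s" unfolding s_def by (rule nonneg) simp
        thus "exp ((L1' + L2') * (s + 1)) \<le> exp (L * (s + 1))" by (simp add: L_def mult_right_mono)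
      qed simp
      also have "\<dots> = (A * exp (L * s)) * growth 1 \<alpha>"
        by (simp add: A_def algebra_simps exp_add)
      finally show ?thesis .
    qed
    have h: "L1 (multi_deriv \<alpha> ?h) \<le> exp (x - s / real (2 * m)) * growth (2 * m) \<alpha>" for \<alpha>
    proof -
      let ?\<Psi> = "\<lambda>k. psi_star \<omega> (real (2 * m) * real k) / real (2 * m)"
      have "CARD('d) * jconst / R \<le> a / R" using a R by (intro divide_right_mono) auto
      also have "\<dots> = exp (- x)" using a by (simp add: R_def exp_minus field_simps)
      finally have "(CARD('d) * jconst / R) ^ N \<le> exp (- x) ^ N"
        using R jconst_pos by (intro power_mono) auto
      also have "\<dots> = exp (- (real N * x))" by (simp add: exp_of_nat_mult[symmetric])
      finally have q: "(CARD('d) * jconst / R) ^ N \<le> exp (- (real N * x))" .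
      \<comment> \<open>Convexity separates the order of the derivative from the \<open>N\<close>
        derivatives spent, at the price of doubling the index.\<close>
      have "2 * psi_star \<omega> (real m * real (multi_abs \<alpha>) + real m * real N)
          \<le> psi_star \<omega> (2 * (real m * real (multi_abs \<alpha>))) + psi_star \<omega> (2 * (real m * real N))"
        by (rule psi_star_midpoint)
      hence mid: "psi_star \<omega> (real m * real (multi_abs \<alpha> + N)) / real m \<le> ?\<Psi> (multi_abs \<alpha>) + ?\<Psi> N"
        using m0 by (simp add: field_simps)
      have "L1 (multi_deriv \<alpha> ?h) \<le> (CARD('d) * jconst / R) ^ N * exp (psi_star \<omega> (real m * real (multi_abs \<alpha> + N)) / real m)"
        by (rule L1_multi_deriv_residual[OF R sf fb])
      also have "\<dots> \<le> exp (- (real N * x)) * exp (?\<Psi> (multi_abs \<alpha>) + ?\<Psi> N)"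
        using mid by (intro mult_mono q) auto
      also have "\<dots> = exp (?\<Psi> N - real N * x) * exp (?\<Psi> (multi_abs \<alpha>))"
        by (simp add: algebra_simps flip: exp_add)
      also have "\<dots> \<le> exp (x - s / real (2 * m)) * exp (?\<Psi> (multi_abs \<alpha>))"
        using N(2) by (intro mult_right_mono) (simp_all add: s_def)
      finally show ?thesis .
    qed
    have "f = (\<lambda>y. ?g y + ?h y)" by (rule ext) (rule approx_plus_residual)
    thus "DL1.splits (2 * m) (A * exp (L * \<omega> (exp x))) (exp (x - \<omega> (exp x) / real (2 * m))) f"
      unfolding DL1.splits_def using DL1_I(2)[OF sobolev_approx[OF R sf] g] DL1_I(2)[OF sobolev_residual[OF R sf] h]
      unfolding s_def
      by (intro bexI[OF _ DL1_I(1)[OF sobolev_approx[OF R sf] g]]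
          bexI[OF _ DL1_I(1)[OF sobolev_residual[OF R sf] h]] conjI)
  qed
qed

lemma DN_B_dual:
  "satisfies_DN_underlined (top_dual (DL1.T :: (real^'d::finite \<Rightarrow> complex) topology)) (strong_dual_topology DL1.T)"
proof -
  obtain L A :: real where L: "L > 0" "A \<ge> 0"
    and dec: "\<forall>m\<ge>1. \<forall>x\<ge>0. \<forall>f :: real^'d \<Rightarrow> complex. f \<in> DL1 \<omega> m \<longrightarrow> DL1_norm \<omega> m f \<le> 1 \<longrightarrow>
      DL1.splits (2 * m) (A * exp (L * \<omega> (exp x))) (exp (x - \<omega> (exp x) / real (2 * m))) f"
    using decomposition[where ?'d = 'd] by (elim exE conjE) (rule that)
  show ?thesis
  proof (rule DL1.DN_strong_dual[OF L(1)])
    fix m :: nat assume m: "1 \<le> m"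
    \<comment> \<open>Half of the decay rate 1 / (2 m); the other half absorbs the factor exp x by
      means of \<open>le_eps\<close>.\<close>
    define b where "b = 1 / (4 * real m)"
    have b: "b > 0" using m by (simp add: b_def)
    obtain C0 where C0: "C0 \<ge> 0" "\<And>x. x \<ge> 0 \<Longrightarrow> x \<le> b * \<omega> (exp x) + C0" using le_eps[OF b] by blast
    define C where "C = A + exp C0"
    have C: "C > 0" using L(2) by (simp add: C_def add_nonneg_pos)
    have main: "DL1.splits (2 * m) (C * exp (L * s)) (C * exp (- (b * s))) f"
      if s: "s \<ge> 0" and f: "f \<in> DL1.unit_ball m" for s and f :: "real^'d \<Rightarrow> complex"
    proof -
      obtain x where x: "x \<ge> 0" "\<omega> (exp x) = s" by (rule attains[OF s])
      have fm: "f \<in> DL1 \<omega> m" "DL1_norm \<omega> m f \<le> 1" using f by (simp_all add: DL1.unit_ball_def)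
      have 1: "A * exp (L * s) \<le> C * exp (L * s)" by (intro mult_right_mono) (auto simp: C_def)
      have "s / real (2 * m) = 2 * (b * s)" using m by (simp add: b_def)
      hence "exp (x - s / real (2 * m)) \<le> exp (C0 + - (b * s))" using C0(2)[OF x(1)] by (simp add: x(2))
      also have "\<dots> = exp C0 * exp (- (b * s))" by (rule exp_add)
      also have "\<dots> \<le> C * exp (- (b * s))" using L(2) by (intro mult_right_mono) (auto simp: C_def)
      finally show ?thesis by (rule DL1.splits_mono[OF dec[rule_format, OF m x(1) fm, unfolded x(2)] 1])
    qed
    show "\<exists>k\<ge>m. \<exists>b>0. \<exists>C>0. \<forall>s\<ge>0. \<forall>f\<in>(DL1.unit_ball m :: (real^'d \<Rightarrow> complex) set).
      DL1.splits k (C * exp (L * s)) (C * exp (- (b * s))) f"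
    proof (intro exI conjI allI impI ballI)
      show "m \<le> 2 * m" "b > 0" "C > 0" using b C by auto
    qed (rule main)
  qed
qed

end

theorem theorem4p4:
  fixes \<omega> :: "real \<Rightarrow> real"
  assumes "weight_function \<omega>"
  shows "frechet_space (B_dual \<omega> :: ((real^'d::finite \<Rightarrow> complex) \<Rightarrow> complex) set)
           (B_dual_topology \<omega>) \<and>
         satisfies_DN_underlined (B_dual \<omega> :: ((real^'d \<Rightarrow> complex) \<Rightarrow> complex) set)
           (B_dual_topology \<omega>)"
proof -
  interpret weight \<omega> by unfold_locales (rule assms)
  show ?thesis
    unfolding B_dual_def B_dual_topology_def DL1_ind_topology_def DL1.T_eq[symmetric]
    by (intro conjI DL1.frechet_strong_dual DN_B_dual)
qed

end
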